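(* (i) Let $(A,\Delta)$ be a weak Hopf algebra. Then it is a weak multiplier Hopf algebra. (ii) Conversely, if $(A,\Delta)$ is a regular weak multiplier Hopf algebra and if the underlying algebra $A$ is unital, then $(A,\Delta)$ is a weak Hopf algebra.
   Context: Weak Hopf algebra: a unital algebra $A$ over $\mathbb C$ with a coassociative multiplicative linear map $\Delta:A\to A\otimes A$ (not necessarily unital), a counit $\varepsilon$ (i.e. $(\varepsilon\otimes\iota)\Delta=\iota=(\iota\otimes\varepsilon)\Delta$), such that $(\Delta\otimes\iota)\Delta(1)=(\Delta(1)\otimes1)(1\otimes\Delta(1))=(1\otimes\Delta(1))(\Delta(1)\otimes1)$ and $\varepsilon(abc)=\sum\varepsilon(ab_{(1)})\varepsilon(b_{(2)}c)=\sum\varepsilon(ab_{(2)})\varepsilon(b_{(1)}c)$ for all $a,b,c$, and with a linear antipode $S:A\to A$ satisfying $\sum a_{(1)}S(a_{(2)})=(\varepsilon\otimes\iota)(\Delta(1)(a\otimes1))$, $\sum S(a_{(1)})a_{(2)}=(\iota\otimes\varepsilon)((1\otimes a)\Delta(1))$ and $\sum S(a_{(1)})a_{(2)}S(a_{(3)})=S(a)$ for all $a$. General conventions. Algebras are associative over $\mathbb C$, not necessarily unital, with non-degenerate product ($ab=0$ for all $b$ implies $a=0$, and $ba=0$ for all $b$ implies $a=0$). $M(A)$ is the multiplier algebra; $L(A)$ is the algebra of left multipliers (linear $\lambda:A\to A$ with $\lambda(ab)=\lambda(a)b$), and one writes $\lambda a$ for $\lambda(a)$. $\iota$ is the identity map.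 Expressions such as $XY$ for subspaces denote linear spans of products. A coproduct on $A$ is a homomorphism $\Delta:A\to M(A\otimes A)$ with $\Delta(a)(1\otimes b)\in A\otimes A$ and $(a\otimes 1)\Delta(b)\in A\otimes A$ for all $a,b$, and $(a\otimes1\otimes1)(\Delta\otimes\iota)(\Delta(b)(1\otimes c))=(\iota\otimes\Delta)((a\otimes1)\Delta(b))(1\otimes1\otimes c)$ for all $a,b,c\in A$. It is full if the smallest subspaces $V,W\subseteq A$ with $\Delta(A)(1\otimes A)\subseteq V\otimes A$ and $(A\otimes1)\Delta(A)\subseteq A\otimes W$ are both equal to $A$. A counit is a linear map $\varepsilon:A\to\mathbb C$ with $(\varepsilon\otimes\iota)(\Delta(a)(1\otimes b))=ab$ and $(\iota\otimes\varepsilon)((a\otimes1)\Delta(b))=ab$ for all $a,b$ (unique when $\Delta$ is full). Put $T_1(a\otimes b)=\Delta(a)(1\otimes b)$ and $T_2(a\otimes b)=(a\otimes1)\Delta(b)$, linear maps $A\otimes A\to A\otimes A$. Weak multiplier Hopf algebra: a pair $(A,\Delta)$ where $A$ is non-degenerate and idempotent ($A^2=A$), $\Delta$ is a full coproduct with a counit $\varepsilon$, and the following hold. (1) There is an idempotent $E\in M(A\otimes A)$ with $\mathrm{Ran}(T_1)=E(A\otimes A)$ and $\mathrm{Ran}(T_2)=(A\otimes A)E$. (Then $E$ is unique, and $\Delta\otimes\iota$ and $\iota\otimes\Delta$ extend uniquely to homomorphisms $M(A\otimes A)\to M(A\otimes A\otimes A)$ sending $1$ to $E\otimes1$ and to $1\otimes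 E$, respectively.) (2) $(\iota\otimes\Delta)(E)=(\Delta\otimes\iota)(E)=(1\otimes E)(E\otimes1)=(E\otimes1)(1\otimes E)$. (3) There are a right multiplier $F_1$ of $A\otimes A^{\mathrm{op}}$ and a left multiplier $F_2$ of $A^{\mathrm{op}}\otimes A$, i.e. linear maps $A\otimes A\to A\otimes A$, $a\otimes b\mapsto (a\otimes1)F_i(1\otimes b)$, satisfying $(a'a\otimes1)F_i(1\otimes bb')=(a'\otimes1)\big((a\otimes1)F_i(1\otimes b)\big)(1\otimes b')$, such that $E_{13}(F_1\otimes1)=E_{13}(1\otimes E)$ and $(1\otimes F_2)E_{13}=(E\otimes1)E_{13}$. Explicitly, for all $a,b,c,d\in A$: if $(a\otimes c)E=\sum_i p_i\otimes q_i$, then $\sum_i (p_i\otimes1)F_1(1\otimes b)\otimes q_id=\sum_i p_i\otimes(1\otimes q_i)E(b\otimes d)$; and if $E(a\otimes c)=\sum_i p_i\otimes q_i$, then $\sum_i dp_i\otimes(b\otimes1)F_2(1\otimes q_i)=\sum_i (d\otimes b)E(p_i\otimes1)\otimes q_i$. (4) $\mathrm{Ker}(T_1)=(A\otimes1)(1-F_1)(1\otimes A)$ and $\mathrm{Ker}(T_2)=(A\otimes1)(1-F_2)(1\otimes A)$. The elements $E,F_1,F_2$ are uniquely determined by $\Delta$. Antipode: let $R_1$ be the unique linear map on $A\otimes A$ with $T_1R_1T_1=T_1$, $R_1T_1R_1=R_1$, $T_1R_1(a\otimes b)=E(a\otimes b)$ and $R_1T_1(a\otimes b)=(a\otimes1)F_1(1\otimes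 b)$. The antipode $S$ is determined by $S(a)b=(\varepsilon\otimes\iota)R_1(a\otimes b)$ for $a,b\in A$ (a priori $S(a)\in L(A)$). The weak multiplier Hopf algebra is called regular if $S$ maps $A$ to itself and is bijective from $A$ to $A$. *)

theory Defs
  imports Complex_Main "HOL-Library.Poly_Mapping"
begin

section \<open>Complex vector spaces and algebras\<close>

class scaleC =
  fixes scaleC :: "complex \<Rightarrow> 'a \<Rightarrow> 'a"  (infixr \<open>*\<^sub>C\<close> 75)

class complex_vector = scaleC + ab_group_add +
  assumes scaleC_add_right: "c *\<^sub>C (x + y) = c *\<^sub>C x + c *\<^sub>C y"
    and scaleC_add_left: "(c + d) *\<^sub>C x = c *\<^sub>C x + d *\<^sub>C x"
    and scaleC_scaleC: "c *\<^sub>C d *\<^sub>C x = (c * d) *\<^sub>C x"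
    and scaleC_one: "1 *\<^sub>C x = x"

text \<open>The class \<open>ring\<close> does not require a unit.\<close>

class complex_algebra = complex_vector + ring +
  assumes mult_scaleC_left: "(c *\<^sub>C x) * y = c *\<^sub>C (x * y)"
    and mult_scaleC_right: "x * (c *\<^sub>C y) = c *\<^sub>C (x * y)"

global_interpretation complex_vector: vector_space "scaleC :: complex \<Rightarrow> 'a \<Rightarrow> 'a::complex_vector"
  by unfold_locales (simp_all add: scaleC_add_right scaleC_add_left scaleC_scaleC scaleC_one)

abbreviation clinear :: "('a::complex_vector \<Rightarrow> 'b::complex_vector) \<Rightarrow> bool"
  where "clinear \<equiv> Vector_Spaces.linear scaleC scaleC"

abbreviation csubspace :: "'a::complex_vector set \<Rightarrow> bool"
  where "csubspace \<equiv> module.subspace scaleC"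

abbreviation cspan :: "'a::complex_vector set \<Rightarrow> 'a set"
  where "cspan \<equiv> module.span scaleC"

lemma clinearI:
  "(\<And>x y. f (x + y) = f x + f y) \<Longrightarrow> (\<And>c x. f (c *\<^sub>C x) = c *\<^sub>C f x) \<Longrightarrow> clinear f"
  by (intro Vector_Spaces.linear.intro module_hom.intro module_hom_axioms.intro
      complex_vector.vector_space_axioms complex_vector.module_axioms)

lemma clinear_add: "clinear f \<Longrightarrow> f (x + y) = f x + f y"
  by (simp add: Vector_Spaces.linear_iff)

lemma clinear_scale: "clinear f \<Longrightarrow> f (c *\<^sub>C x) = c *\<^sub>C f x"
  by (simp add: Vector_Spaces.linear_iff)

lemma clinear_0: "clinear f \<Longrightarrow> f 0 = 0"
  using clinear_scale[of f 0 0] by simp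

lemma clinear_minus: "clinear f \<Longrightarrow> f (- x) = - f x"
  using clinear_scale[of f "-1" x] by (simp add: complex_vector.scale_minus_left)

lemma clinear_diff: "clinear f \<Longrightarrow> f (x - y) = f x - f y"
  using clinear_add[of f x "- y"] by (simp add: clinear_minus)

lemma clinear_sum: "clinear f \<Longrightarrow> f (\<Sum>i\<in>I. g i) = (\<Sum>i\<in>I. f (g i))"
  by (induction I rule: infinite_finite_induct) (simp_all add: clinear_0 clinear_add)

definition cbilinear :: "('a::complex_vector \<Rightarrow> 'b::complex_vector \<Rightarrow> 'c::complex_vector) \<Rightarrow> bool"
  where "cbilinear f \<longleftrightarrow> (\<forall>a. clinear (\<lambda>b. f a b)) \<and> (\<forall>b. clinear (\<lambda>a. f a b))"

lemma cbilinearI: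
  "(\<And>a. clinear (\<lambda>b. f a b)) \<Longrightarrow> (\<And>b. clinear (\<lambda>a. f a b)) \<Longrightarrow> cbilinear f"
  by (simp add: cbilinear_def)

lemma clinear_intros:
  "clinear (\<lambda>x. x)"
  "clinear f \<Longrightarrow> clinear g \<Longrightarrow> clinear (\<lambda>x. f x + g x)"
  "clinear f \<Longrightarrow> clinear (\<lambda>x. d *\<^sub>C f x)"
  "clinear (\<lambda>x. 0)"
  "clinear f \<Longrightarrow> clinear (\<lambda>x. - f x)"
  "clinear f \<Longrightarrow> clinear g \<Longrightarrow> clinear (\<lambda>x. f x - g x)"
  by (intro clinearI;
      simp add: clinear_add clinear_scale complex_vector.scale_right_diff_distrib algebra_simps
        complex_vector.scale_left_commute)+

lemma clinear_mult_intros: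
  fixes a :: "'a::complex_algebra"
  shows "clinear f \<Longrightarrow> clinear (\<lambda>x. a * f x)"
    and "clinear f \<Longrightarrow> clinear (\<lambda>x. f x * a)"
  by (intro clinearI;
      simp add: clinear_add clinear_scale algebra_simps mult_scaleC_left mult_scaleC_right)+

lemma clinear_compose: "clinear f \<Longrightarrow> clinear g \<Longrightarrow> clinear (\<lambda>x. f (g x))"
  by (intro clinearI; simp add: clinear_add clinear_scale)


instantiation complex :: complex_algebra
begin

definition scaleC_complex :: "complex \<Rightarrow> complex \<Rightarrow> complex"
  where "scaleC_complex = (*)"

instance by intro_classes (simp_all add: scaleC_complex_def algebra_simps)

end

instantiation poly_mapping :: (type, complex_vector) complex_vector
begin

definition scaleC_poly_mapping :: "complex \<Rightarrow> ('a \<Rightarrow>\<^sub>0 'b) \<Rightarrow> ('a \<Rightarrow>\<^sub>0 'b)"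
  where "scaleC_poly_mapping c = Poly_Mapping.map (\<lambda>x. c *\<^sub>C x)"

lemma lookup_scaleC: "Poly_Mapping.lookup (c *\<^sub>C p) k = c *\<^sub>C Poly_Mapping.lookup p k"
  by (simp add: scaleC_poly_mapping_def Poly_Mapping.map.rep_eq when_def)

instance
  by intro_classes
    (simp_all add: poly_mapping_eq_iff fun_eq_iff lookup_scaleC lookup_add
      scaleC_add_right scaleC_add_left scaleC_scaleC scaleC_one)

end

section \<open>The algebraic tensor product over the complex numbers\<close>

text \<open>The free vector space on \<open>'a \<times> 'b\<close> modulo the bilinearity relations.\<close>

definition tensor_null :: "('a::complex_vector \<times> 'b::complex_vector \<Rightarrow>\<^sub>0 complex) set"
  where "tensor_null = cspan
    ({Poly_Mapping.single (a + a', b) 1 - Poly_Mapping.single (a, b) 1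
        - Poly_Mapping.single (a', b) 1 | a a' b. True}
     \<union> {Poly_Mapping.single (a, b + b') 1 - Poly_Mapping.single (a, b) 1
        - Poly_Mapping.single (a, b') 1 | a b b'. True}
     \<union> {Poly_Mapping.single (c *\<^sub>C a, b) 1 - c *\<^sub>C Poly_Mapping.single (a, b) 1 | c a b. True}
     \<union> {Poly_Mapping.single (a, c *\<^sub>C b) 1 - c *\<^sub>C Poly_Mapping.single (a, b) 1 | c a b. True})"

lemma tensor_null_add: "p \<in> tensor_null \<Longrightarrow> q \<in> tensor_null \<Longrightarrow> p + q \<in> tensor_null"
  and tensor_null_diff: "p \<in> tensor_null \<Longrightarrow> q \<in> tensor_null \<Longrightarrow> p - q \<in> tensor_null"
  and tensor_null_scale: "p \<in> tensor_null \<Longrightarrow> c *\<^sub>C p \<in> tensor_null"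
  and tensor_null_0: "0 \<in> tensor_null"
  unfolding tensor_null_def
  by (auto intro: complex_vector.span_add complex_vector.span_diff complex_vector.span_scale
      complex_vector.span_zero)

lemma tensor_null_minus: "p \<in> tensor_null \<Longrightarrow> - p \<in> tensor_null"
  using tensor_null_diff[OF tensor_null_0, of p] by simp

quotient_type (overloaded) ('a, 'b) tensor
  = "'a::complex_vector \<times> 'b::complex_vector \<Rightarrow>\<^sub>0 complex" / "\<lambda>p q. p - q \<in> tensor_null"
proof (rule equivpI)
  show "reflp (\<lambda>p q::('a \<times> 'b \<Rightarrow>\<^sub>0 complex). p - q \<in> tensor_null)"
    by (simp add: reflp_def tensor_null_0)
  show "symp (\<lambda>p q::('a \<times> 'b \<Rightarrow>\<^sub>0 complex). p - q \<in> tensor_null)"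
    using tensor_null_minus by (fastforce simp: symp_def)
  show "transp (\<lambda>p q::('a \<times> 'b \<Rightarrow>\<^sub>0 complex). p - q \<in> tensor_null)"
    by (rule transpI) (use tensor_null_add in fastforce)
qed

instantiation tensor :: (complex_vector, complex_vector) complex_vector
begin

lift_definition zero_tensor :: "('a, 'b) tensor" is 0 .
lift_definition plus_tensor :: "('a, 'b) tensor \<Rightarrow> ('a, 'b) tensor \<Rightarrow> ('a, 'b) tensor" is plus
  using tensor_null_add by (fastforce simp: algebra_simps)
lift_definition minus_tensor :: "('a, 'b) tensor \<Rightarrow> ('a, 'b) tensor \<Rightarrow> ('a, 'b) tensor" is minus
  using tensor_null_diff by (fastforce simp: algebra_simps)
lift_definition uminus_tensor :: "('a, 'b) tensor \<Rightarrow> ('a, 'b) tensor" is uminus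
  using tensor_null_minus by (fastforce simp: algebra_simps)
lift_definition scaleC_tensor :: "complex \<Rightarrow> ('a, 'b) tensor \<Rightarrow> ('a, 'b) tensor" is scaleC
  using tensor_null_scale by (fastforce simp: complex_vector.scale_right_diff_distrib[symmetric])

instance
  by (intro_classes; transfer)
    (simp_all add: algebra_simps tensor_null_0 scaleC_add_right scaleC_add_left scaleC_scaleC scaleC_one)

end

lift_definition tprod :: "'a::complex_vector \<Rightarrow> 'b::complex_vector \<Rightarrow> ('a, 'b) tensor"
    (infixr \<open>\<otimes>\<close> 74)
  is "\<lambda>a b. Poly_Mapping.single (a, b) 1" .

lemma cbilinear_tprod: "cbilinear (\<otimes>)"
proof (intro cbilinearI clinearI)
  fix a a' :: 'a and b b' :: 'b and c
  show "a \<otimes> (b + b') = a \<otimes> b + a \<otimes> b'"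
    by (transfer, unfold tensor_null_def, rule complex_vector.span_base, simp only: diff_diff_eq[symmetric], blast)
  show "(a + a') \<otimes> b = a \<otimes> b + a' \<otimes> b"
    by (transfer, unfold tensor_null_def, rule complex_vector.span_base, simp only: diff_diff_eq[symmetric], blast)
  show "a \<otimes> (c *\<^sub>C b) = c *\<^sub>C (a \<otimes> b)"
    by (transfer, unfold tensor_null_def, rule complex_vector.span_base, blast)
  show "(c *\<^sub>C a) \<otimes> b = c *\<^sub>C (a \<otimes> b)"
    by (transfer, unfold tensor_null_def, rule complex_vector.span_base, blast)
qed

lemma clinear_tprod_intros:
  "clinear f \<Longrightarrow> clinear (\<lambda>x. a \<otimes> f x)"
  "clinear f \<Longrightarrow> clinear (\<lambda>x. f x \<otimes> b)"
  using cbilinear_tprod clinear_compose[of "\<lambda>y. a \<otimes> y" f] clinear_compose[of "\<lambda>y. y \<otimes> b" f]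
  by (auto simp: cbilinear_def)

text \<open>The linear extension of a map to the free vector space, and the linear map on the tensor
  product induced by a bilinear map (no meaning is attached to \<open>tlift f\<close> if \<open>f\<close> is not
  bilinear).\<close>

definition free_ext :: "('a \<Rightarrow> 'b \<Rightarrow> 'c::complex_vector) \<Rightarrow> ('a \<times> 'b \<Rightarrow>\<^sub>0 complex) \<Rightarrow> 'c"
  where "free_ext f p = (\<Sum>(a, b)\<in>Poly_Mapping.keys p. Poly_Mapping.lookup p (a, b) *\<^sub>C f a b)"

definition tlift ::
    "('a::complex_vector \<Rightarrow> 'b::complex_vector \<Rightarrow> 'c::complex_vector) \<Rightarrow> ('a, 'b) tensor \<Rightarrow> 'c"
  where "tlift f t = free_ext f (rep_tensor t)"

lemma free_ext_superset:
  assumes "finite K" "Poly_Mapping.keys p \<subseteq> K"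
  shows "free_ext f p = (\<Sum>(a, b)\<in>K. Poly_Mapping.lookup p (a, b) *\<^sub>C f a b)"
  unfolding free_ext_def
  by (rule sum.mono_neutral_left) (use assms in \<open>auto simp: in_keys_iff\<close>)

lemma clinear_free_ext: "clinear (free_ext f)"
proof (rule clinearI)
  fix p q :: "'a \<times> 'b \<Rightarrow>\<^sub>0 complex" and c
  let ?K = "Poly_Mapping.keys p \<union> Poly_Mapping.keys q"
  have "free_ext f (p + q) = (\<Sum>(a, b)\<in>?K. Poly_Mapping.lookup (p + q) (a, b) *\<^sub>C f a b)"
    by (rule free_ext_superset) (simp_all add: Poly_Mapping.keys_add)
  moreover have "free_ext f p = (\<Sum>(a, b)\<in>?K. Poly_Mapping.lookup p (a, b) *\<^sub>C f a b)"
    by (rule free_ext_superset) simp_all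
  moreover have "free_ext f q = (\<Sum>(a, b)\<in>?K. Poly_Mapping.lookup q (a, b) *\<^sub>C f a b)"
    by (rule free_ext_superset) simp_all
  ultimately show "free_ext f (p + q) = free_ext f p + free_ext f q"
    by (simp add: lookup_add scaleC_add_left sum.distrib case_prod_unfold)
  have "free_ext f (c *\<^sub>C p)
      = (\<Sum>(a, b)\<in>Poly_Mapping.keys p. Poly_Mapping.lookup (c *\<^sub>C p) (a, b) *\<^sub>C f a b)"
    by (rule free_ext_superset) (auto simp: in_keys_iff lookup_scaleC)
  then show "free_ext f (c *\<^sub>C p) = c *\<^sub>C free_ext f p"
    by (simp add: free_ext_def lookup_scaleC scaleC_complex_def complex_vector.scale_sum_right
        case_prod_unfold scaleC_scaleC)
qed

lemma free_ext_single: "free_ext f (Poly_Mapping.single (a, b) c) = c *\<^sub>C f a b"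
  using free_ext_superset[of "{(a, b)}" "Poly_Mapping.single (a, b) c" f] by simp

lemma free_ext_null:
  assumes "cbilinear f" "p \<in> tensor_null"
  shows "free_ext f p = 0"
  using assms(2) unfolding tensor_null_def
proof (induction rule: complex_vector.span_induct)
  case base
  then show ?case
    by (auto simp: complex_vector.subspace_def clinear_0[OF clinear_free_ext]
        clinear_add[OF clinear_free_ext] clinear_scale[OF clinear_free_ext])
next
  case (step p)
  have 1: "f (a + a') b = f a b + f a' b" "f a (b + b') = f a b + f a b'"
    "f (c *\<^sub>C a) b = c *\<^sub>C f a b" "f a (c *\<^sub>C b) = c *\<^sub>C f a b" for a a' b b' c
    using assms(1) clinear_add[of "f a"] clinear_add[of "\<lambda>a. f a b"]
      clinear_scale[of "f a"] clinear_scale[of "\<lambda>a. f a b"] by (auto simp: cbilinear_def)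
  from step show ?case
    by (auto simp: clinear_diff[OF clinear_free_ext] clinear_scale[OF clinear_free_ext]
        free_ext_single scaleC_one 1)
qed

lemma tlift_abs:
  assumes "cbilinear f"
  shows "tlift f (abs_tensor p) = free_ext f p"
proof -
  have "rep_tensor (abs_tensor p) - p \<in> tensor_null"
    by (rule Quotient3_rep_abs[OF Quotient3_tensor]) (simp add: tensor_null_0)
  from free_ext_null[OF assms this] show ?thesis
    by (simp add: tlift_def clinear_diff[OF clinear_free_ext])
qed

lemma tlift_tprod [simp]: "cbilinear f \<Longrightarrow> tlift f (a \<otimes> b) = f a b"
  by (simp add: tprod.abs_eq tlift_abs free_ext_single scaleC_one)

lemma clinear_tlift [intro]:
  assumes "cbilinear f"
  shows "clinear (tlift f)"
proof (rule clinearI)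
  show "tlift f (s + t) = tlift f s + tlift f t" for s t
    by (induction s rule: tensor.abs_induct, induction t rule: tensor.abs_induct)
      (simp add: plus_tensor.abs_eq tlift_abs assms clinear_add[OF clinear_free_ext])
  show "tlift f (c *\<^sub>C s) = c *\<^sub>C tlift f s" for c s
    by (induction s rule: tensor.abs_induct)
      (simp add: scaleC_tensor.abs_eq tlift_abs assms clinear_scale[OF clinear_free_ext])
qed

lemma tensor_induct [case_names zero tprod add]:
  assumes "P 0" and "\<And>a b. P (a \<otimes> b)" and "\<And>s t. P s \<Longrightarrow> P t \<Longrightarrow> P (s + t)"
  shows "P t"
proof (induction t rule: tensor.abs_induct)
  case (1 p)
  have single: "abs_tensor (Poly_Mapping.single (a, b) c) = (c *\<^sub>C a) \<otimes> b" for a :: 'a and b :: 'b and c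
  proof -
    have "Poly_Mapping.single (a, b) c = c *\<^sub>C Poly_Mapping.single (a, b) (1::complex)"
      by (auto simp: poly_mapping_eq_iff fun_eq_iff lookup_scaleC scaleC_complex_def
          lookup_single when_def)
    moreover have "(c *\<^sub>C a) \<otimes> b = c *\<^sub>C (a \<otimes> b)"
      using cbilinear_tprod clinear_scale[of "\<lambda>a. a \<otimes> b"] by (auto simp: cbilinear_def)
    ultimately show ?thesis
      by (simp add: tprod.abs_eq scaleC_tensor.abs_eq)
  qed
  have upd: "Poly_Mapping.update k v p = Poly_Mapping.single k v + p"
    if "k \<notin> Poly_Mapping.keys p" for k v and p :: "'a \<times> 'b \<Rightarrow>\<^sub>0 complex"
    using that by (auto simp: poly_mapping_eq_iff fun_eq_iff lookup_add lookup_single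
        lookup_update when_def in_keys_iff)
  show ?case
  proof (induction p rule: update_induct)
    case const
    then show ?case using assms(1) by (simp add: zero_tensor.abs_eq)
  next
    case (update p k v)
    obtain a b where "k = (a, b)" by (cases k)
    with update show ?case
      using assms(2,3) by (simp add: upd plus_tensor.abs_eq[symmetric] single)
  qed
qed

lemma clinear_tensor_eqI:
  assumes "clinear f" "clinear g" "\<And>a b. f (a \<otimes> b) = g (a \<otimes> b)"
  shows "f t = g t"
  by (induction t rule: tensor_induct) (simp_all add: assms clinear_0 clinear_add)

definition tmap :: "('a::complex_vector \<Rightarrow> 'c::complex_vector) \<Rightarrow> ('b::complex_vector \<Rightarrow> 'd::complex_vector)
    \<Rightarrow> ('a, 'b) tensor \<Rightarrow> ('c, 'd) tensor"
  where "tmap f g = tlift (\<lambda>a b. f a \<otimes> g b)"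

lemma cbilinear_tmap: "clinear f \<Longrightarrow> clinear g \<Longrightarrow> cbilinear (\<lambda>a b. f a \<otimes> g b)"
  by (intro cbilinearI clinear_tprod_intros)

lemma clinear_tmap: "clinear f \<Longrightarrow> clinear g \<Longrightarrow> clinear (tmap f g)"
  unfolding tmap_def by (intro clinear_tlift cbilinear_tmap)

lemma tmap_tprod [simp]: "clinear f \<Longrightarrow> clinear g \<Longrightarrow> tmap f g (a \<otimes> b) = f a \<otimes> g b"
  by (simp add: tmap_def cbilinear_tmap)

text \<open>The triple tensor product is represented as \<open>A \<otimes> (A \<otimes> A)\<close>.\<close>

definition tassoc ::
    "(('a::complex_vector, 'b::complex_vector) tensor, 'c::complex_vector) tensor
      \<Rightarrow> ('a, ('b, 'c) tensor) tensor"
  where "tassoc = tlift (\<lambda>s c. tlift (\<lambda>a b. a \<otimes> b \<otimes> c) s)"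

definition tassoc_inv ::
    "('a::complex_vector, ('b::complex_vector, 'c::complex_vector) tensor) tensor
      \<Rightarrow> (('a, 'b) tensor, 'c) tensor"
  where "tassoc_inv = tlift (\<lambda>a s. tlift (\<lambda>b c. (a \<otimes> b) \<otimes> c) s)"

lemma clinear_tlift_fun:
  assumes "\<And>x. cbilinear (f x)" "\<And>a b. clinear (\<lambda>x. f x a b)"
  shows "clinear (\<lambda>x. tlift (f x) t)"
proof (rule clinearI)
  note L = clinear_tlift[OF assms(1)] and T = tlift_tprod[OF assms(1)]
  show "tlift (f (x + y)) t = tlift (f x) t + tlift (f y) t" for x y
    by (rule clinear_tensor_eqI[where f = "tlift (f (x + y))" and g = "\<lambda>t. tlift (f x) t + tlift (f y) t"])
      (simp_all only: L T clinear_intros clinear_add[OF assms(2), of x y])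
  show "tlift (f (c *\<^sub>C x)) t = c *\<^sub>C tlift (f x) t" for c x
    by (rule clinear_tensor_eqI[where f = "tlift (f (c *\<^sub>C x))" and g = "\<lambda>t. c *\<^sub>C tlift (f x) t"])
      (simp_all only: L T clinear_intros clinear_scale[OF assms(2), of c x])
qed

lemma cbilinear_tassoc:
  "cbilinear (\<lambda>a b. a \<otimes> b \<otimes> c)" "cbilinear (\<lambda>s c. tlift (\<lambda>a b. a \<otimes> b \<otimes> c) s)"
  "cbilinear (\<lambda>b c. (a \<otimes> b) \<otimes> c)" "cbilinear (\<lambda>a s. tlift (\<lambda>b c. (a \<otimes> b) \<otimes> c) s)"
  by (intro cbilinearI clinear_tlift clinear_tlift_fun clinear_tprod_intros clinear_intros)+

lemma clinear_tassoc: "clinear tassoc" "clinear tassoc_inv"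
  unfolding tassoc_def tassoc_inv_def by (intro clinear_tlift cbilinear_tassoc)+

lemma tassoc_tprod [simp]: "tassoc ((a \<otimes> b) \<otimes> c) = a \<otimes> b \<otimes> c"
  and tassoc_inv_tprod [simp]: "tassoc_inv (a \<otimes> b \<otimes> c) = (a \<otimes> b) \<otimes> c"
  by (simp_all add: tassoc_def tassoc_inv_def cbilinear_tassoc)

lemma clinear_tensor3_eqI:
  assumes "clinear f" "clinear g" "\<And>a b c. f (a \<otimes> b \<otimes> c) = g (a \<otimes> b \<otimes> c)"
  shows "f t = g t"
proof (rule clinear_tensor_eqI[OF assms(1,2)])
  fix a s
  have "clinear (\<lambda>s. f (a \<otimes> s))" "clinear (\<lambda>s. g (a \<otimes> s))"
    by (rule clinear_compose[OF assms(1)] clinear_compose[OF assms(2)];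
        intro clinear_tprod_intros clinear_intros)+
  then show "f (a \<otimes> s) = g (a \<otimes> s)"
    by (rule clinear_tensor_eqI) (rule assms(3))
qed

lemma clinear_tensor3_eqI':
  assumes "clinear f" "clinear g" "\<And>a b c. f ((a \<otimes> b) \<otimes> c) = g ((a \<otimes> b) \<otimes> c)"
  shows "f t = g t"
proof (rule clinear_tensor_eqI[OF assms(1,2)])
  fix c s
  have "clinear (\<lambda>s. f (s \<otimes> c))" "clinear (\<lambda>s. g (s \<otimes> c))"
    by (rule clinear_compose[OF assms(1)] clinear_compose[OF assms(2)];
        intro clinear_tprod_intros clinear_intros)+
  then show "f (s \<otimes> c) = g (s \<otimes> c)"
    by (rule clinear_tensor_eqI) (rule assms(3))
qed

lemma clinear_tassoc_intros:
  "clinear f \<Longrightarrow> clinear (\<lambda>x. tassoc (f x))"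
  "clinear g \<Longrightarrow> clinear (\<lambda>x. tassoc_inv (g x))"
  by (simp_all only: clinear_compose[OF clinear_tassoc(1)] clinear_compose[OF clinear_tassoc(2)])

lemma tassoc_inverse [simp]: "tassoc (tassoc_inv t) = t" "tassoc_inv (tassoc s) = s"
proof -
  show "tassoc (tassoc_inv t) = t"
    by (rule clinear_tensor3_eqI[where f = "\<lambda>t. tassoc (tassoc_inv t)" and g = "\<lambda>t. t"])
      (simp_all add: clinear_tassoc_intros clinear_intros)
  show "tassoc_inv (tassoc s) = s"
    by (rule clinear_tensor3_eqI'[where f = "\<lambda>t. tassoc_inv (tassoc t)" and g = "\<lambda>t. t"])
      (simp_all add: clinear_tassoc_intros clinear_intros)
qed

instantiation tensor :: (complex_algebra, complex_algebra) complex_algebra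
begin

definition times_tensor :: "('a, 'b) tensor \<Rightarrow> ('a, 'b) tensor \<Rightarrow> ('a, 'b) tensor"
  where "s * t = tlift (\<lambda>a b. tlift (\<lambda>a' b'. (a * a') \<otimes> (b * b')) t) s"

lemma cbilinear_times_tensor:
  "cbilinear (\<lambda>a' b'. (a * a') \<otimes> (b * b'))"
  "cbilinear (\<lambda>a' b'. (a' * a) \<otimes> (b' * b))"
  "cbilinear (\<lambda>a b. tlift (\<lambda>a' b'. (a * a') \<otimes> (b * b')) t)"
  for a :: 'a and b :: 'b and t :: "('a, 'b) tensor"
  by (intro cbilinearI clinear_tlift clinear_tlift_fun clinear_tprod_intros clinear_mult_intros
      clinear_intros)+

lemma clinear_times_tensor: "clinear (\<lambda>s. s * t)" "clinear (\<lambda>t. s * t)" for s t :: "('a, 'b) tensor"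
  unfolding times_tensor_def
  by (intro clinear_tlift clinear_tlift_fun cbilinear_times_tensor)+

lemma tprod_times_tprod [simp]: "(a \<otimes> b) * (a' \<otimes> b') = (a * a') \<otimes> (b * b')"
  for a a' :: 'a and b b' :: 'b
  by (simp add: times_tensor_def cbilinear_times_tensor)

instance
proof
  fix r s t :: "('a, 'b) tensor" and c
  show "(r + s) * t = r * t + s * t" "r * (s + t) = r * s + r * t"
    "(c *\<^sub>C s) * t = c *\<^sub>C (s * t)" "s * (c *\<^sub>C t) = c *\<^sub>C (s * t)"
    using clinear_times_tensor clinear_add[of "\<lambda>s. s * t"] clinear_scale[of "\<lambda>s. s * t"]
      clinear_add[of "\<lambda>t. r * t"] clinear_scale[of "\<lambda>t. s * t"] by auto
  have L: "clinear f \<Longrightarrow> clinear (\<lambda>x. f x * t)" "clinear f \<Longrightarrow> clinear (\<lambda>x. t * f x)"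
    for t :: "('a, 'b) tensor" and f :: "('a, 'b) tensor \<Rightarrow> ('a, 'b) tensor"
    using clinear_compose[OF clinear_times_tensor(1)] clinear_compose[OF clinear_times_tensor(2)]
    by blast+
  have 1: "(a \<otimes> b) * (a' \<otimes> b') * t = (a \<otimes> b) * ((a' \<otimes> b') * t)" for a a' :: 'a and b b' :: 'b
    by (rule clinear_tensor_eqI[where f = "\<lambda>t. _ * _ * t" and g = "\<lambda>t. _ * (_ * t)"])
      (simp_all add: L clinear_intros mult.assoc)
  have 2: "(a \<otimes> b) * s * t = (a \<otimes> b) * (s * t)" for a :: 'a and b :: 'b
    by (rule clinear_tensor_eqI[where f = "\<lambda>s. _ * s * _" and g = "\<lambda>s. _ * (s * _)"])
      (simp_all only: L clinear_intros 1)
  show "r * s * t = r * (s * t)"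
    by (rule clinear_tensor_eqI[where f = "\<lambda>r. r * _ * _" and g = "\<lambda>r. r * (_ * _)"])
      (simp_all only: L clinear_intros 2)
qed

end

lemma tassoc_times [simp]: "tassoc (s * t) = tassoc s * tassoc t"
proof (rule clinear_tensor3_eqI'[where f = "\<lambda>s. tassoc (s * t)" and g = "\<lambda>s. tassoc s * tassoc t"])
  show "tassoc ((a \<otimes> b) \<otimes> c * t) = tassoc ((a \<otimes> b) \<otimes> c) * tassoc t" for a b c
    by (rule clinear_tensor3_eqI'[where f = "\<lambda>t. tassoc (_ * t)" and g = "\<lambda>t. tassoc _ * tassoc t"])
      (simp_all add: clinear_tassoc_intros clinear_mult_intros clinear_intros)
qed (intro clinear_tassoc_intros clinear_mult_intros clinear_intros)+

lemma tassoc_inv_times [simp]: "tassoc_inv (s * t) = tassoc_inv s * tassoc_inv t"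
  by (metis tassoc_inverse tassoc_times)

section \<open>The multiplier algebra\<close>

text \<open>A multiplier is a pair of a left multiplier \<open>l\<close> and a right multiplier \<open>r\<close>,
  thought of as \<open>l a = m a\<close> and \<open>r a = a m\<close>.\<close>

typedef (overloaded) 'a multiplier =
  "{(l :: 'a::complex_algebra \<Rightarrow> 'a, r :: 'a \<Rightarrow> 'a). clinear l \<and> clinear r
      \<and> (\<forall>a b. l (a * b) = l a * b) \<and> (\<forall>a b. r (a * b) = a * r b)
      \<and> (\<forall>a b. r a * b = a * l b)}"
  by (rule exI[of _ "(\<lambda>x. x, \<lambda>x. x)"]) (simp add: clinear_intros)

setup_lifting type_definition_multiplier

lift_definition lmul :: "'a::complex_algebra multiplier \<Rightarrow> 'a \<Rightarrow> 'a" is fst .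
lift_definition rmul :: "'a::complex_algebra multiplier \<Rightarrow> 'a \<Rightarrow> 'a" is snd .

lemma clinear_lmul: "clinear (lmul m)"
  and clinear_rmul: "clinear (rmul m)"
  and lmul_mult: "lmul m (a * b) = lmul m a * b"
  and rmul_mult: "rmul m (a * b) = a * rmul m b"
  and rmul_lmul: "rmul m a * b = a * lmul m b"
  by (transfer, force)+

lemma multiplier_eqI: "(\<And>a. lmul m a = lmul n a) \<Longrightarrow> (\<And>a. rmul m a = rmul n a) \<Longrightarrow> m = n"
  by transfer (auto simp: fun_eq_iff)

instantiation multiplier :: (complex_algebra) "{complex_algebra, monoid_mult}"
begin

lift_definition zero_multiplier :: "'a multiplier" is "(\<lambda>a. 0, \<lambda>a. 0)"
  by (simp add: clinear_intros)
lift_definition one_multiplier :: "'a multiplier" is "(\<lambda>a. a, \<lambda>a. a)"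
  by (simp add: clinear_intros)
lift_definition plus_multiplier :: "'a multiplier \<Rightarrow> 'a multiplier \<Rightarrow> 'a multiplier"
  is "\<lambda>(l, r) (l', r'). (\<lambda>a. l a + l' a, \<lambda>a. r a + r' a)"
  by (auto simp: clinear_intros algebra_simps)
lift_definition minus_multiplier :: "'a multiplier \<Rightarrow> 'a multiplier \<Rightarrow> 'a multiplier"
  is "\<lambda>(l, r) (l', r'). (\<lambda>a. l a - l' a, \<lambda>a. r a - r' a)"
  by (auto simp: clinear_intros algebra_simps)
lift_definition uminus_multiplier :: "'a multiplier \<Rightarrow> 'a multiplier"
  is "\<lambda>(l, r). (\<lambda>a. - l a, \<lambda>a. - r a)"
  by (auto simp: clinear_intros)
lift_definition scaleC_multiplier :: "complex \<Rightarrow> 'a multiplier \<Rightarrow> 'a multiplier"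
  is "\<lambda>c (l, r). (\<lambda>a. c *\<^sub>C l a, \<lambda>a. c *\<^sub>C r a)"
  by (auto simp: clinear_intros mult_scaleC_left mult_scaleC_right)
lift_definition times_multiplier :: "'a multiplier \<Rightarrow> 'a multiplier \<Rightarrow> 'a multiplier"
  is "\<lambda>(l, r) (l', r'). (\<lambda>a. l (l' a), \<lambda>a. r' (r a))"
  by (auto simp: clinear_compose)

lemma lmul_simps [simp]:
  "lmul 0 a = 0" "lmul 1 a = a" "lmul (m + n) a = lmul m a + lmul n a"
  "lmul (m - n) a = lmul m a - lmul n a" "lmul (- m) a = - lmul m a"
  "lmul (c *\<^sub>C m) a = c *\<^sub>C lmul m a" "lmul (m * n) a = lmul m (lmul n a)"
  by (transfer, auto)+

lemma rmul_simps [simp]: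
  "rmul 0 a = 0" "rmul 1 a = a" "rmul (m + n) a = rmul m a + rmul n a"
  "rmul (m - n) a = rmul m a - rmul n a" "rmul (- m) a = - rmul m a"
  "rmul (c *\<^sub>C m) a = c *\<^sub>C rmul m a" "rmul (m * n) a = rmul n (rmul m a)"
  by (transfer, auto)+

instance
  by intro_classes
    (auto intro!: multiplier_eqI simp: algebra_simps scaleC_add_right scaleC_add_left scaleC_scaleC
      scaleC_one clinear_add[OF clinear_lmul] clinear_add[OF clinear_rmul]
      clinear_scale[OF clinear_lmul] clinear_scale[OF clinear_rmul])

end

text \<open>The canonical map from an algebra to its multiplier algebra (an embedding for
  non-degenerate algebras), and its inverse on its range.\<close>

lift_definition emb :: "'a::complex_algebra \<Rightarrow> 'a multiplier" is "\<lambda>a. (\<lambda>b. a * b, \<lambda>b. b * a)"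
  by (simp add: clinear_mult_intros clinear_intros mult.assoc)

lemma lmul_emb [simp]: "lmul (emb a) b = a * b"
  and rmul_emb [simp]: "rmul (emb a) b = b * a"
  by (transfer, simp)+

definition unemb :: "'a::complex_algebra multiplier \<Rightarrow> 'a"
  where "unemb = inv emb"

lemma clinear_multiplier_intros:
  "clinear f \<Longrightarrow> clinear (\<lambda>x. lmul m (f x))"
  "clinear f \<Longrightarrow> clinear (\<lambda>x. rmul m (f x))"
  by (simp_all only: clinear_compose[OF clinear_lmul] clinear_compose[OF clinear_rmul])

lemma clinear_tmap_intros:
  "clinear h \<Longrightarrow> clinear (\<lambda>x. tmap (lmul m) (lmul n) (h x))"
  "clinear h \<Longrightarrow> clinear (\<lambda>x. tmap (rmul m) (rmul n) (h x))"
  by (simp_all only: clinear_compose[OF clinear_tmap[OF clinear_lmul clinear_lmul]]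
      clinear_compose[OF clinear_tmap[OF clinear_rmul clinear_rmul]])

lemmas clinear_all_intros =
  clinear_tmap_intros clinear_multiplier_intros clinear_tassoc_intros clinear_mult_intros clinear_intros

lemma tmap_lmul: "tmap (lmul m) (lmul n) (s * t) = tmap (lmul m) (lmul n) s * t"
proof (rule clinear_tensor_eqI[where f = "\<lambda>s. tmap (lmul m) (lmul n) (s * t)"
      and g = "\<lambda>s. tmap (lmul m) (lmul n) s * t"])
  show "tmap (lmul m) (lmul n) (a \<otimes> b * t) = tmap (lmul m) (lmul n) (a \<otimes> b) * t" for a b
    by (rule clinear_tensor_eqI[where f = "\<lambda>t. tmap (lmul m) (lmul n) (_ * t)"
          and g = "\<lambda>t. _ * t"])
      (simp_all add: clinear_all_intros clinear_lmul lmul_mult)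
qed (intro clinear_all_intros)+

lemma tmap_rmul: "tmap (rmul m) (rmul n) (s * t) = s * tmap (rmul m) (rmul n) t"
proof (rule clinear_tensor_eqI[where f = "\<lambda>s. tmap (rmul m) (rmul n) (s * t)"
      and g = "\<lambda>s. s * tmap (rmul m) (rmul n) t"])
  show "tmap (rmul m) (rmul n) (a \<otimes> b * t) = a \<otimes> b * tmap (rmul m) (rmul n) t" for a b
    by (rule clinear_tensor_eqI[where f = "\<lambda>t. tmap (rmul m) (rmul n) (_ * t)"
          and g = "\<lambda>t. _ * tmap (rmul m) (rmul n) t"])
      (simp_all add: clinear_all_intros clinear_rmul rmul_mult)
qed (intro clinear_all_intros)+

lemma tmap_rmul_lmul: "tmap (rmul m) (rmul n) s * t = s * tmap (lmul m) (lmul n) t"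
proof (rule clinear_tensor_eqI[where f = "\<lambda>s. tmap (rmul m) (rmul n) s * t"
      and g = "\<lambda>s. s * tmap (lmul m) (lmul n) t"])
  show "tmap (rmul m) (rmul n) (a \<otimes> b) * t = a \<otimes> b * tmap (lmul m) (lmul n) t" for a b
    by (rule clinear_tensor_eqI[where f = "\<lambda>t. _ * t"
          and g = "\<lambda>t. _ * tmap (lmul m) (lmul n) t"])
      (simp_all add: clinear_all_intros clinear_lmul clinear_rmul rmul_lmul)
qed (intro clinear_all_intros)+

text \<open>The multiplier \<open>m \<otimes> n\<close> of \<open>A \<otimes> B\<close>, and the identification of the multipliers of
  \<open>(A \<otimes> B) \<otimes> C\<close> with those of \<open>A \<otimes> (B \<otimes> C)\<close>.\<close>

lift_definition mtensor :: "'a::complex_algebra multiplier \<Rightarrow> 'b::complex_algebra multiplier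
    \<Rightarrow> ('a, 'b) tensor multiplier" (infixr \<open>\<otimes>\<^sub>M\<close> 74)
  is "\<lambda>m n. (tmap (lmul m) (lmul n), tmap (rmul m) (rmul n))"
  by (simp add: clinear_tmap clinear_lmul clinear_rmul tmap_lmul tmap_rmul tmap_rmul_lmul)

lemma lmul_mtensor [simp]: "lmul (m \<otimes>\<^sub>M n) = tmap (lmul m) (lmul n)"
  and rmul_mtensor [simp]: "rmul (m \<otimes>\<^sub>M n) = tmap (rmul m) (rmul n)"
  by (simp_all add: lmul.rep_eq rmul.rep_eq mtensor.rep_eq)

lift_definition massoc ::
    "(('a::complex_algebra, 'b::complex_algebra) tensor, 'c::complex_algebra) tensor multiplier
      \<Rightarrow> ('a, ('b, 'c) tensor) tensor multiplier"
  is "\<lambda>m. (\<lambda>t. tassoc (lmul m (tassoc_inv t)), \<lambda>t. tassoc (rmul m (tassoc_inv t)))"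
proof -
  fix m :: "(('a, 'b) tensor, 'c) tensor multiplier"
  have "tassoc (rmul m (tassoc_inv s)) * t = s * tassoc (lmul m (tassoc_inv t))" for s t
    by (metis rmul_lmul tassoc_inverse(1) tassoc_times)
  then show "?thesis m"
    by (simp add: clinear_all_intros lmul_mult rmul_mult)
qed

lemma lmul_massoc [simp]: "lmul (massoc m) t = tassoc (lmul m (tassoc_inv t))"
  and rmul_massoc [simp]: "rmul (massoc m) t = tassoc (rmul m (tassoc_inv t))"
  by (simp_all add: lmul.rep_eq rmul.rep_eq massoc.rep_eq)

section \<open>Weak Hopf algebras\<close>

definition is_one :: "'a::complex_algebra \<Rightarrow> bool"
  where "is_one u \<longleftrightarrow> (\<forall>a. u * a = a \<and> a * u = a)"

definition slice_left :: "('a::complex_vector \<Rightarrow> complex) \<Rightarrow> ('a, 'b::complex_vector) tensor \<Rightarrow> 'b"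
  where "slice_left \<epsilon> = tlift (\<lambda>a b. \<epsilon> a *\<^sub>C b)"

definition slice_right :: "('b::complex_vector \<Rightarrow> complex) \<Rightarrow> ('a::complex_vector, 'b) tensor \<Rightarrow> 'a"
  where "slice_right \<epsilon> = tlift (\<lambda>a b. \<epsilon> b *\<^sub>C a)"

definition weak_Hopf_structure :: "('a::complex_algebra \<Rightarrow> ('a, 'a) tensor) \<Rightarrow> 'a \<Rightarrow> ('a \<Rightarrow> complex)
    \<Rightarrow> ('a \<Rightarrow> 'a) \<Rightarrow> bool"
  where "weak_Hopf_structure \<Delta> u \<epsilon> S \<longleftrightarrow>
    is_one u \<and> clinear \<Delta> \<and> clinear \<epsilon> \<and> clinear S
    \<and> (\<forall>a b. \<Delta> (a * b) = \<Delta> a * \<Delta> b)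
    \<and> (\<forall>a. tassoc (tmap \<Delta> id (\<Delta> a)) = tmap id \<Delta> (\<Delta> a))
    \<and> (\<forall>a. slice_left \<epsilon> (\<Delta> a) = a \<and> slice_right \<epsilon> (\<Delta> a) = a)
    \<and> tassoc (tmap \<Delta> id (\<Delta> u)) = tassoc (\<Delta> u \<otimes> u) * (u \<otimes> \<Delta> u)
    \<and> tassoc (tmap \<Delta> id (\<Delta> u)) = (u \<otimes> \<Delta> u) * tassoc (\<Delta> u \<otimes> u)
    \<and> (\<forall>a b c. \<epsilon> (a * b * c) = tlift (\<lambda>b\<^sub>1 b\<^sub>2. \<epsilon> (a * b\<^sub>1) * \<epsilon> (b\<^sub>2 * c)) (\<Delta> b))
    \<and> (\<forall>a b c. \<epsilon> (a * b * c) = tlift (\<lambda>b\<^sub>1 b\<^sub>2. \<epsilon> (a * b\<^sub>2) * \<epsilon> (b\<^sub>1 * c)) (\<Delta> b))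
    \<and> (\<forall>a. tlift (\<lambda>a\<^sub>1 a\<^sub>2. a\<^sub>1 * S a\<^sub>2) (\<Delta> a) = slice_left \<epsilon> (\<Delta> u * (a \<otimes> u)))
    \<and> (\<forall>a. tlift (\<lambda>a\<^sub>1 a\<^sub>2. S a\<^sub>1 * a\<^sub>2) (\<Delta> a) = slice_right \<epsilon> ((u \<otimes> a) * \<Delta> u))
    \<and> (\<forall>a. tlift (\<lambda>a\<^sub>1. tlift (\<lambda>a\<^sub>2 a\<^sub>3. S a\<^sub>1 * a\<^sub>2 * S a\<^sub>3)) (tmap id \<Delta> (\<Delta> a)) = S a)"

definition weak_Hopf_algebra :: "('a::complex_algebra \<Rightarrow> ('a, 'a) tensor) \<Rightarrow> bool"
  where "weak_Hopf_algebra \<Delta> \<longleftrightarrow> (\<exists>u \<epsilon> S. weak_Hopf_structure \<Delta> u \<epsilon> S)"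

section \<open>Weak multiplier Hopf algebras\<close>

definition nondegenerate :: "'a::complex_algebra itself \<Rightarrow> bool"
  where "nondegenerate _ \<longleftrightarrow>
    (\<forall>a::'a. (\<forall>b. a * b = 0) \<longrightarrow> a = 0) \<and> (\<forall>a::'a. (\<forall>b. b * a = 0) \<longrightarrow> a = 0)"

definition idempotent_algebra :: "'a::complex_algebra itself \<Rightarrow> bool"
  where "idempotent_algebra _ \<longleftrightarrow> cspan {a * b | a b :: 'a. True} = UNIV"

definition alg_hom :: "('a::complex_algebra \<Rightarrow> 'b::complex_algebra) \<Rightarrow> bool"
  where "alg_hom f \<longleftrightarrow> clinear f \<and> (\<forall>a b. f (a * b) = f a * f b)"

definition T1 :: "('a::complex_algebra \<Rightarrow> ('a, 'a) tensor multiplier) \<Rightarrow> ('a, 'a) tensor \<Rightarrow> ('a, 'a) tensor"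
  where "T1 \<Delta> = tlift (\<lambda>a b. unemb (\<Delta> a * (1 \<otimes>\<^sub>M emb b)))"

definition T2 :: "('a::complex_algebra \<Rightarrow> ('a, 'a) tensor multiplier) \<Rightarrow> ('a, 'a) tensor \<Rightarrow> ('a, 'a) tensor"
  where "T2 \<Delta> = tlift (\<lambda>a b. unemb ((emb a \<otimes>\<^sub>M 1) * \<Delta> b))"

text \<open>The maps \<open>\<Delta> \<otimes> \<iota>\<close> and \<open>\<iota> \<otimes> \<Delta>\<close> from \<open>A \<otimes> A\<close> to \<open>M(A \<otimes> A \<otimes> A)\<close>.\<close>

definition Delta_id :: "('a::complex_algebra \<Rightarrow> ('a, 'a) tensor multiplier)
    \<Rightarrow> ('a, 'a) tensor \<Rightarrow> ('a, ('a, 'a) tensor) tensor multiplier"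
  where "Delta_id \<Delta> = tlift (\<lambda>p q. massoc (\<Delta> p \<otimes>\<^sub>M emb q))"

definition id_Delta :: "('a::complex_algebra \<Rightarrow> ('a, 'a) tensor multiplier)
    \<Rightarrow> ('a, 'a) tensor \<Rightarrow> ('a, ('a, 'a) tensor) tensor multiplier"
  where "id_Delta \<Delta> = tlift (\<lambda>p q. emb p \<otimes>\<^sub>M \<Delta> q)"

definition coproduct :: "('a::complex_algebra \<Rightarrow> ('a, 'a) tensor multiplier) \<Rightarrow> bool"
  where "coproduct \<Delta> \<longleftrightarrow> alg_hom \<Delta>
    \<and> (\<forall>a b. \<Delta> a * (1 \<otimes>\<^sub>M emb b) \<in> range emb)
    \<and> (\<forall>a b. (emb a \<otimes>\<^sub>M 1) * \<Delta> b \<in> range emb)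
    \<and> (\<forall>a b c. (emb a \<otimes>\<^sub>M 1 \<otimes>\<^sub>M 1) * Delta_id \<Delta> (T1 \<Delta> (b \<otimes> c))
        = id_Delta \<Delta> (T2 \<Delta> (a \<otimes> b)) * (1 \<otimes>\<^sub>M 1 \<otimes>\<^sub>M emb c))"

definition subspace_tensor :: "'a::complex_vector set \<Rightarrow> 'b::complex_vector set \<Rightarrow> ('a, 'b) tensor set"
  where "subspace_tensor V W = cspan {v \<otimes> w | v w. v \<in> V \<and> w \<in> W}"

definition left_leg :: "('a::complex_algebra \<Rightarrow> ('a, 'a) tensor multiplier) \<Rightarrow> 'a set"
  where "left_leg \<Delta> =
    \<Inter> {V. csubspace V \<and> (\<forall>a b. T1 \<Delta> (a \<otimes> b) \<in> subspace_tensor V UNIV)}"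

definition right_leg :: "('a::complex_algebra \<Rightarrow> ('a, 'a) tensor multiplier) \<Rightarrow> 'a set"
  where "right_leg \<Delta> =
    \<Inter> {W. csubspace W \<and> (\<forall>a b. T2 \<Delta> (a \<otimes> b) \<in> subspace_tensor UNIV W)}"

definition full :: "('a::complex_algebra \<Rightarrow> ('a, 'a) tensor multiplier) \<Rightarrow> bool"
  where "full \<Delta> \<longleftrightarrow> left_leg \<Delta> = UNIV \<and> right_leg \<Delta> = UNIV"

definition counit :: "('a::complex_algebra \<Rightarrow> ('a, 'a) tensor multiplier) \<Rightarrow> ('a \<Rightarrow> complex) \<Rightarrow> bool"
  where "counit \<Delta> \<epsilon> \<longleftrightarrow> clinear \<epsilon>
    \<and> (\<forall>a b. slice_left \<epsilon> (T1 \<Delta> (a \<otimes> b)) = a * b)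
    \<and> (\<forall>a b. slice_right \<epsilon> (T2 \<Delta> (a \<otimes> b)) = a * b)"

text \<open>The extensions of \<open>\<Delta> \<otimes> \<iota>\<close> and \<open>\<iota> \<otimes> \<Delta>\<close> to \<open>M(A \<otimes> A)\<close>: the unique homomorphisms
  extending them with \<open>1 \<mapsto> E \<otimes> 1\<close> and \<open>1 \<mapsto> 1 \<otimes> E\<close>, respectively.\<close>

definition Delta_id_ext :: "('a::complex_algebra \<Rightarrow> ('a, 'a) tensor multiplier)
    \<Rightarrow> ('a, 'a) tensor multiplier
    \<Rightarrow> ('a, 'a) tensor multiplier \<Rightarrow> ('a, ('a, 'a) tensor) tensor multiplier"
  where "Delta_id_ext \<Delta> E =
    (THE \<Phi>. alg_hom \<Phi> \<and> (\<forall>t. \<Phi> (emb t) = Delta_id \<Delta> t) \<and> \<Phi> 1 = massoc (E \<otimes>\<^sub>M 1))"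

definition id_Delta_ext :: "('a::complex_algebra \<Rightarrow> ('a, 'a) tensor multiplier)
    \<Rightarrow> ('a, 'a) tensor multiplier
    \<Rightarrow> ('a, 'a) tensor multiplier \<Rightarrow> ('a, ('a, 'a) tensor) tensor multiplier"
  where "id_Delta_ext \<Delta> E =
    (THE \<Phi>. alg_hom \<Phi> \<and> (\<forall>t. \<Phi> (emb t) = id_Delta \<Delta> t) \<and> \<Phi> 1 = 1 \<otimes>\<^sub>M E)"

text \<open>Both right multipliers of \<open>A \<otimes> A\<^sup>o\<^sup>p\<close> and left multipliers of \<open>A\<^sup>o\<^sup>p \<otimes> A\<close> are linear maps
  \<open>F\<close> on \<open>A \<otimes> A\<close> with this module property, where \<open>F (a \<otimes> b)\<close> stands for
  \<open>(a \<otimes> 1)F(1 \<otimes> b)\<close>.\<close>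

definition outer_multiplier :: "(('a::complex_algebra, 'a) tensor \<Rightarrow> ('a, 'a) tensor) \<Rightarrow> bool"
  where "outer_multiplier F \<longleftrightarrow> clinear F
    \<and> (\<forall>a a' b b'. F ((a' * a) \<otimes> (b * b')) = tmap (\<lambda>x. a' * x) (\<lambda>y. y * b') (F (a \<otimes> b)))"

text \<open>\<open>E\<^sub>1\<^sub>3(F\<^sub>1 \<otimes> 1) = E\<^sub>1\<^sub>3(1 \<otimes> E)\<close>, with \<open>a\<close> and \<open>c\<close> multiplied from the left on the first and third
  leg and \<open>b\<close> and \<open>d\<close> from the right on the second and third leg.\<close>

definition F1_condition :: "('a::complex_algebra, 'a) tensor multiplier
    \<Rightarrow> (('a, 'a) tensor \<Rightarrow> ('a, 'a) tensor) \<Rightarrow> bool"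
  where "F1_condition E F \<longleftrightarrow> (\<forall>a b c d.
    tassoc (tlift (\<lambda>p q. F (p \<otimes> b) \<otimes> (q * d)) (rmul E (a \<otimes> c)))
    = tlift (\<lambda>p q. p \<otimes> tmap id (\<lambda>y. q * y) (lmul E (b \<otimes> d))) (rmul E (a \<otimes> c)))"

text \<open>\<open>(1 \<otimes> F\<^sub>2)E\<^sub>1\<^sub>3 = (E \<otimes> 1)E\<^sub>1\<^sub>3\<close>, with \<open>d\<close> and \<open>b\<close> multiplied from the left on the first and second
  leg and \<open>a\<close> and \<open>c\<close> from the right on the first and third leg.\<close>

definition F2_condition :: "('a::complex_algebra, 'a) tensor multiplier
    \<Rightarrow> (('a, 'a) tensor \<Rightarrow> ('a, 'a) tensor) \<Rightarrow> bool"
  where "F2_condition E F \<longleftrightarrow> (\<forall>a b c d.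
    tlift (\<lambda>p q. (d * p) \<otimes> F (b \<otimes> q)) (lmul E (a \<otimes> c))
    = tassoc (tlift (\<lambda>p q. tmap (\<lambda>x. x * p) id (rmul E (d \<otimes> b)) \<otimes> q) (lmul E (a \<otimes> c))))"

definition wmha_structure :: "('a::complex_algebra \<Rightarrow> ('a, 'a) tensor multiplier) \<Rightarrow> ('a \<Rightarrow> complex)
    \<Rightarrow> ('a, 'a) tensor multiplier \<Rightarrow> (('a, 'a) tensor \<Rightarrow> ('a, 'a) tensor)
    \<Rightarrow> (('a, 'a) tensor \<Rightarrow> ('a, 'a) tensor) \<Rightarrow> bool"
  where "wmha_structure \<Delta> \<epsilon> E F\<^sub>1 F\<^sub>2 \<longleftrightarrow>
    nondegenerate TYPE('a) \<and> idempotent_algebra TYPE('a)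
    \<and> coproduct \<Delta> \<and> full \<Delta> \<and> counit \<Delta> \<epsilon>
    \<and> E * E = E \<and> range (T1 \<Delta>) = range (lmul E) \<and> range (T2 \<Delta>) = range (rmul E)
    \<and> id_Delta_ext \<Delta> E E = Delta_id_ext \<Delta> E E
    \<and> Delta_id_ext \<Delta> E E = (1 \<otimes>\<^sub>M E) * massoc (E \<otimes>\<^sub>M 1)
    \<and> Delta_id_ext \<Delta> E E = massoc (E \<otimes>\<^sub>M 1) * (1 \<otimes>\<^sub>M E)
    \<and> outer_multiplier F\<^sub>1 \<and> outer_multiplier F\<^sub>2
    \<and> F1_condition E F\<^sub>1 \<and> F2_condition E F\<^sub>2
    \<and> {t. T1 \<Delta> t = 0} = range (\<lambda>t. t - F\<^sub>1 t)
    \<and> {t. T2 \<Delta> t = 0} = range (\<lambda>t. t - F\<^sub>2 t)"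

definition weak_multiplier_Hopf_algebra ::
    "('a::complex_algebra \<Rightarrow> ('a, 'a) tensor multiplier) \<Rightarrow> bool"
  where "weak_multiplier_Hopf_algebra \<Delta> \<longleftrightarrow> (\<exists>\<epsilon> E F\<^sub>1 F\<^sub>2. wmha_structure \<Delta> \<epsilon> E F\<^sub>1 F\<^sub>2)"

definition R1 :: "('a::complex_algebra \<Rightarrow> ('a, 'a) tensor multiplier)
    \<Rightarrow> ('a, 'a) tensor multiplier \<Rightarrow> (('a, 'a) tensor \<Rightarrow> ('a, 'a) tensor)
    \<Rightarrow> ('a, 'a) tensor \<Rightarrow> ('a, 'a) tensor"
  where "R1 \<Delta> E F\<^sub>1 = (THE R. clinear R
    \<and> T1 \<Delta> \<circ> R \<circ> T1 \<Delta> = T1 \<Delta> \<and> R \<circ> T1 \<Delta> \<circ> R = R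
    \<and> T1 \<Delta> \<circ> R = lmul E \<and> R \<circ> T1 \<Delta> = F\<^sub>1)"

text \<open>The antipode as a map into the left multipliers: \<open>antipode \<Delta> \<epsilon> E F\<^sub>1 a b\<close> is \<open>S(a)b\<close>.\<close>

definition antipode :: "('a::complex_algebra \<Rightarrow> ('a, 'a) tensor multiplier) \<Rightarrow> ('a \<Rightarrow> complex)
    \<Rightarrow> ('a, 'a) tensor multiplier \<Rightarrow> (('a, 'a) tensor \<Rightarrow> ('a, 'a) tensor) \<Rightarrow> 'a \<Rightarrow> 'a \<Rightarrow> 'a"
  where "antipode \<Delta> \<epsilon> E F\<^sub>1 a b = slice_left \<epsilon> (R1 \<Delta> E F\<^sub>1 (a \<otimes> b))"

text \<open>\<open>A\<close> is regarded as a subspace of its left multipliers by left multiplication.\<close>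

definition regular_weak_multiplier_Hopf_algebra ::
    "('a::complex_algebra \<Rightarrow> ('a, 'a) tensor multiplier) \<Rightarrow> bool"
  where "regular_weak_multiplier_Hopf_algebra \<Delta> \<longleftrightarrow>
    (\<exists>\<epsilon> E F\<^sub>1 F\<^sub>2. wmha_structure \<Delta> \<epsilon> E F\<^sub>1 F\<^sub>2
      \<and> (\<exists>S :: 'a \<Rightarrow> 'a. bij S \<and> (\<forall>a. antipode \<Delta> \<epsilon> E F\<^sub>1 a = (\<lambda>b. S a * b))))"

end

theory Submission
  imports Defs
begin

text \<open>
  Write \<open>\<epsilon>\<^sub>t(a) = \<epsilon>(1\<^sub>(\<^sub>1\<^sub>)a)1\<^sub>(\<^sub>2\<^sub>)\<close> and \<open>\<epsilon>\<^sub>s(a) = 1\<^sub>(\<^sub>1\<^sub>)\<epsilon>(a1\<^sub>(\<^sub>2\<^sub>))\<close>.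

  (i) For a weak Hopf algebra, \<open>E = \<Delta>(1)\<close>, \<open>F\<^sub>1 = 1\<^sub>(\<^sub>1\<^sub>) \<otimes> \<epsilon>\<^sub>s(1\<^sub>(\<^sub>2\<^sub>))\<close> and
  \<open>R\<^sub>1(a \<otimes> b) = a\<^sub>(\<^sub>1\<^sub>) \<otimes> S(a\<^sub>(\<^sub>2\<^sub>))b\<close> satisfy \<open>T\<^sub>1R\<^sub>1 = E\<close> and \<open>R\<^sub>1T\<^sub>1 = F\<^sub>1\<close>, which gives the
  range and the kernel of \<open>T\<^sub>1\<close>. The statements on \<open>T\<^sub>2\<close> and \<open>F\<^sub>2\<close> are those on \<open>T\<^sub>1\<close> and \<open>F\<^sub>1\<close>
  for the opposite product and coproduct.

  (ii) If \<open>A\<close> is unital, the ranges of \<open>T\<^sub>1\<close> and \<open>T\<^sub>2\<close> force \<open>E = \<Delta>(1)\<close>, and applying \<open>\<epsilon>\<close> to the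
  third leg of \<open>E\<^sub>1\<^sub>3(F\<^sub>1 \<otimes> 1) = E\<^sub>1\<^sub>3(1 \<otimes> E)\<close> gives \<open>F\<^sub>1 = 1\<^sub>(\<^sub>1\<^sub>) \<otimes> \<epsilon>\<^sub>s(1\<^sub>(\<^sub>2\<^sub>))\<close>. The generalized
  inverse \<open>R\<^sub>1\<close> of \<open>T\<^sub>1\<close> commutes with \<open>\<Delta> \<otimes> \<iota>\<close>, hence \<open>R\<^sub>1(a \<otimes> b) = a\<^sub>(\<^sub>1\<^sub>) \<otimes> S(a\<^sub>(\<^sub>2\<^sub>))b\<close> for some
  \<open>S\<close>, and the identities between \<open>T\<^sub>1\<close> and \<open>R\<^sub>1\<close> become the antipode axioms. They also give
  \<open>\<epsilon>\<^sub>t(ab) = a\<^sub>(\<^sub>1\<^sub>)\<epsilon>\<^sub>t(b)S(a\<^sub>(\<^sub>2\<^sub>))\<close>. As \<open>\<epsilon> \<circ> \<epsilon>\<^sub>t = \<epsilon>\<close> and \<open>\<epsilon>\<^sub>t\<close> is idempotent,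
  \<open>\<epsilon>(ab) = \<epsilon>(a\<epsilon>\<^sub>t(b)) = \<epsilon>(a1\<^sub>(\<^sub>2\<^sub>))\<epsilon>(1\<^sub>(\<^sub>1\<^sub>)b)\<close>, and the weak multiplicativity of \<open>\<epsilon>\<close> follows
  from this case.
\<close>

section \<open>Linear maps on tensor products\<close>

lemma clinear_scale_left: "clinear f \<Longrightarrow> clinear (\<lambda>x. f x *\<^sub>C v)" for f :: "_ \<Rightarrow> complex"
  by (intro clinearI) (simp_all add: clinear_add clinear_scale scaleC_add_left scaleC_complex_def scaleC_scaleC)

lemma clinear_tlift_param:
  assumes "\<And>z x. clinear (f z x)" "\<And>z y. clinear (\<lambda>x. f z x y)" "\<And>x y. clinear (\<lambda>z. f z x y)"
  shows "clinear (\<lambda>z. tlift (f z) t)"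
  by (intro clinear_tlift_fun cbilinearI assms)

lemma clinear_tlift_arg:
  assumes "\<And>x. clinear (f x)" "\<And>y. clinear (\<lambda>x. f x y)" "clinear g"
  shows "clinear (\<lambda>z. tlift f (g z))"
  by (intro clinear_compose[OF clinear_tlift] cbilinearI assms)

lemma scaleC_complex: "c *\<^sub>C d = c * d" for c d :: complex
  by (simp add: scaleC_complex_def)

lemmas lin = clinear_intros(3)[OF clinear_intros(1)] clinear_tprod_intros(1)[OF clinear_intros(1)]
  clinear_mult_intros(1)[OF clinear_intros(1)] clinear_intros(1-6) clinear_tprod_intros clinear_scale_left clinear_tlift_param
  clinear_tlift_arg clinear_mult_intros

lemma tlift_tensor:
  "(\<And>x. clinear (f x)) \<Longrightarrow> (\<And>y. clinear (\<lambda>x. f x y)) \<Longrightarrow> tlift f (a \<otimes> b) = f a b"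
  by (simp add: cbilinearI)

text \<open>Both sides are linear in \<open>t\<close> and agree on elementary tensors. This moves a
  linear map inside a Sweedler sum.\<close>

lemma tlift_pull:
  assumes "clinear h" "\<And>x. clinear (f x)" "\<And>y. clinear (\<lambda>x. f x y)"
  shows "h (tlift f t) = tlift (\<lambda>x y. h (f x y)) t"
  by (rule clinear_tensor_eqI[where f = "\<lambda>t. h (tlift f t)"])
    (intro lin clinear_compose[OF assms(1)] assms | simp add: tlift_tensor clinear_compose[OF assms(1)] assms)+

text \<open>Two independent Sweedler sums may be interchanged: by linearity in \<open>t\<close> only
  elementary tensors have to be compared.\<close>

lemma tlift_swap:
  assumes "\<And>x y p. clinear (g x y p)" "\<And>x y q. clinear (\<lambda>p. g x y p q)"
    and "\<And>x p q. clinear (\<lambda>y. g x y p q)" "\<And>y p q. clinear (\<lambda>x. g x y p q)"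
  shows "tlift (\<lambda>x y. tlift (g x y) s) t = tlift (\<lambda>p q. tlift (\<lambda>x y. g x y p q) t) s"
  by (rule clinear_tensor_eqI[where f = "\<lambda>t. tlift (\<lambda>x y. tlift (g x y) s) t"])
    (intro lin assms | simp add: tlift_tensor assms lin)+

lemma tlift_tlift:
  assumes "\<And>x. clinear (f x)" "\<And>y. clinear (\<lambda>x. f x y)" "\<And>x. clinear (g x)" "\<And>y. clinear (\<lambda>x. g x y)"
  shows "tlift f (tlift g t) = tlift (\<lambda>x y. tlift f (g x y)) t"
  by (rule tlift_pull; intro lin assms)

lemma tlift_id: "tlift (\<otimes>) t = t"
  by (rule clinear_tensor_eqI[where g = "\<lambda>t. t"]) (simp_all add: tlift_tensor lin clinear_tlift cbilinearI)

text \<open>The co-opposite coproduct is \<open>flip\<close> after \<Delta>. Together with the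
  opposite product it turns \<open>T2\<close> into a conjugate of \<open>T1\<close>.\<close>

definition flip :: "('a::complex_vector, 'b::complex_vector) tensor \<Rightarrow> ('b, 'a) tensor"
  where "flip = tlift (\<lambda>a b. b \<otimes> a)"

lemma flip_tprod [simp]: "flip (a \<otimes> b) = b \<otimes> a"
  unfolding flip_def by (intro tlift_tensor lin)

lemma clinear_flip: "clinear f \<Longrightarrow> clinear (\<lambda>x. flip (f x))"
  unfolding flip_def by (intro lin)

lemma flip_flip [simp]: "flip (flip t) = t"
  by (rule clinear_tensor_eqI[where f = "\<lambda>t. flip (flip t)"]) (intro clinear_flip lin | simp)+

lemma tlift_flip:
  assumes "\<And>x. clinear (f x)" "\<And>y. clinear (\<lambda>x. f x y)"
  shows "tlift f (flip t) = tlift (\<lambda>x y. f y x) t"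
  unfolding flip_def using assms by (simp add: tlift_tlift tlift_tensor lin)

section \<open>Sweedler calculus\<close>

text \<open>The product is a parameter, so that the opposite structure is an instance of the same locale.
  The term \<open>sw a f\<close> below is the Sweedler sum of \<open>f a\<^sub>(\<^sub>1\<^sub>) a\<^sub>(\<^sub>2\<^sub>)\<close> for a bilinear \<open>f\<close>.\<close>

locale weak_coproduct =
  fixes mult :: "'a::complex_vector \<Rightarrow> 'a \<Rightarrow> 'a" (infixl \<open>\<cdot>\<close> 78)
    and u :: 'a
    and \<Delta> :: "'a \<Rightarrow> ('a, 'a) tensor"
    and \<epsilon> :: "'a \<Rightarrow> complex"
  assumes clinear_mult1: "clinear (\<lambda>a. a \<cdot> b)"
    and clinear_mult2: "clinear (\<lambda>b. a \<cdot> b)"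
    and assoc: "(a \<cdot> b) \<cdot> c = a \<cdot> (b \<cdot> c)"
    and unit_left [simp]: "u \<cdot> a = a"
    and unit_right [simp]: "a \<cdot> u = a"
    and clinear_Delta: "clinear \<Delta>"
    and clinear_counit: "clinear \<epsilon>"
    and Delta_mult: "\<Delta> (a \<cdot> b) = tlift (\<lambda>x y. tlift (\<lambda>p q. x \<cdot> p \<otimes> y \<cdot> q) (\<Delta> b)) (\<Delta> a)"
    and Delta_coassoc: "tlift (\<lambda>x y. tlift (\<lambda>p q. p \<otimes> q \<otimes> y) (\<Delta> x)) (\<Delta> a)
      = tlift (\<lambda>x y. tlift (\<lambda>p q. x \<otimes> p \<otimes> q) (\<Delta> y)) (\<Delta> a)"
    and Delta_counit1: "tlift (\<lambda>x y. \<epsilon> x *\<^sub>C y) (\<Delta> a) = a"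
    and Delta_counit2: "tlift (\<lambda>x y. \<epsilon> y *\<^sub>C x) (\<Delta> a) = a"
    and Delta_unit1: "tlift (\<lambda>x y. tlift (\<lambda>p q. p \<otimes> q \<otimes> y) (\<Delta> x)) (\<Delta> u)
      = tlift (\<lambda>p q. tlift (\<lambda>x y. p \<otimes> (q \<cdot> x) \<otimes> y) (\<Delta> u)) (\<Delta> u)"
    and Delta_unit2: "tlift (\<lambda>x y. tlift (\<lambda>p q. p \<otimes> q \<otimes> y) (\<Delta> x)) (\<Delta> u)
      = tlift (\<lambda>p q. tlift (\<lambda>x y. p \<otimes> (x \<cdot> q) \<otimes> y) (\<Delta> u)) (\<Delta> u)"
begin

lemmas llin = lin clinear_compose[OF clinear_mult1] clinear_compose[OF clinear_mult2]
  clinear_compose[OF clinear_Delta] clinear_compose[OF clinear_counit]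
  clinear_mult1 clinear_mult2 clinear_Delta clinear_counit

abbreviation sw :: "'a \<Rightarrow> ('a \<Rightarrow> 'a \<Rightarrow> 'c::complex_vector) \<Rightarrow> 'c"
  where "sw a f \<equiv> tlift f (\<Delta> a)"

lemma sw_mult:
  assumes "\<And>x. clinear (f x)" "\<And>y. clinear (\<lambda>x. f x y)"
  shows "sw (a \<cdot> b) f = sw a (\<lambda>x y. sw b (\<lambda>p q. f (x \<cdot> p) (y \<cdot> q)))"
  unfolding Delta_mult using assms
  by (simp add: tlift_tlift tlift_tensor llin clinear_compose[OF assms(1)] clinear_compose[OF assms(2)])

lemma sw_unit_left:
  assumes "\<And>x. clinear (f x)" "\<And>y. clinear (\<lambda>x. f x y)"
  shows "sw u (\<lambda>x y. sw a (\<lambda>p q. f (x \<cdot> p) (y \<cdot> q))) = sw a f"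
  using sw_mult[of f u a] assms by simp

lemma sw_unit_right:
  assumes "\<And>x. clinear (f x)" "\<And>y. clinear (\<lambda>x. f x y)"
  shows "sw a (\<lambda>x y. sw u (\<lambda>p q. f (x \<cdot> p) (y \<cdot> q))) = sw a f"
  using sw_mult[of f a u] assms by simp

lemma sw_counit1: "clinear f \<Longrightarrow> sw a (\<lambda>x y. \<epsilon> x *\<^sub>C f y) = f a"
  using tlift_pull[of f "\<lambda>x y. \<epsilon> x *\<^sub>C y" "\<Delta> a"]
  by (simp add: llin Delta_counit1 clinear_scale)

lemma sw_counit2: "clinear f \<Longrightarrow> sw a (\<lambda>x y. \<epsilon> y *\<^sub>C f x) = f a"
  using tlift_pull[of f "\<lambda>x y. \<epsilon> y *\<^sub>C x" "\<Delta> a"]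
  by (simp add: llin Delta_counit2 clinear_scale)

context
  fixes g :: "'a \<Rightarrow> 'a \<Rightarrow> 'a \<Rightarrow> 'c::complex_vector"
  assumes g: "\<And>x y. clinear (g x y)" "\<And>x z. clinear (\<lambda>y. g x y z)" "\<And>y z. clinear (\<lambda>x. g x y z)"
begin

lemma sw_coassoc:
  "sw a (\<lambda>x y. sw x (\<lambda>p q. g p q y)) = sw a (\<lambda>x y. sw y (\<lambda>p q. g x p q))"
  using arg_cong[OF Delta_coassoc, of "tlift (\<lambda>x. tlift (g x))" a] g
  by (simp add: tlift_tlift tlift_tensor llin clinear_compose[OF g(1)] clinear_compose[OF g(2)]
      clinear_compose[OF g(3)])

lemma sw_unit1:
  "sw u (\<lambda>x y. sw x (\<lambda>p q. g p q y)) = sw u (\<lambda>p q. sw u (\<lambda>x y. g p (q \<cdot> x) y))"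
  using arg_cong[OF Delta_unit1, of "tlift (\<lambda>x. tlift (g x))"] g
  by (simp add: tlift_tlift tlift_tensor llin clinear_compose[OF g(1)] clinear_compose[OF g(2)]
      clinear_compose[OF g(3)])

lemma sw_unit2:
  "sw u (\<lambda>x y. sw x (\<lambda>p q. g p q y)) = sw u (\<lambda>p q. sw u (\<lambda>x y. g p (x \<cdot> q) y))"
  using arg_cong[OF Delta_unit2, of "tlift (\<lambda>x. tlift (g x))"] g
  by (simp add: tlift_tlift tlift_tensor llin clinear_compose[OF g(1)] clinear_compose[OF g(2)]
      clinear_compose[OF g(3)])

end

text \<open>By \<open>Delta_unit2\<close>, the product \<open>r \<cdot> y\<close> formed from two
  copies of \<Delta>(1) is the middle leg of (\<Delta> \<otimes> \<iota>)\<Delta>(1), and \<epsilon>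
  removes that leg.\<close>

lemma sw_unit_counit:
  assumes "\<And>x. clinear (f x)" "\<And>y. clinear (\<lambda>x. f x y)"
  shows "sw u (\<lambda>x y. sw u (\<lambda>r s. \<epsilon> (r \<cdot> y) *\<^sub>C f x s)) = sw u f"
proof -
  note l = llin assms clinear_compose[OF assms(1)] clinear_compose[OF assms(2)]
  have "sw u (\<lambda>x y. sw u (\<lambda>r s. \<epsilon> (r \<cdot> y) *\<^sub>C f x s))
      = sw u (\<lambda>x y. sw x (\<lambda>p q. \<epsilon> q *\<^sub>C f p y))"
    by (rule sw_unit2[symmetric]; simp add: l)
  also have "\<dots> = sw u f"
    by (simp add: sw_counit2 l)
  finally show ?thesis .
qed

section \<open>The counital maps and three operators on A \<otimes> A\<close>

definition target :: "'a \<Rightarrow> 'a"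
  where "target a = sw u (\<lambda>x y. \<epsilon> (x \<cdot> a) *\<^sub>C y)"

text \<open>This is \<open>target\<close> of the opposite structure, which allows an identity for
  one counital map to be carried over to the other.\<close>

definition source :: "'a \<Rightarrow> 'a"
  where "source a = sw u (\<lambda>x y. \<epsilon> (a \<cdot> y) *\<^sub>C x)"

lemma clinear_target: "clinear target" and clinear_source: "clinear source"
  unfolding target_def source_def by (simp_all add: llin)

text \<open>The map \<open>T\<^sub>1\<close>, left multiplication with \<open>\<Delta>(1)\<close>, and \<open>a \<otimes> b \<mapsto> (a \<otimes> 1)f(1 \<otimes> b)\<close>.\<close>

definition T :: "('a, 'a) tensor \<Rightarrow> ('a, 'a) tensor"
  where "T = tlift (\<lambda>a b. sw a (\<lambda>x y. x \<otimes> y \<cdot> b))"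

definition unit_proj :: "('a, 'a) tensor \<Rightarrow> ('a, 'a) tensor"
  where "unit_proj = tlift (\<lambda>a b. sw u (\<lambda>x y. x \<cdot> a \<otimes> y \<cdot> b))"

definition outer_mult :: "('a, 'a) tensor \<Rightarrow> ('a, 'a) tensor \<Rightarrow> ('a, 'a) tensor"
  where "outer_mult f = tlift (\<lambda>a b. tlift (\<lambda>p q. a \<cdot> p \<otimes> q \<cdot> b) f)"

lemma T_tprod [simp]: "T (a \<otimes> b) = sw a (\<lambda>x y. x \<otimes> y \<cdot> b)"
  and unit_proj_tprod [simp]: "unit_proj (a \<otimes> b) = sw u (\<lambda>x y. x \<cdot> a \<otimes> y \<cdot> b)"
  and outer_mult_tprod [simp]: "outer_mult f (a \<otimes> b) = tlift (\<lambda>p q. a \<cdot> p \<otimes> q \<cdot> b) f"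
  unfolding T_def unit_proj_def outer_mult_def by (simp_all add: tlift_tensor llin)

lemma clinear_T: "clinear T"
  and clinear_unit_proj: "clinear unit_proj"
  and clinear_outer_mult: "clinear (outer_mult f)"
  unfolding T_def unit_proj_def outer_mult_def by (simp_all add: llin)

lemmas alin = llin clinear_compose[OF clinear_T] clinear_compose[OF clinear_unit_proj]
  clinear_compose[OF clinear_outer_mult] clinear_T clinear_unit_proj clinear_outer_mult
  clinear_target clinear_source clinear_compose[OF clinear_target] clinear_compose[OF clinear_source]

text \<open>Multiplicativity gives \<Delta>(1)\<Delta>(a) = \<Delta>(a), so \<open>T\<close> takes
  its values in the range of \<open>unit_proj\<close>.\<close>

lemma unit_proj_T: "unit_proj (T t) = T t"
proof (rule clinear_tensor_eqI[where f = "\<lambda>t. unit_proj (T t)"])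
  show "unit_proj (T (a \<otimes> b)) = T (a \<otimes> b)" for a b
  proof -
    have "unit_proj (T (a \<otimes> b)) = sw a (\<lambda>x y. sw u (\<lambda>p q. p \<cdot> x \<otimes> q \<cdot> (y \<cdot> b)))"
      by (simp add: tlift_pull[of unit_proj] alin)
    also have "\<dots> = sw u (\<lambda>p q. sw a (\<lambda>x y. p \<cdot> x \<otimes> (q \<cdot> y) \<cdot> b))"
      by (simp add: assoc, rule tlift_swap; simp add: alin)
    also have "\<dots> = sw a (\<lambda>x y. x \<otimes> y \<cdot> b)"
      by (rule sw_unit_left; simp add: alin)
    finally show ?thesis by simp
  qed
qed (simp_all add: alin)

text \<open>When the product and the order of the legs are both reversed, each of the two conditions
  on \<Delta>(1) goes to itself, up to coassociativity and an interchange of the two sums.\<close>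

lemma opposite: "weak_coproduct (\<lambda>a b. b \<cdot> a) u (\<lambda>a. flip (\<Delta> a)) \<epsilon>"
proof (rule weak_coproduct.intro)
  fix a b
  show "flip (\<Delta> (b \<cdot> a)) = tlift (\<lambda>x y. tlift (\<lambda>p q. p \<cdot> x \<otimes> q \<cdot> y) (flip (\<Delta> b))) (flip (\<Delta> a))"
    unfolding Delta_mult
    by (simp add: tlift_pull[of flip] clinear_flip tlift_flip llin, rule tlift_swap; simp add: llin)
  show "tlift (\<lambda>x y. tlift (\<lambda>p q. p \<otimes> q \<otimes> y) (flip (\<Delta> x))) (flip (\<Delta> a))
      = tlift (\<lambda>x y. tlift (\<lambda>p q. x \<otimes> p \<otimes> q) (flip (\<Delta> y))) (flip (\<Delta> a))"
    using sw_coassoc[of "\<lambda>x y z. z \<otimes> y \<otimes> x" a] by (simp add: tlift_flip clinear_flip llin)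
  show "tlift (\<lambda>x y. tlift (\<lambda>p q. p \<otimes> q \<otimes> y) (flip (\<Delta> x))) (flip (\<Delta> u))
      = tlift (\<lambda>p q. tlift (\<lambda>x y. p \<otimes> x \<cdot> q \<otimes> y) (flip (\<Delta> u))) (flip (\<Delta> u))"
    using sw_unit1[of "\<lambda>x y z. z \<otimes> y \<otimes> x"] sw_coassoc[of "\<lambda>x y z. z \<otimes> y \<otimes> x" u]
      tlift_swap[of "\<lambda>p q x y. y \<otimes> q \<cdot> x \<otimes> p" "\<Delta> u" "\<Delta> u"]
    by (simp add: tlift_flip clinear_flip llin)
  show "tlift (\<lambda>x y. tlift (\<lambda>p q. p \<otimes> q \<otimes> y) (flip (\<Delta> x))) (flip (\<Delta> u))
      = tlift (\<lambda>p q. tlift (\<lambda>x y. p \<otimes> q \<cdot> x \<otimes> y) (flip (\<Delta> u))) (flip (\<Delta> u))"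
    using sw_unit2[of "\<lambda>x y z. z \<otimes> y \<otimes> x"] sw_coassoc[of "\<lambda>x y z. z \<otimes> y \<otimes> x" u]
      tlift_swap[of "\<lambda>p q x y. y \<otimes> x \<cdot> q \<otimes> p" "\<Delta> u" "\<Delta> u"]
    by (simp add: tlift_flip clinear_flip llin)
qed (simp_all add: llin clinear_flip assoc tlift_flip Delta_counit1 Delta_counit2)

end

section \<open>The antipode and its consequences\<close>

text \<open>In a unital algebra \<open>F\<^sub>1\<close> is given by an element \<open>f\<close> of
  A \<otimes> A, and \<open>unit_f\<close> is the equation \<open>E\<^sub>1\<^sub>3(F\<^sub>1
  \<otimes> 1) = E\<^sub>1\<^sub>3(1 \<otimes> E)\<close> for E = \<Delta>(1).\<close>

locale weak_coproduct_F = weak_coproduct +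
  fixes f :: "('a, 'a) tensor"
  assumes unit_f: "sw u (\<lambda>x y. tlift (\<lambda>p q. x \<cdot> p \<otimes> q \<otimes> y) f)
      = sw u (\<lambda>x y. sw u (\<lambda>p q. x \<otimes> p \<otimes> y \<cdot> q))"
begin

lemma unit_f':
  assumes g: "\<And>x y. clinear (g x y)" "\<And>x z. clinear (\<lambda>y. g x y z)" "\<And>y z. clinear (\<lambda>x. g x y z)"
  shows "sw u (\<lambda>x y. tlift (\<lambda>p q. g (x \<cdot> p) q y) f) = sw u (\<lambda>x y. sw u (\<lambda>p q. g x p (y \<cdot> q)))"
  using arg_cong[OF unit_f, of "tlift (\<lambda>x. tlift (g x))"] g
  by (simp add: tlift_tlift tlift_tensor alin clinear_compose[OF g(1)] clinear_compose[OF g(2)]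
      clinear_compose[OF g(3)])

text \<open>Applying \<epsilon> to the third leg of \<open>unit_f\<close> removes \<Delta>(1) in
  front of \<open>f\<close>. In particular \<open>unit_f\<close> has at most one solution.\<close>

lemma f_eq: "f = sw u (\<lambda>x y. sw u (\<lambda>p q. \<epsilon> (y \<cdot> q) *\<^sub>C (x \<otimes> p)))"
proof -
  have "f = tlift (\<otimes>) f"
    by (simp only: tlift_id)
  also have "\<dots> = sw u (\<lambda>x y. \<epsilon> y *\<^sub>C tlift (\<lambda>p q. x \<cdot> p \<otimes> q) f)"
    by (subst sw_counit2; simp add: alin)
  also have "\<dots> = sw u (\<lambda>x y. tlift (\<lambda>p q. \<epsilon> y *\<^sub>C (x \<cdot> p \<otimes> q)) f)"
    by (simp add: tlift_pull[of "\<lambda>x. _ *\<^sub>C x"] alin)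
  also have "\<dots> = sw u (\<lambda>x y. sw u (\<lambda>p q. \<epsilon> (y \<cdot> q) *\<^sub>C (x \<otimes> p)))"
    by (rule unit_f'; simp add: alin)
  finally show ?thesis .
qed

text \<open>Weak multiplicativity of \<epsilon> is not among the assumptions here. Instead,
  \<Delta>(a) is replaced by \<Delta>(a)\<Delta>(1), and \<open>unit_f\<close> is applied to the
  inserted copy of \<Delta>(1).\<close>

lemma source_f: "tlift (\<lambda>p q. \<epsilon> (a \<cdot> p) *\<^sub>C q) f = source a"
proof -
  \<comment> \<open>A copy of \<Delta>(1) to the right of \<Delta>(a) is absorbed, whichever of the
    two sums is the outer one.\<close>
  have 1: "sw u (\<lambda>x y. sw a (\<lambda>r s. g (r \<cdot> x) (s \<cdot> y))) = sw a g"
    if g: "\<And>x. clinear (g x)" "\<And>y. clinear (\<lambda>x. g x y)" for g :: "'a \<Rightarrow> 'a \<Rightarrow> 'a"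
    unfolding sw_unit_right[OF g, symmetric]
    by (rule tlift_swap; simp add: alin clinear_compose[OF g(1)] clinear_compose[OF g(2)])
  have "tlift (\<lambda>p q. \<epsilon> (a \<cdot> p) *\<^sub>C q) f = sw a (\<lambda>r s. \<epsilon> s *\<^sub>C tlift (\<lambda>p q. \<epsilon> (r \<cdot> p) *\<^sub>C q) f)"
    by (subst sw_counit2; simp add: alin)
  \<comment> \<open>Used backwards, \<open>1\<close> supplies the copy of \<Delta>(1) that
    \<open>unit_f'\<close> needs.\<close>
  also have "\<dots> = sw u (\<lambda>x y. sw a (\<lambda>r s. \<epsilon> (s \<cdot> y) *\<^sub>C tlift (\<lambda>p q. \<epsilon> (r \<cdot> x \<cdot> p) *\<^sub>C q) f))"
    by (rule 1[symmetric]; simp add: alin)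
  also have "\<dots> = sw u (\<lambda>x y. tlift (\<lambda>p q. sw a (\<lambda>r s. \<epsilon> (s \<cdot> y) *\<^sub>C \<epsilon> (r \<cdot> (x \<cdot> p)) *\<^sub>C q)) f)"
    by (subst tlift_swap; simp add: tlift_pull[of "\<lambda>x. _ *\<^sub>C x"] alin assoc)
  also have "\<dots> = sw u (\<lambda>x y. sw u (\<lambda>p q. sw a (\<lambda>r s. \<epsilon> (s \<cdot> (y \<cdot> q)) *\<^sub>C \<epsilon> (r \<cdot> x) *\<^sub>C p)))"
    by (rule unit_f'; simp add: alin)
  also have "\<dots> = sw u (\<lambda>x y. sw a (\<lambda>r s. sw u (\<lambda>p q. \<epsilon> (s \<cdot> y \<cdot> q) *\<^sub>C \<epsilon> (r \<cdot> x) *\<^sub>C p)))"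
    by (subst (2) tlift_swap; simp add: alin assoc)
  also have "\<dots> = sw a (\<lambda>r s. sw u (\<lambda>p q. \<epsilon> (s \<cdot> q) *\<^sub>C \<epsilon> r *\<^sub>C p))"
    by (rule 1; simp add: alin)
  also have "\<dots> = sw a (\<lambda>r s. \<epsilon> r *\<^sub>C source s)"
    by (simp add: source_def tlift_pull[of "\<lambda>x. _ *\<^sub>C x"] alin mult.commute)
  also have "\<dots> = source a"
    by (rule sw_counit1) (rule clinear_source)
  finally show ?thesis .
qed

lemma outer_mult_tprod_eq:
  "outer_mult f (a \<otimes> b) = sw u (\<lambda>x y. sw u (\<lambda>p q. \<epsilon> (y \<cdot> q) *\<^sub>C (a \<cdot> x \<otimes> p \<cdot> b)))"
  unfolding outer_mult_tprod
  by (subst f_eq) (simp add: alin tlift_pull[of "tlift _"] clinear_scale[of "tlift _"] tlift_tensor)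

text \<open>Two applications of \<open>unit_f'\<close> trade both copies of \<open>f\<close> for
  copies of \<Delta>(1), two of which merge by \<Delta>(1)\<Delta>(1) = \<Delta>(1).\<close>

lemma outer_mult_idem: "outer_mult f (outer_mult f t) = outer_mult f t"
proof (rule clinear_tensor_eqI[where f = "\<lambda>t. outer_mult f (outer_mult f t)"])
  fix a b
  have "outer_mult f (outer_mult f (a \<otimes> b)) = tlift (\<lambda>p q. tlift (\<lambda>p' q'. a \<cdot> p \<cdot> p' \<otimes> q' \<cdot> (q \<cdot> b)) f) f"
    by (simp add: tlift_pull[of "outer_mult f"] alin)
  \<comment> \<open>The unit is written as \<open>1\<^sub>1\<epsilon>(1\<^sub>2)\<close> in front of
    \<open>p\<close>, which prepares for \<open>unit_f'\<close>.\<close>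
  also have "\<dots> = sw u (\<lambda>x y. \<epsilon> y *\<^sub>C tlift (\<lambda>p q. tlift (\<lambda>p' q'. a \<cdot> (x \<cdot> p) \<cdot> p' \<otimes> q' \<cdot> (q \<cdot> b)) f) f)"
    by (subst sw_counit2; simp add: alin)
  also have "\<dots> = sw u (\<lambda>x y. tlift (\<lambda>p q. \<epsilon> y *\<^sub>C tlift (\<lambda>p' q'. a \<cdot> (x \<cdot> p) \<cdot> p' \<otimes> q' \<cdot> (q \<cdot> b)) f) f)"
    by (simp add: tlift_pull[of "\<lambda>x. _ *\<^sub>C x"] alin)
  also have "\<dots> = sw u (\<lambda>x y. sw u (\<lambda>r s. \<epsilon> (y \<cdot> s) *\<^sub>C tlift (\<lambda>p' q'. a \<cdot> x \<cdot> p' \<otimes> q' \<cdot> (r \<cdot> b)) f))"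
    by (rule unit_f'; simp add: alin)
  also have "\<dots> = sw u (\<lambda>x y. tlift (\<lambda>p' q'. sw u (\<lambda>r s. \<epsilon> (y \<cdot> s) *\<^sub>C (a \<cdot> (x \<cdot> p') \<otimes> q' \<cdot> (r \<cdot> b)))) f)"
  proof (rule arg_cong[where f = "\<lambda>h. sw u h"], intro ext)
    fix x y
    show "sw u (\<lambda>r s. \<epsilon> (y \<cdot> s) *\<^sub>C tlift (\<lambda>p' q'. a \<cdot> x \<cdot> p' \<otimes> q' \<cdot> (r \<cdot> b)) f)
        = tlift (\<lambda>p' q'. sw u (\<lambda>r s. \<epsilon> (y \<cdot> s) *\<^sub>C (a \<cdot> (x \<cdot> p') \<otimes> q' \<cdot> (r \<cdot> b)))) f"
      by (subst tlift_swap; simp add: tlift_pull[of "\<lambda>x. _ *\<^sub>C x"] alin assoc)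
  qed
  also have "\<dots> = sw u (\<lambda>x y. sw u (\<lambda>p q. sw u (\<lambda>r s. \<epsilon> (y \<cdot> q \<cdot> s) *\<^sub>C (a \<cdot> x \<otimes> p \<cdot> (r \<cdot> b)))))"
    by (rule unit_f'; simp add: alin)
  also have "\<dots> = sw u (\<lambda>x y. sw u (\<lambda>p q. \<epsilon> (y \<cdot> q) *\<^sub>C (a \<cdot> x \<otimes> p \<cdot> b)))"
  proof (rule arg_cong[where f = "\<lambda>h. sw u h"], intro ext)
    fix x y
    show "sw u (\<lambda>p q. sw u (\<lambda>r s. \<epsilon> (y \<cdot> q \<cdot> s) *\<^sub>C (a \<cdot> x \<otimes> p \<cdot> (r \<cdot> b))))
        = sw u (\<lambda>p q. \<epsilon> (y \<cdot> q) *\<^sub>C (a \<cdot> x \<otimes> p \<cdot> b))"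
      using sw_unit_left[of "\<lambda>p q. \<epsilon> (y \<cdot> q) *\<^sub>C (a \<cdot> x \<otimes> p \<cdot> b)" u] by (simp add: alin assoc)
  qed
  also have "\<dots> = outer_mult f (a \<otimes> b)"
    by (simp only: outer_mult_tprod_eq)
  finally show "outer_mult f (outer_mult f (a \<otimes> b)) = outer_mult f (a \<otimes> b)" .
qed (simp_all add: alin)

end

text \<open>The common ground of both directions. For
  \<open>R\<^sub>1(a \<otimes> b) = a\<^sub>1 \<otimes> S(a\<^sub>2)b\<close>, the assumptions
  \<open>T_R\<close> and \<open>R_T\<close> are \<open>T\<^sub>1R\<^sub>1 = E\<close> and
  \<open>R\<^sub>1T\<^sub>1 = F\<^sub>1\<close> at \<open>b = 1\<close>. They yield the range and
  the kernel of \<open>T\<close> as well as the weak multiplicativity of \<epsilon>.\<close>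

locale weak_coproduct_antipode = weak_coproduct_F +
  fixes S :: "'a \<Rightarrow> 'a"
  assumes clinear_antipode: "clinear S"
    and T_R: "sw a (\<lambda>x y. sw y (\<lambda>p q. x \<otimes> p \<cdot> S q)) = sw u (\<lambda>p q. p \<cdot> a \<otimes> q)"
    and R_T: "sw a (\<lambda>x y. sw y (\<lambda>p q. x \<otimes> S p \<cdot> q)) = tlift (\<lambda>p q. a \<cdot> p \<otimes> q) f"
    and S_id_S: "sw a (\<lambda>x y. sw y (\<lambda>p q. S x \<cdot> p \<cdot> S q)) = S a"
begin

lemmas slin = alin clinear_antipode clinear_compose[OF clinear_antipode]

lemma T_R':
  assumes "\<And>x. clinear (g x)" "\<And>y. clinear (\<lambda>x. g x y)"
  shows "sw a (\<lambda>x y. sw y (\<lambda>p q. g x (p \<cdot> S q))) = sw u (\<lambda>p q. g (p \<cdot> a) q)"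
  using arg_cong[OF T_R[of a], of "tlift g"]
  by (simp add: tlift_tlift tlift_tensor slin assms clinear_compose[OF assms(1)] clinear_compose[OF assms(2)])

lemma R_T':
  assumes "\<And>x. clinear (g x)" "\<And>y. clinear (\<lambda>x. g x y)"
  shows "sw a (\<lambda>x y. sw y (\<lambda>p q. g x (S p \<cdot> q))) = tlift (\<lambda>p q. g (a \<cdot> p) q) f"
  using arg_cong[OF R_T[of a], of "tlift g"]
  by (simp add: tlift_tlift tlift_tensor slin assms clinear_compose[OF assms(1)] clinear_compose[OF assms(2)])

text \<open>This is \<open>T_R\<close> with \<epsilon> applied to the first leg.\<close>

lemma S_target: "sw a (\<lambda>p q. p \<cdot> S q) = target a"
proof -
  have "sw a (\<lambda>p q. p \<cdot> S q) = sw a (\<lambda>x y. \<epsilon> x *\<^sub>C sw y (\<lambda>p q. p \<cdot> S q))"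
    by (subst sw_counit1; simp add: slin)
  also have "\<dots> = sw a (\<lambda>x y. sw y (\<lambda>p q. \<epsilon> x *\<^sub>C (p \<cdot> S q)))"
    by (simp add: tlift_pull[of "\<lambda>x. _ *\<^sub>C x"] slin)
  also have "\<dots> = target a"
    unfolding target_def by (rule T_R'; simp add: slin)
  finally show ?thesis .
qed

text \<open>This is \<open>R_T\<close> with \<epsilon> applied to the first leg;
  \<open>source_f\<close> evaluates the right-hand side.\<close>

lemma S_source: "sw a (\<lambda>p q. S p \<cdot> q) = source a"
proof -
  have "sw a (\<lambda>p q. S p \<cdot> q) = sw a (\<lambda>x y. \<epsilon> x *\<^sub>C sw y (\<lambda>p q. S p \<cdot> q))"
    by (subst sw_counit1; simp add: slin)
  also have "\<dots> = sw a (\<lambda>x y. sw y (\<lambda>p q. \<epsilon> x *\<^sub>C (S p \<cdot> q)))"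
    by (simp add: tlift_pull[of "\<lambda>x. _ *\<^sub>C x"] slin)
  also have "\<dots> = tlift (\<lambda>p q. \<epsilon> (a \<cdot> p) *\<^sub>C q) f"
    by (rule R_T'; simp add: slin)
  finally show ?thesis by (simp add: source_f)
qed

section \<open>Weak multiplicativity of the counit\<close>

lemma target_target: "target (target b) = target b"
proof -
  have 1: "\<epsilon> (p \<cdot> target b) *\<^sub>C q = sw u (\<lambda>r s. \<epsilon> (p \<cdot> s) *\<^sub>C \<epsilon> (r \<cdot> b) *\<^sub>C q)" for p q
    unfolding target_def
    by (simp add: tlift_pull[of "\<lambda>z. _ \<cdot> z"] tlift_pull[of \<epsilon>] tlift_pull[of "\<lambda>x. x *\<^sub>C _"] slin
        clinear_scale[of "\<lambda>z. _ \<cdot> z"] clinear_scale[of \<epsilon>] scaleC_complex scaleC_scaleC mult.commute)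
  have "target (target b) = sw u (\<lambda>p q. sw u (\<lambda>r s. \<epsilon> (p \<cdot> s) *\<^sub>C \<epsilon> (r \<cdot> b) *\<^sub>C q))"
    unfolding target_def[of "target b"] by (rule arg_cong[where f = "\<lambda>h. tlift h _"], intro ext 1)
  also have "\<dots> = sw u (\<lambda>r s. sw u (\<lambda>p q. \<epsilon> (p \<cdot> s) *\<^sub>C \<epsilon> (r \<cdot> b) *\<^sub>C q))"
    by (rule tlift_swap; simp add: slin)
  also have "\<dots> = target b"
    unfolding target_def by (rule sw_unit_counit; simp add: slin)
  finally show ?thesis .
qed

lemma counit_target: "\<epsilon> (target c) = \<epsilon> c"
  unfolding target_def
  using sw_counit2[of "\<lambda>x. \<epsilon> (x \<cdot> c)" u]
  by (simp add: tlift_pull[of \<epsilon>] slin clinear_scale[of \<epsilon>] scaleC_complex mult.commute)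

text \<open>The product \<open>a\<^sub>1b\<^sub>1\<close> is expanded by the counit. Then
  \<open>T_R\<close> for \<open>b\<close>, absorption of \<Delta>(1) into \<Delta>(a), and
  \<open>T_R\<close> for \<open>a\<close> collapse the sum.\<close>

lemma target_mult: "target (a \<cdot> b) = sw a (\<lambda>x y. x \<cdot> target b \<cdot> S y)"
proof -
  have mult_counit: "x \<cdot> p = sw x (\<lambda>x1 x2. sw p (\<lambda>p1 p2. \<epsilon> (x1 \<cdot> p1) *\<^sub>C (x2 \<cdot> p2)))" for x p
    using sw_counit1[of "\<lambda>x. x" "x \<cdot> p"] by (simp add: sw_mult slin)
  have "sw a (\<lambda>x y. x \<cdot> target b \<cdot> S y) = sw a (\<lambda>x y. sw b (\<lambda>p q. x \<cdot> p \<cdot> S q \<cdot> S y))"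
    by (simp add: S_target[symmetric] tlift_pull[of "\<lambda>z. _ \<cdot> z"] tlift_pull[of "\<lambda>z. z \<cdot> _"] slin assoc)
  also have "\<dots> = sw a (\<lambda>x y. sw x (\<lambda>x1 x2. sw b (\<lambda>p q. sw p (\<lambda>p1 p2. \<epsilon> (x1 \<cdot> p1) *\<^sub>C (x2 \<cdot> (p2 \<cdot> S q) \<cdot> S y)))))"
    (is "_ = sw a (\<lambda>x y. sw x (\<lambda>x1 x2. ?I x1 x2 y))")
    by (subst mult_counit, subst (2) tlift_swap)
      (simp_all add: tlift_pull[of "\<lambda>z. z \<cdot> _"] slin assoc clinear_scale[of "\<lambda>z. z \<cdot> _"])
  \<comment> \<open>Coassociativity brings \<open>b\<close> into the form
    \<open>b\<^sub>1 \<otimes> b\<^sub>2S(b\<^sub>3)\<close>, which \<open>T_R'\<close> replaces by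
    \<open>1\<^sub>1b \<otimes> 1\<^sub>2\<close>.\<close>
  also have "?I = (\<lambda>x1 x2 y. sw u (\<lambda>r s. \<epsilon> (x1 \<cdot> (r \<cdot> b)) *\<^sub>C (x2 \<cdot> s \<cdot> S y)))"
  proof (intro ext)
    fix x1 x2 y
    have "?I x1 x2 y = sw b (\<lambda>p q. sw q (\<lambda>q1 q2. \<epsilon> (x1 \<cdot> p) *\<^sub>C (x2 \<cdot> (q1 \<cdot> S q2) \<cdot> S y)))"
      by (rule sw_coassoc; simp add: slin)
    also have "\<dots> = sw u (\<lambda>r s. \<epsilon> (x1 \<cdot> (r \<cdot> b)) *\<^sub>C (x2 \<cdot> s \<cdot> S y))"
      by (rule T_R'; simp add: slin)
    finally show "?I x1 x2 y = \<dots>" .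
  qed
  \<comment> \<open>The copy of \<Delta>(1) just created is absorbed by \<Delta>(x) on its
    left.\<close>
  also have "sw a (\<lambda>x y. sw x (\<lambda>x1 x2. sw u (\<lambda>r s. \<epsilon> (x1 \<cdot> (r \<cdot> b)) *\<^sub>C (x2 \<cdot> s \<cdot> S y))))
      = sw a (\<lambda>x y. sw x (\<lambda>x1 x2. \<epsilon> (x1 \<cdot> b) *\<^sub>C (x2 \<cdot> S y)))"
    by (subst sw_unit_right[symmetric]; simp add: slin assoc)
  also have "\<dots> = sw a (\<lambda>x y. sw y (\<lambda>p q. \<epsilon> (x \<cdot> b) *\<^sub>C (p \<cdot> S q)))"
    by (rule sw_coassoc; simp add: slin)
  also have "\<dots> = sw u (\<lambda>p q. \<epsilon> (p \<cdot> a \<cdot> b) *\<^sub>C q)"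
    by (rule T_R'; simp add: slin)
  finally show ?thesis by (simp add: target_def assoc)
qed

text \<open>By \<open>target_mult\<close>, \<open>target (a \<cdot> b)\<close> depends on
  \<open>b\<close> only through \<open>target b\<close>. As \<open>target\<close> is idempotent,
  \<open>a \<cdot> b\<close> and \<open>a \<cdot> target b\<close> have the same image under it,
  hence the same counit.\<close>

lemma counit_mult_target: "\<epsilon> (a \<cdot> target b) = \<epsilon> (a \<cdot> b)"
  using counit_target[of "a \<cdot> b"] counit_target[of "a \<cdot> target b"]
  by (simp add: target_mult target_target)

text \<open>The definition of \<open>target b\<close> is inserted in
  \<open>counit_mult_target\<close>. This is weak multiplicativity with middle factor 1.\<close>

lemma counit_mult1: "\<epsilon> (a \<cdot> b) = sw u (\<lambda>p q. \<epsilon> (a \<cdot> q) * \<epsilon> (p \<cdot> b))"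
  unfolding counit_mult_target[of a b, symmetric] target_def
  by (simp add: tlift_pull[of "\<lambda>z. _ \<cdot> z"] tlift_pull[of \<epsilon>] slin
        clinear_scale[of "\<lambda>z. _ \<cdot> z"] clinear_scale[of \<epsilon>] scaleC_complex mult.commute)

lemma counit_mult_source: "\<epsilon> (source a \<cdot> b) = \<epsilon> (a \<cdot> b)"
  unfolding counit_mult1[of a b] source_def
  by (simp add: tlift_pull[of "\<lambda>z. z \<cdot> _"] tlift_pull[of \<epsilon>] slin
        clinear_scale[of "\<lambda>z. z \<cdot> _"] clinear_scale[of \<epsilon>] scaleC_complex)

text \<open>The legs of \<Delta>(1) stand in the other order than in \<open>counit_mult1\<close>.
  The passage is made by \<open>source_f\<close>, which pairs \<open>a\<close> with the first leg of
  \<open>f\<close>.\<close>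

lemma counit_mult2: "\<epsilon> (a \<cdot> b) = sw u (\<lambda>x y. \<epsilon> (a \<cdot> x) * \<epsilon> (y \<cdot> b))"
proof -
  have "\<epsilon> (a \<cdot> b) = \<epsilon> (source a \<cdot> b)"
    by (rule counit_mult_source[symmetric])
  \<comment> \<open>Expressing \<open>source a\<close> through \<open>f\<close> and expanding
    \<open>f\<close> by \<open>f_eq\<close> gives two copies of \<Delta>(1);
    \<open>counit_mult1\<close> contracts the inner one.\<close>
  also have "\<dots> = sw u (\<lambda>x y. \<epsilon> (a \<cdot> x) * sw u (\<lambda>p q. \<epsilon> (y \<cdot> q) * \<epsilon> (p \<cdot> b)))"
    unfolding source_f[symmetric] f_eq
    by (simp add: tlift_pull[of "\<lambda>z. z \<cdot> _"] tlift_pull[of \<epsilon>] slin tlift_tlift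
        tlift_pull[of "tlift _"] tlift_tensor clinear_scale[of "tlift _"]
        clinear_scale[of "\<lambda>z. z \<cdot> _"] clinear_scale[of \<epsilon>] scaleC_complex mult_ac
        tlift_pull[of "\<lambda>z. _ * z"])
  also have "\<dots> = sw u (\<lambda>x y. \<epsilon> (a \<cdot> x) * \<epsilon> (y \<cdot> b))"
    by (simp add: counit_mult1[symmetric])
  finally show ?thesis .
qed

text \<open>From middle factor 1 to middle factor \<open>b\<close>: \<open>T_R\<close> turns
  \<open>1\<^sub>1b \<otimes> 1\<^sub>2\<close> into
  \<open>b\<^sub>1 \<otimes> b\<^sub>2S(b\<^sub>3)\<close>, whose second leg is
  \<open>target b\<^sub>2\<close>, and \<epsilon> does not see \<open>target\<close> there.\<close>

lemma counit_mult3_swap: "\<epsilon> (a \<cdot> b \<cdot> c) = sw b (\<lambda>x y. \<epsilon> (a \<cdot> y) * \<epsilon> (x \<cdot> c))"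
proof -
  have "\<epsilon> (a \<cdot> b \<cdot> c) = sw u (\<lambda>p q. \<epsilon> (a \<cdot> q) * \<epsilon> (p \<cdot> b \<cdot> c))"
    using counit_mult1[of a "b \<cdot> c"] by (simp add: assoc)
  also have "\<dots> = sw b (\<lambda>x y. sw y (\<lambda>p q. \<epsilon> (a \<cdot> (p \<cdot> S q)) * \<epsilon> (x \<cdot> c)))"
    by (rule T_R'[symmetric]; simp add: slin)
  also have "\<dots> = sw b (\<lambda>x y. \<epsilon> (a \<cdot> target y) * \<epsilon> (x \<cdot> c))"
    by (simp add: S_target[symmetric] tlift_pull[of "\<lambda>z. _ \<cdot> z"] tlift_pull[of \<epsilon>]
        tlift_pull[of "\<lambda>z. z * _"] slin)
  finally show ?thesis by (simp add: counit_mult_target)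
qed

text \<open>Here \<open>R_T\<close> replaces \<open>b\<^sub>1 \<otimes> source b\<^sub>2\<close> by
  (b \<otimes> 1)f, which reduces the claim to \<open>counit_mult1\<close> and
  \<open>counit_mult2\<close>.\<close>

lemma counit_mult3: "\<epsilon> (a \<cdot> b \<cdot> c) = sw b (\<lambda>x y. \<epsilon> (a \<cdot> x) * \<epsilon> (y \<cdot> c))"
proof -
  have "sw b (\<lambda>x y. \<epsilon> (a \<cdot> x) * \<epsilon> (y \<cdot> c)) = sw b (\<lambda>x y. \<epsilon> (a \<cdot> x) * \<epsilon> (source y \<cdot> c))"
    by (simp only: counit_mult_source)
  also have "\<dots> = sw b (\<lambda>x y. sw y (\<lambda>p q. \<epsilon> (a \<cdot> x) * \<epsilon> (S p \<cdot> q \<cdot> c)))"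
    by (simp add: S_source[symmetric] tlift_pull[of "\<lambda>z. z \<cdot> _"] tlift_pull[of \<epsilon>]
        tlift_pull[of "\<lambda>z. _ * z"] slin)
  also have "\<dots> = tlift (\<lambda>p q. \<epsilon> (a \<cdot> (b \<cdot> p)) * \<epsilon> (q \<cdot> c)) f"
    by (rule R_T'; simp add: slin)
  also have "\<dots> = sw u (\<lambda>x y. \<epsilon> (a \<cdot> b \<cdot> x) * sw u (\<lambda>p q. \<epsilon> (y \<cdot> q) * \<epsilon> (p \<cdot> c)))"
    unfolding f_eq
    by (simp add: slin tlift_tlift
        tlift_pull[of "tlift _"] tlift_tensor clinear_scale[of "tlift _"] assoc
        scaleC_complex mult_ac tlift_pull[of "\<lambda>z. _ * z"])
  also have "\<dots> = \<epsilon> (a \<cdot> b \<cdot> c)"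
    by (simp add: counit_mult1[symmetric] counit_mult2[symmetric])
  finally show ?thesis ..
qed

section \<open>The generalized inverse of \<open>T\<close> given by the antipode\<close>

definition R :: "('a, 'a) tensor \<Rightarrow> ('a, 'a) tensor"
  where "R = tlift (\<lambda>a b. sw a (\<lambda>x y. x \<otimes> S y \<cdot> b))"

lemma R_tprod [simp]: "R (a \<otimes> b) = sw a (\<lambda>x y. x \<otimes> S y \<cdot> b)"
  unfolding R_def by (simp add: tlift_tensor slin)

lemma clinear_R: "clinear R"
  unfolding R_def by (simp add: slin)

lemma T_R_unit_proj: "T (R t) = unit_proj t"
proof (rule clinear_tensor_eqI[where f = "\<lambda>t. T (R t)"])
  fix a b
  have "T (R (a \<otimes> b)) = sw a (\<lambda>x y. sw x (\<lambda>p q. p \<otimes> q \<cdot> (S y \<cdot> b)))"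
    by (simp add: tlift_pull[of T] slin)
  also have "\<dots> = sw a (\<lambda>x y. sw y (\<lambda>p q. x \<otimes> (p \<cdot> S q) \<cdot> b))"
    by (subst sw_coassoc; simp add: slin assoc)
  also have "\<dots> = unit_proj (a \<otimes> b)"
    by (subst T_R'; simp add: slin)
  finally show "T (R (a \<otimes> b)) = unit_proj (a \<otimes> b)" .
qed (simp_all add: slin clinear_compose[OF clinear_T clinear_R])

lemma R_T_outer_mult: "R (T t) = outer_mult f t"
proof (rule clinear_tensor_eqI[where f = "\<lambda>t. R (T t)"])
  fix a b
  have "R (T (a \<otimes> b)) = sw a (\<lambda>x y. sw x (\<lambda>p q. p \<otimes> S q \<cdot> (y \<cdot> b)))"
    by (simp add: tlift_pull[of R] slin clinear_R)
  also have "\<dots> = sw a (\<lambda>x y. sw y (\<lambda>p q. x \<otimes> (S p \<cdot> q) \<cdot> b))"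
    by (subst sw_coassoc; simp add: slin assoc)
  also have "\<dots> = outer_mult f (a \<otimes> b)"
    by (subst R_T'; simp add: slin)
  finally show "R (T (a \<otimes> b)) = outer_mult f (a \<otimes> b)" .
qed (simp_all add: slin clinear_compose[OF clinear_R clinear_T])

text \<open>Each operator factors through the other: \<open>T = unit_proj \<circ> T\<close> and
  \<open>unit_proj = T \<circ> R\<close>.\<close>

lemma range_T: "range T = range unit_proj"
proof (intro subset_antisym image_subsetI)
  show "T t \<in> range unit_proj" for t
    using rangeI[of unit_proj "T t"] by (simp add: unit_proj_T)
  show "unit_proj t \<in> range T" for t
    using rangeI[of T "R t"] by (simp add: T_R_unit_proj)
qed

text \<open>On the kernel, \<open>outer_mult f = R \<circ> T\<close> vanishes; conversely,
  \<open>T \<circ> R \<circ> T = T\<close> shows that \<open>T\<close> kills the given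
  range.\<close>

lemma kernel_T: "{t. T t = 0} = range (\<lambda>t. t - outer_mult f t)"
proof (intro set_eqI iffI)
  fix t assume "t \<in> {t. T t = 0}"
  then have "outer_mult f t = 0"
    by (simp add: R_T_outer_mult[symmetric] clinear_0[OF clinear_R])
  then show "t \<in> range (\<lambda>t. t - outer_mult f t)"
    by (intro range_eqI[of _ _ t]) simp
next
  fix t assume "t \<in> range (\<lambda>t. t - outer_mult f t)"
  then show "t \<in> {t. T t = 0}"
    by (auto simp: clinear_diff[OF clinear_T] R_T_outer_mult[symmetric] T_R_unit_proj unit_proj_T)
qed

end

section \<open>Construction of the antipode\<close>

locale weak_coproduct_inverse = weak_coproduct_F +
  assumes range_T: "range T = range unit_proj"
    and kernel_T: "{t. T t = 0} = range (\<lambda>t. t - outer_mult f t)"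
begin

lemma T_outer_mult: "T (outer_mult f t) = T t"
proof -
  have "t - outer_mult f t \<in> {t. T t = 0}"
    unfolding kernel_T by simp
  then show ?thesis by (simp add: clinear_diff[OF clinear_T])
qed

text \<open>The kernel of \<open>T\<close> is the range of the complement of
  \<open>outer_mult f\<close>, which is killed because \<open>outer_mult f\<close> is
  idempotent.\<close>

lemma outer_mult_cong:
  assumes "T s = T t"
  shows "outer_mult f s = outer_mult f t"
proof -
  have "s - t \<in> {t. T t = 0}"
    using assms by (simp add: clinear_diff[OF clinear_T])
  then obtain r where "s - t = r - outer_mult f r"
    unfolding kernel_T by auto
  then have "outer_mult f (s - t) = 0"
    by (simp add: clinear_diff[OF clinear_outer_mult] outer_mult_idem)
  then show ?thesis by (simp add: clinear_diff[OF clinear_outer_mult])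
qed

text \<open>A preimage under \<open>T\<close> is chosen and then projected by
  \<open>outer_mult f\<close>. By \<open>outer_mult_cong\<close> the result does not depend on the
  choice, hence it is linear in \<open>t\<close>.\<close>

definition R :: "('a, 'a) tensor \<Rightarrow> ('a, 'a) tensor"
  where "R t = outer_mult f (SOME s. T s = unit_proj t)"

lemma R_eqI: "T s = unit_proj t \<Longrightarrow> R t = outer_mult f s"
  unfolding R_def by (rule outer_mult_cong) (metis (mono_tags, lifting) someI)

lemma T_surj:
  obtains s where "T s = unit_proj t"
  using range_T rangeI[of unit_proj t] by (metis rangeE)

lemma clinear_R: "clinear R"
proof (rule clinearI)
  fix s t c
  obtain s' t' where s': "T s' = unit_proj s" and t': "T t' = unit_proj t"
    by (metis T_surj)
  have "T (s' + t') = unit_proj (s + t)"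
    by (simp add: s' t' clinear_add[OF clinear_T] clinear_add[OF clinear_unit_proj])
  then show "R (s + t) = R s + R t"
    by (simp add: R_eqI[OF s'] R_eqI[OF t'] R_eqI clinear_add[OF clinear_outer_mult])
  have "T (c *\<^sub>C s') = unit_proj (c *\<^sub>C s)"
    by (simp add: s' clinear_scale[OF clinear_T] clinear_scale[OF clinear_unit_proj])
  then show "R (c *\<^sub>C s) = c *\<^sub>C R s"
    by (simp add: R_eqI[OF s'] R_eqI clinear_scale[OF clinear_outer_mult])
qed

lemma T_R: "T (R t) = unit_proj t"
  by (metis R_eqI T_outer_mult T_surj)

lemma R_T: "R (T t) = outer_mult f t"
  by (rule R_eqI) (simp add: unit_proj_T)

lemma R_unit_proj: "R (unit_proj t) = R t"
  by (metis R_eqI T_surj unit_proj_T)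

lemma R_T_R: "R (T (R t)) = R t"
  by (simp add: T_R R_unit_proj)

lemmas rlin = alin clinear_R clinear_compose[OF clinear_R]

text \<open>A generalized inverse is natural: a map \<open>h\<close> compatible with the operators
  and their two projections is compatible with the inverses, as seen by writing
  \<open>unit_proj t\<close> as \<open>T s\<close>.\<close>

lemma R_intertwine:
  assumes "\<And>t. T' (h t) = h (T t)" "\<And>t. unit_proj' (h t) = h (unit_proj t)"
    and "\<And>t. outer' (h t) = h (outer_mult f t)" "\<And>t. R' (unit_proj' t) = R' t"
    and "\<And>t. R' (T' t) = outer' t"
  shows "R' (h t) = h (R t)"
proof -
  obtain s where s: "T s = unit_proj t" by (rule T_surj)
  have "R' (h t) = R' (h (T s))"
    by (simp add: s assms(2)[symmetric] assms(4))
  also have "\<dots> = h (R t)"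
    by (simp add: assms(1)[symmetric] assms(3,5) R_eqI[OF s])
  finally show ?thesis .
qed

section \<open>Compatibility of \<open>R\<close> with the coproduct on the first leg\<close>

definition Delta_left :: "('a, 'a) tensor \<Rightarrow> ('a, ('a, 'a) tensor) tensor"
  where "Delta_left = tlift (\<lambda>a b. sw a (\<lambda>x y. x \<otimes> y \<otimes> b))"

lemma Delta_left_tprod [simp]: "Delta_left (a \<otimes> b) = sw a (\<lambda>x y. x \<otimes> y \<otimes> b)"
  unfolding Delta_left_def by (simp add: tlift_tensor alin)

lemma clinear_Delta_left: "clinear Delta_left"
  unfolding Delta_left_def by (simp add: alin)

lemma Delta_left_T: "tmap id T (Delta_left t) = Delta_left (T t)"
proof (rule clinear_tensor_eqI[where f = "\<lambda>t. tmap id T (Delta_left t)"])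
  fix a b
  have "tmap id T (Delta_left (a \<otimes> b)) = sw a (\<lambda>x y. sw y (\<lambda>p q. x \<otimes> p \<otimes> q \<cdot> b))"
    by (simp add: tlift_pull[of "tmap (\<lambda>x. x) T"] clinear_tmap alin id_def tlift_pull[of "\<lambda>z. _ \<otimes> z"])
  also have "\<dots> = sw a (\<lambda>x y. sw x (\<lambda>p q. p \<otimes> q \<otimes> y \<cdot> b))"
    by (rule sw_coassoc[symmetric]; simp add: alin)
  also have "\<dots> = Delta_left (T (a \<otimes> b))"
    by (simp add: tlift_pull[of Delta_left] clinear_Delta_left alin)
  finally show "tmap id T (Delta_left (a \<otimes> b)) = Delta_left (T (a \<otimes> b))" .
qed (simp_all add: id_def clinear_compose[OF clinear_tmap] clinear_compose[OF clinear_Delta_left] alin clinear_Delta_left)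

text \<open>Writing \<Delta>(a) as \<Delta>(1)\<Delta>(a) produces (1 \<otimes> E)(E \<otimes> 1),
  which \<open>Delta_unit2\<close> identifies with (\<Delta> \<otimes> \<iota>)E.\<close>

lemma Delta_left_unit_proj: "tmap id unit_proj (Delta_left t) = Delta_left (unit_proj t)"
proof (rule clinear_tensor_eqI[where f = "\<lambda>t. tmap id unit_proj (Delta_left t)"])
  fix a b
  have "tmap id unit_proj (Delta_left (a \<otimes> b)) = sw a (\<lambda>x y. sw u (\<lambda>p q. x \<otimes> p \<cdot> y \<otimes> q \<cdot> b))"
    by (simp add: tlift_pull[of "tmap (\<lambda>x. x) unit_proj"] clinear_tmap alin id_def tlift_pull[of "\<lambda>z. _ \<otimes> z"])
  also have "\<dots> = sw u (\<lambda>r s. sw a (\<lambda>x y. sw u (\<lambda>p q. r \<cdot> x \<otimes> p \<cdot> (s \<cdot> y) \<otimes> q \<cdot> b)))"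
    by (rule sw_unit_left[symmetric]; simp add: alin)
  also have "\<dots> = sw u (\<lambda>r s. sw u (\<lambda>p q. sw a (\<lambda>x y. r \<cdot> x \<otimes> (p \<cdot> s) \<cdot> y \<otimes> q \<cdot> b)))"
    by (rule arg_cong[where f = "\<lambda>h. sw u h"], intro ext) (subst tlift_swap; simp add: alin assoc)
  also have "\<dots> = sw u (\<lambda>p q. sw p (\<lambda>r s. sw a (\<lambda>x y. r \<cdot> x \<otimes> s \<cdot> y \<otimes> q \<cdot> b)))"
    by (rule sw_unit2[symmetric]; simp add: alin)
  also have "\<dots> = Delta_left (unit_proj (a \<otimes> b))"
    by (simp add: tlift_pull[of Delta_left] clinear_Delta_left alin sw_mult)
  finally show "tmap id unit_proj (Delta_left (a \<otimes> b)) = Delta_left (unit_proj (a \<otimes> b))" .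
qed (simp_all add: id_def clinear_compose[OF clinear_tmap] clinear_compose[OF clinear_Delta_left] alin clinear_Delta_left)

text \<open>Now \<Delta>(1) is inserted to the right of \<Delta>(a). With the first copy of
  \<Delta>(1) inside \<open>f\<close> it forms (E \<otimes> 1)(1 \<otimes> E), to which
  \<open>Delta_unit1\<close> applies.\<close>

lemma Delta_left_outer_mult: "tmap id (outer_mult f) (Delta_left t) = Delta_left (outer_mult f t)"
proof (rule clinear_tensor_eqI[where f = "\<lambda>t. tmap id (outer_mult f) (Delta_left t)"])
  fix a b
  have "tmap id (outer_mult f) (Delta_left (a \<otimes> b))
      = sw a (\<lambda>r s. sw u (\<lambda>x y. sw u (\<lambda>p q. \<epsilon> (y \<cdot> q) *\<^sub>C (r \<otimes> s \<cdot> x \<otimes> p \<cdot> b))))"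
    by (simp add: outer_mult_tprod_eq tlift_pull[of "tmap (\<lambda>x. x) (outer_mult f)"] clinear_tmap alin id_def tlift_pull[of "\<lambda>z. _ \<otimes> z"]
      clinear_scale[of "\<lambda>z. _ \<otimes> z"] del: outer_mult_tprod)
  also have "\<dots> = sw a (\<lambda>r s. sw u (\<lambda>x1 x2. sw u (\<lambda>x y. sw u (\<lambda>p q. \<epsilon> (y \<cdot> q) *\<^sub>C
      (r \<cdot> x1 \<otimes> s \<cdot> x2 \<cdot> x \<otimes> p \<cdot> b)))))"
    by (rule sw_unit_right[symmetric]; simp add: alin)
  also have "\<dots> = sw a (\<lambda>r s. sw u (\<lambda>x y. sw x (\<lambda>x1 x2. sw u (\<lambda>p q. \<epsilon> (y \<cdot> q) *\<^sub>C
      (r \<cdot> x1 \<otimes> s \<cdot> x2 \<otimes> p \<cdot> b)))))"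
    by (rule arg_cong[where f = "\<lambda>h. sw a h"], intro ext) (subst sw_unit1; simp add: alin assoc)
  also have "\<dots> = sw u (\<lambda>x y. sw a (\<lambda>r s. sw x (\<lambda>x1 x2. sw u (\<lambda>p q. \<epsilon> (y \<cdot> q) *\<^sub>C
      (r \<cdot> x1 \<otimes> s \<cdot> x2 \<otimes> p \<cdot> b)))))"
    by (rule tlift_swap; simp add: alin)
  also have "\<dots> = sw u (\<lambda>x y. sw (a \<cdot> x) (\<lambda>r s. sw u (\<lambda>p q. \<epsilon> (y \<cdot> q) *\<^sub>C (r \<otimes> s \<otimes> p \<cdot> b))))"
    by (simp add: sw_mult alin)
  also have "\<dots> = sw u (\<lambda>x y. sw u (\<lambda>p q. sw (a \<cdot> x) (\<lambda>r s. \<epsilon> (y \<cdot> q) *\<^sub>C (r \<otimes> s \<otimes> p \<cdot> b))))"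
    by (rule arg_cong[where f = "\<lambda>h. sw u h"], intro ext, rule tlift_swap; simp add: alin)
  also have "\<dots> = Delta_left (outer_mult f (a \<otimes> b))"
    by (simp add: outer_mult_tprod_eq tlift_pull[of Delta_left] clinear_scale[OF clinear_Delta_left] clinear_Delta_left alin
      tlift_pull[of "\<lambda>x. _ *\<^sub>C x"] del: outer_mult_tprod)
  finally show "tmap id (outer_mult f) (Delta_left (a \<otimes> b)) = Delta_left (outer_mult f (a \<otimes> b))" .
qed (simp_all add: id_def clinear_compose[OF clinear_tmap] clinear_compose[OF clinear_Delta_left] alin clinear_Delta_left)

lemma Delta_left_R: "tmap id R (Delta_left t) = Delta_left (R t)"
proof (rule R_intertwine[OF Delta_left_T Delta_left_unit_proj Delta_left_outer_mult])
  have c: "tmap id h (tmap id k t) = tmap id (\<lambda>t. h (k t)) t" if "clinear h" "clinear k"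
    for h k :: "('a, 'a) tensor \<Rightarrow> ('a, 'a) tensor" and t :: "('a, ('a, 'a) tensor) tensor"
    by (rule clinear_tensor_eqI[where f = "\<lambda>t. tmap id h (tmap id k t)"])
      (simp_all add: that clinear_compose[OF that] clinear_compose[OF clinear_tmap] clinear_tmap id_def lin)
  show "tmap id R (tmap id unit_proj t) = tmap id R t" for t :: "('a, ('a, 'a) tensor) tensor"
    by (simp add: c rlin R_unit_proj)
  show "tmap id R (tmap id T t) = tmap id (outer_mult f) t" for t :: "('a, ('a, 'a) tensor) tensor"
    by (simp add: c rlin R_T)
qed

definition mult_right :: "'a \<Rightarrow> ('a, 'a) tensor \<Rightarrow> ('a, 'a) tensor"
  where "mult_right c = tlift (\<lambda>a b. a \<otimes> b \<cdot> c)"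

lemma mult_right_tprod [simp]: "mult_right c (a \<otimes> b) = a \<otimes> b \<cdot> c"
  unfolding mult_right_def by (simp add: tlift_tensor alin)

lemma clinear_mult_right: "clinear (mult_right c)"
  unfolding mult_right_def by (simp add: alin)

text \<open>The three operators act on the second leg by multiplication from the left only, so they
  commute with multiplication from the right.\<close>

lemma mult_right_R: "R (mult_right c t) = mult_right c (R t)"
proof (rule R_intertwine)
  note m = alin clinear_mult_right clinear_compose[OF clinear_mult_right]
  show "T (mult_right c t) = mult_right c (T t)" for t
    by (rule clinear_tensor_eqI[where f = "\<lambda>t. T (mult_right c t)"])
      (simp_all add: m tlift_pull[of "mult_right c"] assoc)
  show "unit_proj (mult_right c t) = mult_right c (unit_proj t)" for t
    by (rule clinear_tensor_eqI[where f = "\<lambda>t. unit_proj (mult_right c t)"])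
      (simp_all add: m tlift_pull[of "mult_right c"] assoc)
  show "outer_mult f (mult_right c t) = mult_right c (outer_mult f t)" for t
    by (rule clinear_tensor_eqI[where f = "\<lambda>t. outer_mult f (mult_right c t)"])
      (simp_all add: m tlift_pull[of "mult_right c"] assoc)
qed (simp_all add: R_unit_proj R_T)

text \<open>The defining formula \<open>S(a)b = (\<epsilon> \<otimes> \<iota>)R\<^sub>1(a \<otimes>
  b)\<close> at \<open>b = 1\<close>; \<open>slice_R\<close> recovers general
  \<open>b\<close>.\<close>

definition S :: "'a \<Rightarrow> 'a"
  where "S a = slice_left \<epsilon> (R (a \<otimes> u))"

lemma slice_tprod [simp]: "slice_left \<epsilon> (a \<otimes> b) = \<epsilon> a *\<^sub>C b"
  for b :: "'b::complex_vector"
  unfolding slice_left_def by (simp add: tlift_tensor alin)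

lemma clinear_slice: "clinear (slice_left \<epsilon> :: ('a, 'b::complex_vector) tensor \<Rightarrow> 'b)"
  unfolding slice_left_def by (simp add: alin)

lemmas ilin = rlin clinear_slice clinear_compose[OF clinear_slice]

lemma clinear_S: "clinear S"
  unfolding S_def by (simp add: ilin)

lemma slice_R: "slice_left \<epsilon> (R (a \<otimes> b)) = S a \<cdot> b"
proof -
  have "slice_left \<epsilon> (mult_right b t) = slice_left \<epsilon> t \<cdot> b" for t
    by (rule clinear_tensor_eqI[where f = "\<lambda>t. slice_left \<epsilon> (mult_right b t)"])
      (simp_all add: ilin clinear_mult_right clinear_compose[OF clinear_mult_right] clinear_scale[of "\<lambda>z. z \<cdot> _"])
  then show ?thesis
    using mult_right_R[of b "a \<otimes> u"] by (simp add: S_def)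
qed

text \<open>Applying \<epsilon> to the middle leg undoes \<Delta> \<otimes> \<iota>. Done on both
  sides of \<open>Delta_left_R\<close>, this leaves \<open>R (a \<otimes> b)\<close> on one side and
  slices evaluated by \<open>slice_R\<close> on the other.\<close>

lemma R_tprod: "R (a \<otimes> b) = sw a (\<lambda>x y. x \<otimes> S y \<cdot> b)"
proof -
  have "tmap id (slice_left \<epsilon>) (Delta_left t) = t" for t
    by (rule clinear_tensor_eqI[where f = "\<lambda>t. tmap id (slice_left \<epsilon>) (Delta_left t)"])
      (simp_all add: id_def clinear_compose[OF clinear_tmap] clinear_tmap ilin clinear_Delta_left
        tlift_pull[of "tmap _ _"] sw_counit2 clinear_scale[of "\<lambda>z. _ \<otimes> z"])
  then have "R (a \<otimes> b) = tmap id (slice_left \<epsilon>) (tmap id R (Delta_left (a \<otimes> b)))"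
    by (simp only: Delta_left_R)
  then show ?thesis
    by (simp add: id_def clinear_tmap ilin tlift_pull[of "tmap _ _"] slice_R)
qed

text \<open>The three identities for \<open>S\<close> are TR = E, RT = \<open>outer_mult f\<close>
  and RTR = R at \<open>a \<otimes> u\<close>, the last one after applying \<epsilon> to the first
  leg.\<close>

lemma antipode: "weak_coproduct_antipode mult u \<Delta> \<epsilon> f S"
proof unfold_locales
  note s = ilin clinear_S clinear_compose[OF clinear_S]
  show "S (a + b) = S a + S b" "S (c *\<^sub>C a) = c *\<^sub>C S a" for a b c
    by (simp_all add: clinear_add[OF clinear_S] clinear_scale[OF clinear_S])
  fix a
  have TR: "T (R (a \<otimes> u)) = sw a (\<lambda>x y. sw x (\<lambda>p q. p \<otimes> q \<cdot> S y))"
    by (simp add: R_tprod tlift_pull[of T] s)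
  also have "\<dots> = sw a (\<lambda>x y. sw y (\<lambda>p q. x \<otimes> p \<cdot> S q))"
    by (rule sw_coassoc; simp add: s)
  finally show "sw a (\<lambda>x y. sw y (\<lambda>p q. x \<otimes> p \<cdot> S q)) = sw u (\<lambda>p q. p \<cdot> a \<otimes> q)"
    by (simp add: T_R)
  have "tlift (\<lambda>p q. a \<cdot> p \<otimes> q) f = R (T (a \<otimes> u))"
    unfolding R_T by simp
  also have "\<dots> = sw a (\<lambda>x y. sw x (\<lambda>p q. p \<otimes> S q \<cdot> y))"
    by (simp add: R_tprod tlift_pull[of R] s)
  also have "\<dots> = sw a (\<lambda>x y. sw y (\<lambda>p q. x \<otimes> S p \<cdot> q))"
    by (rule sw_coassoc; simp add: s)
  finally show "sw a (\<lambda>x y. sw y (\<lambda>p q. x \<otimes> S p \<cdot> q)) = tlift (\<lambda>p q. a \<cdot> p \<otimes> q) f" ..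
  have "S a = slice_left \<epsilon> (R (T (R (a \<otimes> u))))"
    by (simp add: R_T_R S_def)
  also have "\<dots> = sw a (\<lambda>x y. sw x (\<lambda>p q. S p \<cdot> (q \<cdot> S y)))"
    by (simp add: TR tlift_pull[of R] tlift_pull[of "slice_left \<epsilon>"] s slice_R)
  also have "\<dots> = sw a (\<lambda>x y. sw y (\<lambda>p q. S x \<cdot> p \<cdot> S q))"
    by (subst sw_coassoc; simp add: s assoc)
  finally show "sw a (\<lambda>x y. sw y (\<lambda>p q. S x \<cdot> p \<cdot> S q)) = S a" ..
qed

end

section \<open>Weak Hopf algebras\<close>

locale weak_Hopf = weak_coproduct +
  fixes S :: "'a \<Rightarrow> 'a"
  assumes clinear_antipode: "clinear S"
    and counit_mult3: "\<epsilon> (a \<cdot> b \<cdot> c) = sw b (\<lambda>x y. \<epsilon> (a \<cdot> x) * \<epsilon> (y \<cdot> c))"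
    and counit_mult3_swap: "\<epsilon> (a \<cdot> b \<cdot> c) = sw b (\<lambda>x y. \<epsilon> (a \<cdot> y) * \<epsilon> (x \<cdot> c))"
    and S_target: "sw a (\<lambda>x y. x \<cdot> S y) = target a"
    and S_source: "sw a (\<lambda>x y. S x \<cdot> y) = source a"
    and S_id_S: "sw a (\<lambda>x y. sw y (\<lambda>p q. S x \<cdot> p \<cdot> S q)) = S a"
begin

lemmas hlin = alin clinear_antipode clinear_compose[OF clinear_antipode]

text \<open>The same \<open>S\<close> serves both structures: the reversal exchanges
  \<open>S_target\<close> with \<open>S_source\<close> and preserves each form of weak
  multiplicativity.\<close>

lemma opposite_weak_Hopf: "weak_Hopf (\<lambda>a b. b \<cdot> a) u (\<lambda>a. flip (\<Delta> a)) \<epsilon> S"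
proof (rule weak_Hopf.intro[OF opposite], rule weak_Hopf_axioms.intro)
  note t = tlift_flip hlin weak_coproduct.target_def[OF opposite] weak_coproduct.source_def[OF opposite]
  fix a b c
  show "\<epsilon> (c \<cdot> (b \<cdot> a)) = tlift (\<lambda>x y. \<epsilon> (x \<cdot> a) * \<epsilon> (c \<cdot> y)) (flip (\<Delta> b))"
    "\<epsilon> (c \<cdot> (b \<cdot> a)) = tlift (\<lambda>x y. \<epsilon> (y \<cdot> a) * \<epsilon> (c \<cdot> x)) (flip (\<Delta> b))"
    using counit_mult3[of c b a] counit_mult3_swap[of c b a]
    by (simp_all add: t assoc mult.commute)
  show "tlift (\<lambda>x y. S y \<cdot> x) (flip (\<Delta> a)) = weak_coproduct.target (\<lambda>a b. b \<cdot> a) u (\<lambda>a. flip (\<Delta> a)) \<epsilon> a"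
    "tlift (\<lambda>x y. y \<cdot> S x) (flip (\<Delta> a)) = weak_coproduct.source (\<lambda>a b. b \<cdot> a) u (\<lambda>a. flip (\<Delta> a)) \<epsilon> a"
    using S_target[of a] S_source[of a] by (simp_all add: t target_def source_def)
  show "tlift (\<lambda>x y. tlift (\<lambda>p q. S q \<cdot> (p \<cdot> S x)) (flip (\<Delta> y))) (flip (\<Delta> a)) = S a"
    using S_id_S[of a] sw_coassoc[of "\<lambda>x y z. S x \<cdot> y \<cdot> S z" a] by (simp add: t assoc)
qed (rule clinear_antipode)

text \<open>Together with \<open>S_target\<close> this becomes TR = E. Inserting \<Delta>(1) and
  splitting \<open>target (q \<cdot> y)\<close> by weak multiplicativity leaves a counit on the
  second leg of \<open>a\<close>, which removes it.\<close>

lemma unit_target: "sw a (\<lambda>x y. x \<otimes> target y) = sw u (\<lambda>p q. p \<cdot> a \<otimes> q)"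
proof -
  have target_mult: "target (q \<cdot> y) = sw q (\<lambda>q1 q2. \<epsilon> (q1 \<cdot> y) *\<^sub>C target q2)" for q y
  proof -
    have 1: "\<epsilon> (r \<cdot> (q \<cdot> y)) *\<^sub>C s = sw q (\<lambda>q1 q2. \<epsilon> (q1 \<cdot> y) *\<^sub>C \<epsilon> (r \<cdot> q2) *\<^sub>C s)" for r s
      unfolding assoc[symmetric] counit_mult3_swap
      by (simp add: tlift_pull[of "\<lambda>z. z *\<^sub>C _"] hlin mult.commute)
    have "target (q \<cdot> y) = sw u (\<lambda>r s. sw q (\<lambda>q1 q2. \<epsilon> (q1 \<cdot> y) *\<^sub>C \<epsilon> (r \<cdot> q2) *\<^sub>C s))"
      unfolding target_def by (rule arg_cong[where f = "\<lambda>h. sw u h"], intro ext, rule 1)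
    also have "\<dots> = sw q (\<lambda>q1 q2. \<epsilon> (q1 \<cdot> y) *\<^sub>C target q2)"
      unfolding target_def by (subst tlift_swap; simp add: hlin tlift_pull[of "\<lambda>z. _ *\<^sub>C z"])
    finally show ?thesis .
  qed
  have "sw a (\<lambda>x y. x \<otimes> target y) = sw u (\<lambda>p q. sw a (\<lambda>x y. p \<cdot> x \<otimes> target (q \<cdot> y)))"
    by (rule sw_unit_left[symmetric]; simp add: hlin)
  also have "\<dots> = sw u (\<lambda>p q. sw a (\<lambda>x y. sw q (\<lambda>q1 q2. \<epsilon> (q1 \<cdot> y) *\<^sub>C (p \<cdot> x \<otimes> target q2))))"
    by (simp add: target_mult tlift_pull[of "\<lambda>z. _ \<otimes> z"] hlin clinear_scale[of "\<lambda>z. _ \<otimes> z"])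
  also have "\<dots> = sw u (\<lambda>p q. sw q (\<lambda>q1 q2. sw a (\<lambda>x y. \<epsilon> (q1 \<cdot> y) *\<^sub>C (p \<cdot> x \<otimes> target q2))))"
    by (rule arg_cong[where f = "\<lambda>h. sw u h"], intro ext, rule tlift_swap; simp add: hlin)
  also have "\<dots> = sw u (\<lambda>m q2. sw m (\<lambda>p q1. sw a (\<lambda>x y. \<epsilon> (q1 \<cdot> y) *\<^sub>C (p \<cdot> x \<otimes> target q2))))"
    by (rule sw_coassoc[symmetric]; simp add: hlin)
  also have "\<dots> = sw u (\<lambda>m q2. sw (m \<cdot> a) (\<lambda>x y. \<epsilon> y *\<^sub>C (x \<otimes> target q2)))"
    by (simp add: sw_mult hlin)
  also have "\<dots> = sw u (\<lambda>m y. sw u (\<lambda>r s. \<epsilon> (r \<cdot> y) *\<^sub>C (m \<cdot> a \<otimes> s)))"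
    by (simp add: sw_counit2 hlin, simp add: target_def tlift_pull[of "\<lambda>z. _ \<otimes> z"] hlin
        clinear_scale[of "\<lambda>z. _ \<otimes> z"])
  also have "\<dots> = sw u (\<lambda>p q. p \<cdot> a \<otimes> q)"
    by (rule sw_unit_counit; simp add: hlin)
  finally show ?thesis .
qed

text \<open>This is \<open>unit_target\<close> for the opposite structure.\<close>

lemma source_split: "sw a (\<lambda>x y. source x \<otimes> y) = sw u (\<lambda>p q. p \<otimes> a \<cdot> q)"
proof -
  have "weak_coproduct.target (\<lambda>a b. b \<cdot> a) u (\<lambda>a. flip (\<Delta> a)) \<epsilon> = source"
    by (simp add: fun_eq_iff weak_coproduct.target_def[OF opposite] source_def tlift_flip hlin)
  then show ?thesis
    using arg_cong[OF weak_Hopf.unit_target[OF opposite_weak_Hopf, of a], of flip]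
    by (simp add: tlift_flip tlift_pull[of flip] clinear_flip hlin)
qed

text \<open>The argument of \<open>unit_target\<close> with \<Delta>(1) inserted on the right;
  \<open>source q\<close> stays, as its value is what enters \<open>F\<close>.\<close>

lemma unit_source: "sw a (\<lambda>x y. x \<otimes> source y) = sw u (\<lambda>p q. a \<cdot> p \<otimes> source q)"
proof -
  have source_mult: "source (y \<cdot> q) = sw q (\<lambda>q1 q2. \<epsilon> (y \<cdot> q1) *\<^sub>C source q2)" for q y
  proof -
    have "source (y \<cdot> q) = sw u (\<lambda>r s. sw q (\<lambda>q1 q2. \<epsilon> (y \<cdot> q1) *\<^sub>C \<epsilon> (q2 \<cdot> s) *\<^sub>C r))"
      unfolding source_def counit_mult3
      by (simp add: tlift_pull[of "\<lambda>z. z *\<^sub>C _"] hlin)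
    also have "\<dots> = sw q (\<lambda>q1 q2. \<epsilon> (y \<cdot> q1) *\<^sub>C source q2)"
      unfolding source_def by (subst tlift_swap; simp add: hlin tlift_pull[of "\<lambda>z. _ *\<^sub>C z"])
    finally show ?thesis .
  qed
  have "sw a (\<lambda>x y. x \<otimes> source y) = sw a (\<lambda>x y. sw u (\<lambda>p q. x \<cdot> p \<otimes> source (y \<cdot> q)))"
    by (rule sw_unit_right[symmetric]; simp add: hlin)
  also have "\<dots> = sw a (\<lambda>x y. sw u (\<lambda>p q. sw q (\<lambda>q1 q2. \<epsilon> (y \<cdot> q1) *\<^sub>C (x \<cdot> p \<otimes> source q2))))"
    by (simp add: source_mult tlift_pull[of "\<lambda>z. _ \<otimes> z"] hlin clinear_scale[of "\<lambda>z. _ \<otimes> z"])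
  also have "\<dots> = sw a (\<lambda>x y. sw u (\<lambda>m q2. sw m (\<lambda>p q1. \<epsilon> (y \<cdot> q1) *\<^sub>C (x \<cdot> p \<otimes> source q2))))"
    by (rule arg_cong[where f = "\<lambda>h. sw a h"], intro ext, rule sw_coassoc[symmetric]; simp add: hlin)
  also have "\<dots> = sw u (\<lambda>m q2. sw a (\<lambda>x y. sw m (\<lambda>p q1. \<epsilon> (y \<cdot> q1) *\<^sub>C (x \<cdot> p \<otimes> source q2))))"
    by (rule tlift_swap; simp add: hlin)
  also have "\<dots> = sw u (\<lambda>m q2. sw (a \<cdot> m) (\<lambda>x y. \<epsilon> y *\<^sub>C (x \<otimes> source q2)))"
    by (simp add: sw_mult hlin)
  also have "\<dots> = sw u (\<lambda>p q. a \<cdot> p \<otimes> source q)"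
    by (simp add: sw_counit2 hlin)
  finally show ?thesis .
qed

definition F :: "('a, 'a) tensor"
  where "F = sw u (\<lambda>x y. x \<otimes> source y)"

lemma antipode: "weak_coproduct_antipode mult u \<Delta> \<epsilon> F S"
proof unfold_locales
  show "S (a + b) = S a + S b" "S (c *\<^sub>C a) = c *\<^sub>C S a" for a b c
    by (simp_all add: clinear_add[OF clinear_antipode] clinear_scale[OF clinear_antipode])
  show "sw a (\<lambda>x y. sw y (\<lambda>p q. x \<otimes> p \<cdot> S q)) = sw u (\<lambda>p q. p \<cdot> a \<otimes> q)" for a
    unfolding unit_target[symmetric] S_target[symmetric]
    by (simp add: tlift_pull[of "\<lambda>z. _ \<otimes> z"] hlin)
  show "sw a (\<lambda>x y. sw y (\<lambda>p q. x \<otimes> S p \<cdot> q)) = tlift (\<lambda>p q. a \<cdot> p \<otimes> q) F" for a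
  proof -
    have "sw a (\<lambda>x y. sw y (\<lambda>p q. x \<otimes> S p \<cdot> q)) = sw a (\<lambda>x y. x \<otimes> source y)"
      by (simp add: S_source[symmetric] tlift_pull[of "\<lambda>z. _ \<otimes> z"] hlin)
    also have "\<dots> = tlift (\<lambda>p q. a \<cdot> p \<otimes> q) F"
      unfolding unit_source[of a] by (simp add: F_def tlift_tlift tlift_tensor hlin)
    finally show ?thesis .
  qed
  show "sw a (\<lambda>x y. sw y (\<lambda>p q. S x \<cdot> p \<cdot> S q)) = S a" for a
    by (rule S_id_S)
  have 1: "sw u (\<lambda>r s. x \<cdot> r \<otimes> source s \<otimes> y) = sw x (\<lambda>p q. p \<otimes> source q \<otimes> y)" for x y
    using arg_cong[OF unit_source[of x], of "tlift (\<lambda>p q. p \<otimes> q \<otimes> y)"]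
    by (simp add: tlift_tlift tlift_tensor hlin)
  have 2: "sw y (\<lambda>p q. x \<otimes> source p \<otimes> q) = sw u (\<lambda>p q. x \<otimes> p \<otimes> y \<cdot> q)" for x y
    using arg_cong[OF source_split[of y], of "\<lambda>z. x \<otimes> z"]
    by (simp add: tlift_pull[of "\<lambda>z. _ \<otimes> z"] hlin)
  \<comment> \<open>Both sides of \<open>unit_f\<close> equal
    \<open>1\<^sub>1 \<otimes> source 1\<^sub>2 \<otimes> 1\<^sub>3\<close>: one by
    \<open>unit_source\<close>, the other by \<open>source_split\<close>.\<close>
  have "sw u (\<lambda>x y. tlift (\<lambda>p q. x \<cdot> p \<otimes> q \<otimes> y) F) = sw u (\<lambda>x y. sw x (\<lambda>p q. p \<otimes> source q \<otimes> y))"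
    by (simp add: F_def tlift_tlift tlift_tensor hlin 1)
  also have "\<dots> = sw u (\<lambda>x y. sw y (\<lambda>p q. x \<otimes> source p \<otimes> q))"
    by (rule sw_coassoc; simp add: hlin)
  finally show "sw u (\<lambda>x y. tlift (\<lambda>p q. x \<cdot> p \<otimes> q \<otimes> y) F) = sw u (\<lambda>x y. sw u (\<lambda>p q. x \<otimes> p \<otimes> y \<cdot> q))"
    by (simp add: 2)
qed

end

section \<open>Multipliers of unital algebras\<close>

lemma emb_is_one: "is_one v \<Longrightarrow> emb v = 1"
  by (rule multiplier_eqI) (simp_all add: is_one_def)

text \<open>A multiplier of a unital algebra is multiplication by its value at the unit, so
  \<open>emb\<close> is bijective there.\<close>

lemma emb_lmul_is_one:
  fixes v :: "'a::complex_algebra"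
  assumes "is_one v"
  shows "emb (lmul m v) = m"
proof (rule multiplier_eqI)
  show "lmul (emb (lmul m v)) a = lmul m a" for a
    using assms lmul_mult[of m v a] by (simp add: is_one_def)
  show "rmul (emb (lmul m v)) a = rmul m a" for a
    using assms rmul_lmul[of m a v] by (simp add: is_one_def)
qed

lemma emb_inject:
  fixes v s t :: "'a::complex_algebra"
  assumes "is_one v"
  shows "emb s = emb t \<longleftrightarrow> s = t"
proof
  assume "emb s = emb t"
  then have "lmul (emb s) v = lmul (emb t) v" by simp
  with assms show "s = t" by (simp add: is_one_def)
qed simp

lemma unemb_emb: "is_one v \<Longrightarrow> unemb (emb s) = s"
  for v s :: "'a::complex_algebra"
  unfolding unemb_def by (rule inv_f_f) (simp add: inj_def emb_inject)

lemma emb_unemb: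
  fixes v :: "'a::complex_algebra" and m :: "'a multiplier"
  assumes "is_one v"
  shows "emb (unemb m) = m"
proof -
  have "emb (unemb (emb (lmul m v))) = emb (lmul m v)"
    by (simp only: unemb_emb[OF assms])
  then show ?thesis by (simp only: emb_lmul_is_one[OF assms])
qed

lemma emb_mult: "emb (a * b) = emb a * emb b"
  by (rule multiplier_eqI) (simp_all add: mult.assoc)

lemma clinear_emb: "clinear f \<Longrightarrow> clinear (\<lambda>x. emb (f x))"
  by (intro clinearI; rule multiplier_eqI)
    (simp_all add: clinear_add clinear_scale distrib_left distrib_right mult_scaleC_left mult_scaleC_right)

lemma is_one_tprod:
  assumes "is_one v" "is_one w"
  shows "is_one (v \<otimes> w)"
proof -
  have "(v \<otimes> w) * t = t" for t
    by (rule clinear_tensor_eqI[where f = "\<lambda>t. (v \<otimes> w) * t" and g = "\<lambda>t. t"])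
      (use assms in \<open>simp_all add: lin is_one_def\<close>)
  moreover have "t * (v \<otimes> w) = t" for t
    by (rule clinear_tensor_eqI[where f = "\<lambda>t. t * (v \<otimes> w)" and g = "\<lambda>t. t"])
      (use assms in \<open>simp_all add: lin is_one_def\<close>)
  ultimately show ?thesis by (simp add: is_one_def)
qed

lemma mtensor_emb: "emb a \<otimes>\<^sub>M emb b = emb (a \<otimes> b)"
proof (rule multiplier_eqI)
  show "lmul (emb a \<otimes>\<^sub>M emb b) t = lmul (emb (a \<otimes> b)) t" for t
    by (rule clinear_tensor_eqI[OF clinear_lmul clinear_lmul]) (simp add: clinear_lmul)
  show "rmul (emb a \<otimes>\<^sub>M emb b) t = rmul (emb (a \<otimes> b)) t" for t
    by (rule clinear_tensor_eqI[OF clinear_rmul clinear_rmul]) (simp add: clinear_rmul)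
qed

lemma massoc_emb: "massoc (emb t) = emb (tassoc t)"
  by (rule multiplier_eqI) simp_all

lemma tassoc_tprod_left: "tassoc (s \<otimes> c) = tlift (\<lambda>p q. p \<otimes> q \<otimes> c) s"
  unfolding tassoc_def by (simp add: tlift_tensor lin)

lemma tprod_eq_tlift: "a \<otimes> s = tlift (\<lambda>p q. a \<otimes> p \<otimes> q) s"
proof -
  have "a \<otimes> s = a \<otimes> tlift (\<otimes>) s" by (simp only: tlift_id)
  then show ?thesis by (simp add: tlift_pull[of "\<lambda>z. _ \<otimes> z"] lin)
qed

lemma tassoc_tmap:
  assumes "clinear D"
  shows "tassoc (tmap D id t) = tlift (\<lambda>x y. tlift (\<lambda>p q. p \<otimes> q \<otimes> y) (D x)) t"
  by (rule clinear_tensor_eqI[where f = "\<lambda>t. tassoc (tmap D id t)"])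
    (simp_all add: assms clinear_compose[OF assms] lin tlift_tensor tassoc_tprod_left id_def
      clinear_compose[OF clinear_tassoc(1)] clinear_tmap clinear_compose[OF clinear_tmap])

lemma tmap_id_Delta:
  assumes "clinear D"
  shows "tmap id D t = tlift (\<lambda>x y. tlift (\<lambda>p q. x \<otimes> p \<otimes> q) (D y)) t"
  by (rule clinear_tensor_eqI[where f = "\<lambda>t. tmap id D t"])
    (simp_all add: assms clinear_compose[OF assms] lin tlift_tensor tprod_eq_tlift[symmetric] id_def
      clinear_tmap clinear_compose[OF clinear_tmap])

lemma tmap_times:
  assumes "clinear f" "clinear g" "\<And>a b. f (a * b) = f a * f b" "\<And>a b. g (a * b) = g a * g b"
  shows "tmap f g (s * t) = tmap f g s * tmap f g t"
proof (rule clinear_tensor_eqI[where f = "\<lambda>s. tmap f g (s * t)"])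
  note l = lin clinear_compose[OF clinear_tmap] assms
  show "tmap f g ((a \<otimes> b) * t) = tmap f g (a \<otimes> b) * tmap f g t" for a b
    by (rule clinear_tensor_eqI[where f = "\<lambda>t. tmap f g ((a \<otimes> b) * t)"])
      (simp_all add: l clinear_tmap)
qed (simp_all add: lin clinear_compose[OF clinear_tmap] clinear_tmap assms)

lemma tmap_tlift:
  assumes "clinear h" "clinear k" "\<And>x. clinear (f x)" "\<And>y. clinear (\<lambda>x. f x y)"
  shows "tmap h k (tlift f t) = tlift (\<lambda>x y. tmap h k (f x y)) t"
  by (rule tlift_pull; simp add: assms clinear_tmap)

text \<open>The setting for translating the multiplier conditions into identities in tensor powers
  of A. \<Delta>(u) may differ from \<open>u \<otimes> u\<close>.\<close>

locale unital_comultiplication =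
  fixes u :: "'a::complex_algebra" and \<Delta> :: "'a \<Rightarrow> ('a, 'a) tensor"
  assumes is_one: "is_one u"
    and clinear_Delta: "clinear \<Delta>"
    and Delta_times: "\<Delta> (a * b) = \<Delta> a * \<Delta> b"
begin

lemma unit [simp]: "u * a = a" "a * u = a"
  using is_one by (simp_all add: is_one_def)

lemma is_one2: "is_one (u \<otimes> u)" and is_one3: "is_one (u \<otimes> u \<otimes> u)"
  by (intro is_one_tprod is_one)+

lemma unit2 [simp]: "(u \<otimes> u) * t = t" "t * (u \<otimes> u) = t"
  using is_one2 by (simp_all add: is_one_def)

lemma emb_unit: "(1 :: 'a multiplier) = emb u" "(1 :: ('a, 'a) tensor multiplier) = emb (u \<otimes> u)"
  "(1 :: ('a, ('a, 'a) tensor) tensor multiplier) = emb (u \<otimes> u \<otimes> u)"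
  by (simp_all add: emb_is_one is_one is_one2 is_one3)

lemmas glin = lin clinear_Delta clinear_compose[OF clinear_Delta]

lemma T1_emb: "T1 (\<lambda>a. emb (\<Delta> a)) t = tlift (\<lambda>a b. tlift (\<lambda>x y. x \<otimes> (y * b)) (\<Delta> a)) t"
proof -
  have "s * (u \<otimes> b) = tlift (\<lambda>x y. x \<otimes> (y * b)) s" for s :: "('a, 'a) tensor" and b
    by (rule clinear_tensor_eqI[where f = "\<lambda>s. s * (u \<otimes> b)"]) (simp_all add: lin tlift_tensor)
  then show ?thesis
    unfolding T1_def by (simp add: emb_unit(1) mtensor_emb emb_mult[symmetric] unemb_emb[OF is_one2])
qed

lemma T2_emb: "T2 (\<lambda>a. emb (\<Delta> a)) t = tlift (\<lambda>a b. tlift (\<lambda>x y. (a * x) \<otimes> y) (\<Delta> b)) t"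
proof -
  have "(a \<otimes> u) * s = tlift (\<lambda>x y. (a * x) \<otimes> y) s" for s :: "('a, 'a) tensor" and a
    by (rule clinear_tensor_eqI[where f = "\<lambda>s. (a \<otimes> u) * s"]) (simp_all add: lin tlift_tensor)
  then show ?thesis
    unfolding T2_def by (simp add: emb_unit(1) mtensor_emb emb_mult[symmetric] unemb_emb[OF is_one2])
qed

lemma Delta_id_emb: "Delta_id (\<lambda>a. emb (\<Delta> a)) t = emb (tassoc (tmap \<Delta> id t))"
  unfolding Delta_id_def
  by (rule clinear_tensor_eqI[where g = "\<lambda>t. emb (tassoc (tmap \<Delta> id t))"])
    (simp_all add: mtensor_emb massoc_emb glin clinear_emb id_def tlift_tensor
      clinear_compose[OF clinear_tassoc(1)] clinear_compose[OF clinear_tmap] clinear_tmap)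

lemma id_Delta_emb: "id_Delta (\<lambda>a. emb (\<Delta> a)) t = emb (tmap id \<Delta> t)"
  unfolding id_Delta_def
  by (rule clinear_tensor_eqI[where g = "\<lambda>t. emb (tmap id \<Delta> t)"])
    (simp_all add: mtensor_emb glin clinear_emb id_def tlift_tensor
      clinear_compose[OF clinear_tmap] clinear_tmap)

text \<open>Every multiplier of A \<otimes> A is of the form \<open>emb t\<close>, so the prescribed
  values on A \<otimes> A already determine the extension, and the definite description is met by
  exactly one map.\<close>

lemma unital_ext_eq:
  fixes h :: "('a, 'a) tensor \<Rightarrow> 'b::complex_algebra multiplier"
  assumes "clinear h" "\<And>s t. h (s * t) = h s * h t" "h (u \<otimes> u) = m"
  shows "(THE \<Phi>. alg_hom \<Phi> \<and> (\<forall>t. \<Phi> (emb t) = h t) \<and> \<Phi> 1 = m) = (\<lambda>n. h (unemb n))"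
proof (rule the_equality)
  have u: "clinear (unemb :: ('a, 'a) tensor multiplier \<Rightarrow> _)"
    by (intro clinearI; rule emb_inject[OF is_one2, THEN iffD1])
      (simp_all add: emb_unemb[OF is_one2] clinear_add[OF clinear_emb[OF clinear_intros(1)]]
        clinear_scale[OF clinear_emb[OF clinear_intros(1)]])
  have t: "unemb (m * n) = unemb m * unemb n" for m n :: "('a, 'a) tensor multiplier"
    by (rule emb_inject[OF is_one2, THEN iffD1]) (simp add: emb_unemb[OF is_one2] emb_mult)
  show "alg_hom (\<lambda>n. h (unemb n)) \<and> (\<forall>t. h (unemb (emb t)) = h t) \<and> h (unemb 1) = m"
    using assms by (simp add: alg_hom_def clinear_compose[OF assms(1) u] t unemb_emb[OF is_one2] emb_unit(2))
next
  fix \<Phi> :: "('a, 'a) tensor multiplier \<Rightarrow> 'b multiplier"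
  assume "alg_hom \<Phi> \<and> (\<forall>t. \<Phi> (emb t) = h t) \<and> \<Phi> 1 = m"
  then show "\<Phi> = (\<lambda>n. h (unemb n))"
    by (metis emb_unemb[OF is_one2] ext)
qed

lemma Delta_id_ext_emb:
  "Delta_id_ext (\<lambda>a. emb (\<Delta> a)) (emb (\<Delta> u)) (emb t) = emb (tassoc (tmap \<Delta> id t))"
proof -
  have "Delta_id_ext (\<lambda>a. emb (\<Delta> a)) (emb (\<Delta> u)) = (\<lambda>n. emb (tassoc (tmap \<Delta> id (unemb n))))"
    unfolding Delta_id_ext_def Delta_id_emb
    by (rule unital_ext_eq)
      (simp_all add: clinear_emb clinear_tassoc_intros clinear_tmap clinear_compose[OF clinear_tmap]
        clinear_Delta id_def lin tmap_times Delta_times emb_mult massoc_emb emb_unit(1) mtensor_emb)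
  then show ?thesis by (simp add: unemb_emb[OF is_one2])
qed

lemma id_Delta_ext_emb:
  "id_Delta_ext (\<lambda>a. emb (\<Delta> a)) (emb (\<Delta> u)) (emb t) = emb (tmap id \<Delta> t)"
proof -
  have "id_Delta_ext (\<lambda>a. emb (\<Delta> a)) (emb (\<Delta> u)) = (\<lambda>n. emb (tmap id \<Delta> (unemb n)))"
    unfolding id_Delta_ext_def id_Delta_emb
    by (rule unital_ext_eq)
      (simp_all add: clinear_emb clinear_tmap clinear_compose[OF clinear_tmap]
        clinear_Delta id_def lin tmap_times Delta_times emb_mult emb_unit(1) mtensor_emb)
  then show ?thesis by (simp add: unemb_emb[OF is_one2])
qed

lemma tassoc_unit_times:
  "tassoc (\<Delta> u \<otimes> u) * (u \<otimes> \<Delta> u) = tlift (\<lambda>p q. tlift (\<lambda>x y. p \<otimes> (q * x) \<otimes> y) (\<Delta> u)) (\<Delta> u)"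
  "(u \<otimes> \<Delta> u) * tassoc (\<Delta> u \<otimes> u) = tlift (\<lambda>p q. tlift (\<lambda>x y. p \<otimes> (x * q) \<otimes> y) (\<Delta> u)) (\<Delta> u)"
proof -
  have 1: "u \<otimes> \<Delta> u = tlift (\<lambda>p q. u \<otimes> p \<otimes> q) (\<Delta> u)"
    by (rule tprod_eq_tlift)
  show "tassoc (\<Delta> u \<otimes> u) * (u \<otimes> \<Delta> u) = tlift (\<lambda>p q. tlift (\<lambda>x y. p \<otimes> (q * x) \<otimes> y) (\<Delta> u)) (\<Delta> u)"
    unfolding 1 tassoc_tprod_left
    by (simp add: tlift_pull[of "\<lambda>z. z * _"] tlift_pull[of "\<lambda>z. _ * z"] lin, rule tlift_swap; simp add: lin)
  show "(u \<otimes> \<Delta> u) * tassoc (\<Delta> u \<otimes> u) = tlift (\<lambda>p q. tlift (\<lambda>x y. p \<otimes> (x * q) \<otimes> y) (\<Delta> u)) (\<Delta> u)"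
    unfolding 1 tassoc_tprod_left
    by (simp add: tlift_pull[of "\<lambda>z. z * _"] tlift_pull[of "\<lambda>z. _ * z"] lin)
qed

lemma weak_coproduct_iff:
  assumes "clinear \<epsilon>"
  shows "weak_coproduct (*) u \<Delta> \<epsilon> \<longleftrightarrow>
    (\<forall>a. tassoc (tmap \<Delta> id (\<Delta> a)) = tmap id \<Delta> (\<Delta> a))
    \<and> (\<forall>a. slice_left \<epsilon> (\<Delta> a) = a \<and> slice_right \<epsilon> (\<Delta> a) = a)
    \<and> tassoc (tmap \<Delta> id (\<Delta> u)) = tassoc (\<Delta> u \<otimes> u) * (u \<otimes> \<Delta> u)
    \<and> tassoc (tmap \<Delta> id (\<Delta> u)) = (u \<otimes> \<Delta> u) * tassoc (\<Delta> u \<otimes> u)"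
proof -
  have 1: "\<Delta> (a * b) = tlift (\<lambda>x y. tlift (\<lambda>p q. (x * p) \<otimes> (y * q)) (\<Delta> b)) (\<Delta> a)" for a b
    by (simp add: Delta_times times_tensor_def)
  show ?thesis
    unfolding weak_coproduct_def
    by (auto simp: assms clinear_Delta lin 1 mult.assoc slice_left_def slice_right_def
        tassoc_tmap[OF clinear_Delta] tmap_id_Delta[OF clinear_Delta] tassoc_unit_times)
qed

lemma lmul_emb_Delta: "lmul (emb (\<Delta> u)) (a \<otimes> b) = tlift (\<lambda>x y. (x * a) \<otimes> (y * b)) (\<Delta> u)"
  and rmul_emb_Delta: "rmul (emb (\<Delta> u)) (a \<otimes> b) = tlift (\<lambda>x y. (a * x) \<otimes> (b * y)) (\<Delta> u)"
proof -
  have "s * (a \<otimes> b) = tlift (\<lambda>x y. (x * a) \<otimes> (y * b)) s" for s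
    by (rule clinear_tensor_eqI[where f = "\<lambda>s. s * (a \<otimes> b)"]) (simp_all add: lin tlift_tensor)
  then show "lmul (emb (\<Delta> u)) (a \<otimes> b) = tlift (\<lambda>x y. (x * a) \<otimes> (y * b)) (\<Delta> u)" by simp
  have "(a \<otimes> b) * s = tlift (\<lambda>x y. (a * x) \<otimes> (b * y)) s" for s
    by (rule clinear_tensor_eqI[where f = "\<lambda>s. (a \<otimes> b) * s"]) (simp_all add: lin tlift_tensor)
  then show "rmul (emb (\<Delta> u)) (a \<otimes> b) = tlift (\<lambda>x y. (a * x) \<otimes> (b * y)) (\<Delta> u)" by simp
qed

lemma weak_Hopf_structure_iff:
  "weak_Hopf_structure \<Delta> u \<epsilon> S \<longleftrightarrow> weak_Hopf (*) u \<Delta> \<epsilon> S"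
proof (cases "weak_coproduct (*) u \<Delta> \<epsilon> \<and> clinear S")
  case True
  then interpret weak_coproduct "(*)" u \<Delta> \<epsilon> by blast
  note S = glin clinear_counit clinear_compose[OF clinear_counit] conjunct2[OF True] clinear_compose[OF conjunct2[OF True]]
  have target: "slice_left \<epsilon> (\<Delta> u * (a \<otimes> u)) = target a" for a
    unfolding lmul_emb[symmetric] lmul_emb_Delta
    by (simp add: target_def slice_left_def tlift_tlift tlift_tensor S)
  have source: "slice_right \<epsilon> ((u \<otimes> a) * \<Delta> u) = source a" for a
    unfolding rmul_emb[symmetric] rmul_emb_Delta
    by (simp add: source_def slice_right_def tlift_tlift tlift_tensor S)
  have "tlift (\<lambda>a\<^sub>1. tlift (\<lambda>a\<^sub>2 a\<^sub>3. S a\<^sub>1 * a\<^sub>2 * S a\<^sub>3)) (tmap id \<Delta> (\<Delta> a))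
      = sw a (\<lambda>x y. sw y (\<lambda>p q. S x * p * S q))" for a
    by (simp add: tmap_id_Delta[OF clinear_Delta] tlift_tlift tlift_tensor S)
  with target source show ?thesis
    using True is_one clinear_Delta Delta_times weak_coproduct_iff[OF clinear_counit]
    by (auto simp: weak_Hopf_structure_def weak_Hopf_def weak_Hopf_axioms_def clinear_counit)
next
  case False
  then show ?thesis
    unfolding weak_Hopf_structure_def weak_Hopf_def weak_Hopf_axioms_def
    using weak_coproduct_iff by blast
qed

text \<open>Coassociativity is the case a = c = 1 of the multiplier condition, and multiplying the
  outer legs by \<open>a\<close> and \<open>c\<close> gives it back.\<close>

lemma coproduct_iff:
  "coproduct (\<lambda>a. emb (\<Delta> a)) \<longleftrightarrow> (\<forall>a. tassoc (tmap \<Delta> id (\<Delta> a)) = tmap id \<Delta> (\<Delta> a))"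
proof -
  have hom: "alg_hom (\<lambda>a. emb (\<Delta> a))"
    by (simp add: alg_hom_def clinear_emb clinear_Delta Delta_times emb_mult)
  have T1: "T1 (\<lambda>a. emb (\<Delta> a)) (b \<otimes> c) = tlift (\<lambda>x y. x \<otimes> (y * c)) (\<Delta> b)" for b c
    by (simp add: T1_emb tlift_tensor glin)
  have T2: "T2 (\<lambda>a. emb (\<Delta> a)) (a \<otimes> b) = tlift (\<lambda>x y. (a * x) \<otimes> y) (\<Delta> b)" for a b
    by (simp add: T2_emb tlift_tensor glin)
  have L: "(a \<otimes> u \<otimes> u) * tassoc (tmap \<Delta> id (tlift (\<lambda>x y. x \<otimes> (y * c)) (\<Delta> b)))
      = tlift (\<lambda>x y. tlift (\<lambda>p q. (a * p) \<otimes> q \<otimes> (y * c)) (\<Delta> x)) (\<Delta> b)" for a b c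
    by (simp add: tassoc_tmap[OF clinear_Delta] tlift_tlift tlift_tensor glin tlift_pull[of "\<lambda>z. _ * z"])
  have R: "tmap id \<Delta> (tlift (\<lambda>x y. (a * x) \<otimes> y) (\<Delta> b)) * (u \<otimes> u \<otimes> c)
      = tlift (\<lambda>x y. tlift (\<lambda>p q. (a * x) \<otimes> p \<otimes> (q * c)) (\<Delta> y)) (\<Delta> b)" for a b c
    by (simp add: tmap_id_Delta[OF clinear_Delta] tlift_tlift tlift_tensor glin tlift_pull[of "\<lambda>z. z * _"])
  have "coproduct (\<lambda>a. emb (\<Delta> a)) \<longleftrightarrow> (\<forall>a b c.
      tlift (\<lambda>x y. tlift (\<lambda>p q. (a * p) \<otimes> q \<otimes> (y * c)) (\<Delta> x)) (\<Delta> b)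
      = tlift (\<lambda>x y. tlift (\<lambda>p q. (a * x) \<otimes> p \<otimes> (q * c)) (\<Delta> y)) (\<Delta> b))"
    unfolding coproduct_def Delta_id_emb id_Delta_emb T1 T2 emb_unit mtensor_emb emb_mult[symmetric]
      emb_inject[OF is_one3] L R
    by (simp add: hom)
  also have "\<dots> \<longleftrightarrow> (\<forall>a. tassoc (tmap \<Delta> id (\<Delta> a)) = tmap id \<Delta> (\<Delta> a))"
  proof (intro iffI allI)
    fix a b c
    assume "\<forall>a. tassoc (tmap \<Delta> id (\<Delta> a)) = tmap id \<Delta> (\<Delta> a)"
    then have "tassoc (tmap \<Delta> id (\<Delta> b)) = tmap id \<Delta> (\<Delta> b)" ..
    from arg_cong[OF this, of "tlift (\<lambda>p. tlift (\<lambda>q y. (a * p) \<otimes> q \<otimes> (y * c)))"]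
    show "tlift (\<lambda>x y. tlift (\<lambda>p q. (a * p) \<otimes> q \<otimes> (y * c)) (\<Delta> x)) (\<Delta> b)
      = tlift (\<lambda>x y. tlift (\<lambda>p q. (a * x) \<otimes> p \<otimes> (q * c)) (\<Delta> y)) (\<Delta> b)"
      by (simp add: tassoc_tmap[OF clinear_Delta] tmap_id_Delta[OF clinear_Delta] tlift_tlift tlift_tensor glin)
  next
    fix b
    assume *: "\<forall>a b c. tlift (\<lambda>x y. tlift (\<lambda>p q. (a * p) \<otimes> q \<otimes> (y * c)) (\<Delta> x)) (\<Delta> b)
      = tlift (\<lambda>x y. tlift (\<lambda>p q. (a * x) \<otimes> p \<otimes> (q * c)) (\<Delta> y)) (\<Delta> b)"
    show "tassoc (tmap \<Delta> id (\<Delta> b)) = tmap id \<Delta> (\<Delta> b)"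
      using *[rule_format, of u u b]
      by (simp add: tassoc_tmap[OF clinear_Delta] tmap_id_Delta[OF clinear_Delta])
  qed
  finally show ?thesis .
qed

text \<open>The case a = b = c = d = 1 is \<open>unit_f\<close>, and it implies all others by
  multiplying the legs from outside.\<close>

lemma F1_condition_iff:
  assumes F: "clinear F" "\<And>a b. F (a \<otimes> b) = tlift (\<lambda>p q. (a * p) \<otimes> (q * b)) f"
  shows "F1_condition (emb (\<Delta> u)) F \<longleftrightarrow>
    tlift (\<lambda>x y. tlift (\<lambda>p q. (x * p) \<otimes> q \<otimes> y) f) (\<Delta> u)
    = tlift (\<lambda>x y. tlift (\<lambda>p q. x \<otimes> p \<otimes> (y * q)) (\<Delta> u)) (\<Delta> u)"
proof -
  note F' = glin F(1) clinear_compose[OF F(1)] id_def clinear_tassoc_intros clinear_tmap clinear_compose[OF clinear_tmap]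
  have L: "tassoc (tlift (\<lambda>p q. F (p \<otimes> b) \<otimes> (q * d)) (rmul (emb (\<Delta> u)) (a \<otimes> c)))
      = tlift (\<lambda>x y. tlift (\<lambda>p q. (a * x * p) \<otimes> (q * b) \<otimes> (c * y * d)) f) (\<Delta> u)" for a b c d
    unfolding rmul_emb_Delta
    by (simp add: tlift_tlift tlift_tensor F' F(2) tlift_pull[of tassoc] tassoc_tprod_left)
  have R: "tlift (\<lambda>p q. p \<otimes> tmap id (\<lambda>y. q * y) (lmul (emb (\<Delta> u)) (b \<otimes> d))) (rmul (emb (\<Delta> u)) (a \<otimes> c))
      = tlift (\<lambda>x y. tlift (\<lambda>p q. (a * x) \<otimes> (p * b) \<otimes> (c * y * (q * d))) (\<Delta> u)) (\<Delta> u)" for a b c d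
  proof -
    have 1: "p \<otimes> tmap id (\<lambda>y. q * y) (lmul (emb (\<Delta> u)) (b \<otimes> d))
        = tlift (\<lambda>r s. p \<otimes> (r * b) \<otimes> (q * (s * d))) (\<Delta> u)" for p q
      by (simp add: lmul_emb_Delta F' tmap_tlift tlift_pull[of "\<lambda>z. _ \<otimes> z"] del: lmul_emb)
    show ?thesis
      unfolding 1 rmul_emb_Delta by (simp add: tlift_tlift tlift_tensor F')
  qed
  show ?thesis
    unfolding F1_condition_def L R
  proof (intro iffI allI)
    assume "\<forall>a b c d. tlift (\<lambda>x y. tlift (\<lambda>p q. (a * x * p) \<otimes> (q * b) \<otimes> (c * y * d)) f) (\<Delta> u)
      = tlift (\<lambda>x y. tlift (\<lambda>p q. (a * x) \<otimes> (p * b) \<otimes> (c * y * (q * d))) (\<Delta> u)) (\<Delta> u)"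
    from this[rule_format, of u u u u]
    show "tlift (\<lambda>x y. tlift (\<lambda>p q. (x * p) \<otimes> q \<otimes> y) f) (\<Delta> u)
      = tlift (\<lambda>x y. tlift (\<lambda>p q. x \<otimes> p \<otimes> (y * q)) (\<Delta> u)) (\<Delta> u)" by simp
  next
    fix a b c d
    assume *: "tlift (\<lambda>x y. tlift (\<lambda>p q. (x * p) \<otimes> q \<otimes> y) f) (\<Delta> u)
      = tlift (\<lambda>x y. tlift (\<lambda>p q. x \<otimes> p \<otimes> (y * q)) (\<Delta> u)) (\<Delta> u)"
    show "tlift (\<lambda>x y. tlift (\<lambda>p q. (a * x * p) \<otimes> (q * b) \<otimes> (c * y * d)) f) (\<Delta> u)
      = tlift (\<lambda>x y. tlift (\<lambda>p q. (a * x) \<otimes> (p * b) \<otimes> (c * y * (q * d))) (\<Delta> u)) (\<Delta> u)"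
      using arg_cong[OF *, of "tlift (\<lambda>x. tlift (\<lambda>p y. (a * x) \<otimes> (p * b) \<otimes> (c * y * d)))"]
      by (simp add: tlift_tlift tlift_tensor glin mult.assoc)
  qed
qed

text \<open>The assumption on \<open>f\<close> is \<open>unit_f\<close> of the opposite structure
  with the flips carried out.\<close>

lemma F2_condition:
  assumes F: "clinear F" "\<And>a b. F (a \<otimes> b) = tlift (\<lambda>p q. (a * q) \<otimes> (p * b)) f"
    and f: "tlift (\<lambda>x y. tlift (\<lambda>p q. (p * y) \<otimes> q \<otimes> x) f) (\<Delta> u)
      = tlift (\<lambda>x y. tlift (\<lambda>p q. y \<otimes> q \<otimes> (p * x)) (\<Delta> u)) (\<Delta> u)"
  shows "F2_condition (emb (\<Delta> u)) F"
  unfolding F2_condition_def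
proof (intro allI)
  fix a b c d
  note F' = glin F(1) clinear_compose[OF F(1)] id_def clinear_tassoc_intros clinear_tmap clinear_compose[OF clinear_tmap]
  have "tlift (\<lambda>p q. (d * p) \<otimes> F (b \<otimes> q)) (lmul (emb (\<Delta> u)) (a \<otimes> c))
      = tlift (\<lambda>x y. tlift (\<lambda>p q. (d * (x * a)) \<otimes> (b * q) \<otimes> (p * (y * c))) f) (\<Delta> u)"
    unfolding lmul_emb_Delta by (simp add: tlift_tlift tlift_tensor F' F(2) tlift_pull[of "\<lambda>z. _ \<otimes> z"])
  also have "\<dots> = tlift (\<lambda>x y. tlift (\<lambda>p q. (d * p * (x * a)) \<otimes> (b * q) \<otimes> (y * c)) (\<Delta> u)) (\<Delta> u)"
    using arg_cong[OF f, of "tlift (\<lambda>x. tlift (\<lambda>p y. (d * y * a) \<otimes> (b * p) \<otimes> (x * c)))"]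
    by (simp add: tlift_tlift tlift_tensor glin mult.assoc)
  also have "\<dots> = tassoc (tlift (\<lambda>p q. tmap (\<lambda>x. x * p) id (rmul (emb (\<Delta> u)) (d \<otimes> b)) \<otimes> q) (lmul (emb (\<Delta> u)) (a \<otimes> c)))"
  proof -
    have 1: "tmap (\<lambda>x. x * p) id (rmul (emb (\<Delta> u)) (d \<otimes> b)) = tlift (\<lambda>r s. (d * r * p) \<otimes> (b * s)) (\<Delta> u)" for p
      by (simp add: rmul_emb_Delta F' tmap_tlift del: rmul_emb)
    show ?thesis
      unfolding 1 lmul_emb_Delta
      by (simp add: tlift_tlift tlift_tensor F' tlift_pull[of tassoc] tassoc_tprod_left)
  qed
  finally show "tlift (\<lambda>p q. (d * p) \<otimes> F (b \<otimes> q)) (lmul (emb (\<Delta> u)) (a \<otimes> c))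
    = tassoc (tlift (\<lambda>p q. tmap (\<lambda>x. x * p) id (rmul (emb (\<Delta> u)) (d \<otimes> b)) \<otimes> q) (lmul (emb (\<Delta> u)) (a \<otimes> c)))" .
qed

end

section \<open>Comparison of the two notions\<close>

lemma flip_diff: "flip (s - t) = flip s - flip t"
  by (rule clinear_diff[of flip]) (rule clinear_flip[OF clinear_intros(1)])

lemma flip_eq_0_iff: "flip t = 0 \<longleftrightarrow> t = 0"
proof
  assume "flip t = 0"
  then have "flip (flip t) = flip (0 - 0)" by simp
  then show "t = 0" unfolding flip_diff by simp
next
  assume "t = 0"
  then show "flip t = 0" using flip_diff[of 0 0] by simp
qed

lemma range_flip_conj:
  fixes K L :: "('a::complex_vector, 'b::complex_vector) tensor \<Rightarrow> ('c::complex_vector, 'd::complex_vector) tensor"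
  assumes "range K = range L"
  shows "range (\<lambda>t. flip (K (flip t))) = range (\<lambda>t. flip (L (flip t)))"
proof -
  have 1: "range (\<lambda>t. flip (M (flip t))) = flip ` range M"
    for M :: "('a, 'b) tensor \<Rightarrow> ('c, 'd) tensor"
  proof (intro subset_antisym subsetI)
    fix s assume "s \<in> flip ` range M"
    then obtain t where "s = flip (M (flip (flip t)))" by auto
    then show "s \<in> range (\<lambda>t. flip (M (flip t)))" by blast
  qed auto
  show ?thesis unfolding 1[of K] 1[of L] assms ..
qed

lemma kernel_flip_conj:
  assumes "{t. K t = 0} = range (\<lambda>t. t - L t)"
  shows "{t. flip (K (flip t)) = 0} = range (\<lambda>t. t - flip (L (flip t)))"
proof (intro subset_antisym subsetI)
  fix t assume "t \<in> {t. flip (K (flip t)) = 0}"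
  then have "flip t \<in> range (\<lambda>t. t - L t)"
    using assms by (auto simp: flip_eq_0_iff)
  then obtain s where "flip t = s - L s" by blast
  then have "flip (flip t) = flip s - flip (L (flip (flip s)))"
    by (simp add: flip_diff)
  then show "t \<in> range (\<lambda>t. t - flip (L (flip t)))"
    by (intro range_eqI[of _ _ "flip s"]) simp
next
  fix t assume "t \<in> range (\<lambda>t. t - flip (L (flip t)))"
  then obtain s where "flip t = flip s - L (flip s)" by (auto simp: flip_diff)
  then have "flip t \<in> {t. K t = 0}"
    using assms by blast
  then show "t \<in> {t. flip (K (flip t)) = 0}" by (simp add: flip_eq_0_iff)
qed

lemma slice_subspace_tensor:
  fixes \<epsilon> :: "'a::complex_vector \<Rightarrow> complex" and V :: "'b::complex_vector set"
    and W :: "'c::complex_vector set"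
  assumes "clinear \<epsilon>"
  shows "csubspace V \<Longrightarrow> t \<in> subspace_tensor V UNIV \<Longrightarrow> slice_right \<epsilon> t \<in> V"
    and "csubspace W \<Longrightarrow> s \<in> subspace_tensor UNIV W \<Longrightarrow> slice_left \<epsilon> s \<in> W"
proof -
  note l = lin assms clinear_compose[OF assms]
  have r: "clinear (slice_right \<epsilon> :: ('b, 'a) tensor \<Rightarrow> 'b)" "clinear (slice_left \<epsilon> :: ('a, 'c) tensor \<Rightarrow> 'c)"
    unfolding slice_right_def slice_left_def by (intro clinear_tlift cbilinearI; simp add: l)+
  have *: "f t \<in> U"
    if f: "clinear f" and U: "csubspace U" and t: "t \<in> cspan X" and X: "\<And>x. x \<in> X \<Longrightarrow> f x \<in> U"
    for f :: "('d::complex_vector, 'e::complex_vector) tensor \<Rightarrow> 'f::complex_vector" and U X t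
    using t
    by (induction rule: complex_vector.span_induct)
      (use U X in \<open>auto simp: complex_vector.subspace_def clinear_0[OF f] clinear_add[OF f] clinear_scale[OF f]\<close>)
  show "slice_right \<epsilon> t \<in> V" if "csubspace V" "t \<in> subspace_tensor V UNIV"
    using that(2) unfolding subspace_tensor_def
    by (rule *[OF r(1) that(1)])
      (auto simp: slice_right_def tlift_tensor l complex_vector.subspace_scale[OF that(1)])
  show "slice_left \<epsilon> s \<in> W" if "csubspace W" "s \<in> subspace_tensor UNIV W"
    using that(2) unfolding subspace_tensor_def
    by (rule *[OF r(2) that(1)])
      (auto simp: slice_left_def tlift_tensor l complex_vector.subspace_scale[OF that(1)])
qed

context unital_comultiplication
begin

section \<open>From weak Hopf algebras to weak multiplier Hopf algebras\<close>

lemma weak_Hopf_imp_wmha: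
  assumes "weak_Hopf (*) u \<Delta> \<epsilon> S"
  shows "weak_multiplier_Hopf_algebra (\<lambda>a. emb (\<Delta> a))"
proof -
  interpret H: weak_Hopf "(*)" u \<Delta> \<epsilon> S by (rule assms)
  interpret A: weak_coproduct_antipode "(*)" u \<Delta> \<epsilon> H.F S by (rule H.antipode)
  interpret H': weak_Hopf "\<lambda>a b. b * a" u "\<lambda>a. flip (\<Delta> a)" \<epsilon> S
    by (rule H.opposite_weak_Hopf)
  interpret A': weak_coproduct_antipode "\<lambda>a b. b * a" u "\<lambda>a. flip (\<Delta> a)" \<epsilon> H'.F S
    by (rule H'.antipode)
  let ?\<Delta> = "\<lambda>a. emb (\<Delta> a)" and ?E = "emb (\<Delta> u)" and ?F = "H.outer_mult H.F"
    and ?F' = "\<lambda>t. flip (H'.outer_mult H'.F (flip t))"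
  have W: "tassoc (tmap \<Delta> id (\<Delta> a)) = tmap id \<Delta> (\<Delta> a)"
    "slice_left \<epsilon> (\<Delta> a) = a" "slice_right \<epsilon> (\<Delta> a) = a"
    "tassoc (tmap \<Delta> id (\<Delta> u)) = tassoc (\<Delta> u \<otimes> u) * (u \<otimes> \<Delta> u)"
    "tassoc (tmap \<Delta> id (\<Delta> u)) = (u \<otimes> \<Delta> u) * tassoc (\<Delta> u \<otimes> u)" for a
    using H.weak_coproduct_axioms weak_coproduct_iff[OF H.clinear_counit] by auto
  have T1: "T1 ?\<Delta> = H.T"
    by (rule ext) (simp only: T1_emb H.T_def)
  \<comment> \<open>Conjugation by the flip identifies \<open>T2\<close> with the operator
    \<open>T\<close> of the opposite structure, whose range and kernel are known from
    \<open>A'\<close>.\<close>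
  have T2: "T2 ?\<Delta> = (\<lambda>t. flip (H'.T (flip t)))"
    unfolding fun_eq_iff T2_emb
    by (intro allI, rule clinear_tensor_eqI[where f = "tlift (\<lambda>a b. tlift (\<lambda>x y. (a * x) \<otimes> y) (\<Delta> b))"])
      (simp_all add: cbilinearI clinear_tlift tlift_tensor glin clinear_flip H'.alin tlift_flip tlift_pull[of flip])
  have E1: "lmul ?E = H.unit_proj"
    by (rule ext, rule clinear_tensor_eqI[OF clinear_lmul H.clinear_unit_proj])
      (simp add: lmul_emb_Delta del: lmul_emb)
  have E2: "rmul ?E = (\<lambda>t. flip (H'.unit_proj (flip t)))"
    by (rule ext, rule clinear_tensor_eqI[OF clinear_rmul])
      (simp_all add: rmul_emb_Delta glin clinear_flip H'.alin tlift_flip tlift_pull[of flip] del: rmul_emb)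
  have F': "?F' (a \<otimes> b) = tlift (\<lambda>p q. (a * q) \<otimes> (p * b)) H'.F" for a b
    by (simp add: tlift_pull[of flip] clinear_flip glin)
  have lF': "clinear ?F'"
    by (intro clinear_flip clinear_compose[OF H'.clinear_outer_mult] lin)
  have "nondegenerate TYPE('a)"
    unfolding nondegenerate_def by (metis unit)
  moreover have "idempotent_algebra TYPE('a)"
    unfolding idempotent_algebra_def
  proof (intro subset_antisym subset_UNIV subsetI)
    fix a :: 'a
    have "a * u \<in> {a * b | a b :: 'a. True}" by blast
    from complex_vector.span_base[OF this] show "a \<in> cspan {a * b | a b :: 'a. True}" by simp
  qed
  moreover have "coproduct ?\<Delta>"
    unfolding coproduct_iff using W(1) by blast
  \<comment> \<open>Slicing \<Delta>(a) with \<epsilon> on either leg returns \<open>a\<close>, so a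
    subspace that can serve as a leg contains every \<open>a\<close>.\<close>
  moreover have "full ?\<Delta>"
  proof -
    have T: "T1 ?\<Delta> (a \<otimes> u) = \<Delta> a" "T2 ?\<Delta> (u \<otimes> a) = \<Delta> a" for a
      by (simp_all add: T1_emb T2_emb tlift_tensor glin tlift_id)
    note slice = slice_subspace_tensor[OF H.clinear_counit, of _ "\<Delta> _", unfolded W(2,3)]
    have "a \<in> V" if "csubspace V" "\<forall>a b. T1 ?\<Delta> (a \<otimes> b) \<in> subspace_tensor V UNIV" for a V
      using that(2)[rule_format, of a u] unfolding T by (rule slice(1)[OF that(1)])
    moreover have "a \<in> W" if "csubspace W" "\<forall>a b. T2 ?\<Delta> (a \<otimes> b) \<in> subspace_tensor UNIV W" for a W
      using that(2)[rule_format, of u a] unfolding T by (rule slice(2)[OF that(1)])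
    ultimately show ?thesis
      unfolding full_def left_leg_def right_leg_def by blast
  qed
  moreover have "counit ?\<Delta> \<epsilon>"
  proof -
    note l = H.alin
    have "slice_left \<epsilon> (T1 ?\<Delta> (a \<otimes> b)) = a * b" "slice_right \<epsilon> (T2 ?\<Delta> (a \<otimes> b)) = a * b" for a b
      using H.sw_counit1[of "\<lambda>x. x * b" a] H.sw_counit2[of "\<lambda>x. a * x" b]
      by (simp_all add: T1_emb T2_emb slice_left_def slice_right_def tlift_tlift tlift_tensor l)
    then show ?thesis
      by (simp add: counit_def H.clinear_counit)
  qed
  moreover have "?E * ?E = ?E"
    by (simp add: emb_mult[symmetric] Delta_times[symmetric])
  moreover have "range (T1 ?\<Delta>) = range (lmul ?E)"
    unfolding T1 E1 by (rule A.range_T)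
  moreover have "range (T2 ?\<Delta>) = range (rmul ?E)"
    unfolding T2 E2 by (rule range_flip_conj[OF A'.range_T])
  moreover have "id_Delta_ext ?\<Delta> ?E ?E = Delta_id_ext ?\<Delta> ?E ?E"
    "Delta_id_ext ?\<Delta> ?E ?E = (1 \<otimes>\<^sub>M ?E) * massoc (?E \<otimes>\<^sub>M 1)"
    "Delta_id_ext ?\<Delta> ?E ?E = massoc (?E \<otimes>\<^sub>M 1) * (1 \<otimes>\<^sub>M ?E)"
    unfolding id_Delta_ext_emb Delta_id_ext_emb emb_unit(1) mtensor_emb massoc_emb emb_mult[symmetric]
    using W(1)[of u] W(4,5) by simp_all
  moreover have "outer_multiplier ?F" "outer_multiplier ?F'"
    unfolding outer_multiplier_def F'
    by (auto simp: H.clinear_outer_mult lF' tmap_tlift glin mult.assoc)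
  moreover have "F1_condition ?E ?F"
    using A.unit_f by (subst F1_condition_iff[OF H.clinear_outer_mult H.outer_mult_tprod])
  moreover have "F2_condition ?E ?F'"
    using A'.unit_f by (intro F2_condition[OF lF' F']) (simp add: tlift_flip glin)
  moreover have "{t. T1 ?\<Delta> t = 0} = range (\<lambda>t. t - ?F t)"
    unfolding T1 by (rule A.kernel_T)
  moreover have "{t. T2 ?\<Delta> t = 0} = range (\<lambda>t. t - ?F' t)"
    unfolding T2 by (rule kernel_flip_conj[OF A'.kernel_T])
  ultimately have "wmha_structure ?\<Delta> \<epsilon> ?E ?F ?F'"
    unfolding wmha_structure_def by blast
  then show ?thesis
    unfolding weak_multiplier_Hopf_algebra_def by blast
qed

section \<open>From unital weak multiplier Hopf algebras to weak Hopf algebras\<close>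

lemma wmha_idempotent:
  assumes "E * E = E" "range (T1 (\<lambda>a. emb (\<Delta> a))) = range (lmul E)"
    and "range (T2 (\<lambda>a. emb (\<Delta> a))) = range (rmul E)"
  shows "E = emb (\<Delta> u)"
proof -
  define e where "e = lmul E (u \<otimes> u)"
  have E: "E = emb e"
    unfolding e_def by (rule emb_lmul_is_one[OF is_one2, symmetric])
  have e: "e * e = e"
    using assms(1) unfolding E emb_mult[symmetric] emb_inject[OF is_one2] .
  have "\<Delta> u * T1 (\<lambda>a. emb (\<Delta> a)) t = T1 (\<lambda>a. emb (\<Delta> a)) t" for t
  proof (rule clinear_tensor_eqI[where f = "\<lambda>t. \<Delta> u * T1 (\<lambda>a. emb (\<Delta> a)) t"])
    fix a b
    have 1: "T1 (\<lambda>a. emb (\<Delta> a)) (a \<otimes> b) = \<Delta> a * (u \<otimes> b)"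
      using clinear_tensor_eqI[of "\<lambda>s. tlift (\<lambda>x y. x \<otimes> (y * b)) s" "\<lambda>s. s * (u \<otimes> b)" "\<Delta> a"]
      by (simp add: T1_emb tlift_tensor glin)
    show "\<Delta> u * T1 (\<lambda>a. emb (\<Delta> a)) (a \<otimes> b) = T1 (\<lambda>a. emb (\<Delta> a)) (a \<otimes> b)"
      unfolding 1 by (simp add: mult.assoc[symmetric] Delta_times[symmetric])
  qed (simp_all add: T1_emb glin)
  \<comment> \<open>Values of \<open>T1\<close> are fixed by \<Delta>(u) on the left; as
    \<open>e\<close> is such a value, \<Delta>(u)e = e.\<close>
  moreover have "e \<in> range (T1 (\<lambda>a. emb (\<Delta> a)))"
    unfolding assms(2) e_def by (rule rangeI)
  ultimately have 1: "\<Delta> u * e = e" by (metis rangeE)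
  \<comment> \<open>On the other side \<Delta>(u) is a value of \<open>T2\<close>, hence a left
    multiple of the idempotent \<open>e\<close>, so \<Delta>(u)e = \<Delta>(u).\<close>
  have "\<Delta> u \<in> range (T2 (\<lambda>a. emb (\<Delta> a)))"
    using rangeI[of "T2 (\<lambda>a. emb (\<Delta> a))" "u \<otimes> u"] by (simp add: T2_emb tlift_tensor glin tlift_id)
  then obtain t where t: "\<Delta> u = t * e"
    unfolding assms(3) E by auto
  have "\<Delta> u * e = \<Delta> u"
    unfolding t mult.assoc e ..
  then have "e = \<Delta> u" using 1 by (simp only:)
  then show ?thesis by (simp only: E)
qed

lemma wmha_imp_weak_Hopf:
  assumes "wmha_structure (\<lambda>a. emb (\<Delta> a)) \<epsilon> E F\<^sub>1 F\<^sub>2"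
  shows "weak_Hopf_algebra \<Delta>"
proof -
  let ?\<Delta> = "\<lambda>a. emb (\<Delta> a)"
  note w = assms[unfolded wmha_structure_def]
  have E: "E = emb (\<Delta> u)"
    using w by (intro wmha_idempotent) blast+
  have \<epsilon>: "clinear \<epsilon>" and c1: "\<And>a b. slice_left \<epsilon> (T1 ?\<Delta> (a \<otimes> b)) = a * b"
    and c2: "\<And>a b. slice_right \<epsilon> (T2 ?\<Delta> (a \<otimes> b)) = a * b"
    using w by (auto simp: counit_def)
  have "weak_coproduct (*) u \<Delta> \<epsilon>"
    unfolding weak_coproduct_iff[OF \<epsilon>]
  proof (intro conjI allI)
    show "tassoc (tmap \<Delta> id (\<Delta> a)) = tmap id \<Delta> (\<Delta> a)" for a
      using w coproduct_iff by blast
    show "slice_left \<epsilon> (\<Delta> a) = a" "slice_right \<epsilon> (\<Delta> a) = a" for a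
      using c1[of a u] c2[of u a] by (simp_all add: T1_emb T2_emb tlift_tensor glin tlift_id)
    have "Delta_id_ext ?\<Delta> E E = massoc (E \<otimes>\<^sub>M 1) * (1 \<otimes>\<^sub>M E)"
      "Delta_id_ext ?\<Delta> E E = (1 \<otimes>\<^sub>M E) * massoc (E \<otimes>\<^sub>M 1)"
      using w by blast+
    then show "tassoc (tmap \<Delta> id (\<Delta> u)) = tassoc (\<Delta> u \<otimes> u) * (u \<otimes> \<Delta> u)"
      "tassoc (tmap \<Delta> id (\<Delta> u)) = (u \<otimes> \<Delta> u) * tassoc (\<Delta> u \<otimes> u)"
      unfolding E Delta_id_ext_emb emb_unit(1) mtensor_emb massoc_emb emb_mult[symmetric]
        emb_inject[OF is_one3] .
  qed
  then interpret weak_coproduct "(*)" u \<Delta> \<epsilon> .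
  \<comment> \<open>The module property of \<open>F\<^sub>1\<close> and the unit show that
    \<open>F\<^sub>1\<close> is determined by this single tensor.\<close>
  define f where "f = F\<^sub>1 (u \<otimes> u)"
  have F: "clinear F\<^sub>1" "F\<^sub>1 (a \<otimes> b) = tlift (\<lambda>p q. (a * p) \<otimes> (q * b)) f" for a b
  proof -
    have o: "outer_multiplier F\<^sub>1" using w by blast
    then show "clinear F\<^sub>1" by (simp add: outer_multiplier_def)
    have "F\<^sub>1 ((a * u) \<otimes> (u * b)) = tmap (\<lambda>x. a * x) (\<lambda>y. y * b) f"
      using o unfolding outer_multiplier_def f_def by blast
    then show "F\<^sub>1 (a \<otimes> b) = tlift (\<lambda>p q. (a * p) \<otimes> (q * b)) f"
      by (simp add: tmap_def)
  qed
  have F': "F\<^sub>1 = outer_mult f"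
    by (rule ext, rule clinear_tensor_eqI[OF F(1) clinear_outer_mult]) (simp add: F(2))
  have T1: "T1 ?\<Delta> = T"
    by (rule ext) (simp only: T1_emb T_def)
  have E1: "lmul E = unit_proj"
    unfolding E
    by (rule ext, rule clinear_tensor_eqI[OF clinear_lmul clinear_unit_proj]) (simp add: lmul_emb_Delta del: lmul_emb)
  interpret weak_coproduct_inverse "(*)" u \<Delta> \<epsilon> f
  proof unfold_locales
    have "F1_condition E F\<^sub>1" using w by blast
    then show "sw u (\<lambda>x y. tlift (\<lambda>p q. (x * p) \<otimes> q \<otimes> y) f) = sw u (\<lambda>x y. sw u (\<lambda>p q. x \<otimes> p \<otimes> (y * q)))"
      unfolding E F1_condition_iff[OF F] .
    have "range (T1 ?\<Delta>) = range (lmul E)" "{t. T1 ?\<Delta> t = 0} = range (\<lambda>t. t - F\<^sub>1 t)"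
      using w by blast+
    then show "range T = range unit_proj" "{t. T t = 0} = range (\<lambda>t. t - outer_mult f t)"
      unfolding T1 E1 F' .
  qed
  interpret A: weak_coproduct_antipode "(*)" u \<Delta> \<epsilon> f S
    by (rule antipode)
  have "weak_Hopf (*) u \<Delta> \<epsilon> S"
    by (rule weak_Hopf.intro[OF weak_coproduct_axioms], rule weak_Hopf_axioms.intro,
        rule A.clinear_antipode, rule A.counit_mult3, rule A.counit_mult3_swap, rule A.S_target,
        rule A.S_source, rule A.S_id_S)
  then have "weak_Hopf_structure \<Delta> u \<epsilon> S"
    by (rule weak_Hopf_structure_iff[THEN iffD2])
  then show ?thesis
    unfolding weak_Hopf_algebra_def by blast
qed

end

theorem proposition4p12:
  fixes \<Delta> :: "'a::complex_algebra \<Rightarrow> ('a, 'a) tensor"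
    and \<Delta>' :: "'b::complex_algebra \<Rightarrow> ('b, 'b) tensor multiplier"
  shows "(weak_Hopf_algebra \<Delta> \<longrightarrow> weak_multiplier_Hopf_algebra (\<lambda>a. emb (\<Delta> a)))
    \<and> (regular_weak_multiplier_Hopf_algebra \<Delta>' \<and> (\<exists>u::'b. is_one u)
        \<longrightarrow> (\<exists>\<Delta>\<^sub>0. (\<forall>a. \<Delta>' a = emb (\<Delta>\<^sub>0 a)) \<and> weak_Hopf_algebra \<Delta>\<^sub>0))"
proof (intro conjI impI)
  assume "weak_Hopf_algebra \<Delta>"
  then obtain u \<epsilon> S where H: "weak_Hopf_structure \<Delta> u \<epsilon> S"
    unfolding weak_Hopf_algebra_def by blast
  interpret unital_comultiplication u \<Delta>
    by (rule unital_comultiplication.intro) (use H in \<open>auto simp: weak_Hopf_structure_def\<close>)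
  show "weak_multiplier_Hopf_algebra (\<lambda>a. emb (\<Delta> a))"
    using weak_Hopf_imp_wmha H unfolding weak_Hopf_structure_iff by blast
next
  assume "regular_weak_multiplier_Hopf_algebra \<Delta>' \<and> (\<exists>u::'b. is_one u)"
  then obtain u :: 'b and \<epsilon> E F\<^sub>1 F\<^sub>2 where u: "is_one u" and w: "wmha_structure \<Delta>' \<epsilon> E F\<^sub>1 F\<^sub>2"
    unfolding regular_weak_multiplier_Hopf_algebra_def by blast
  note u2 = is_one_tprod[OF u u]
  \<comment> \<open>As A \<otimes> A is unital, each multiplier \<open>\<Delta>' a\<close> comes
    from a unique tensor.\<close>
  define \<Delta>\<^sub>0 where "\<Delta>\<^sub>0 a = unemb (\<Delta>' a)" for a
  have \<Delta>': "\<Delta>' a = emb (\<Delta>\<^sub>0 a)" for a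
    unfolding \<Delta>\<^sub>0_def by (rule emb_unemb[OF u2, symmetric])
  have hom: "clinear \<Delta>'" "\<Delta>' (a * b) = \<Delta>' a * \<Delta>' b" for a b
    using w by (auto simp: wmha_structure_def coproduct_def alg_hom_def)
  interpret unital_comultiplication u \<Delta>\<^sub>0
  proof (rule unital_comultiplication.intro)
    show "is_one u" by (rule u)
    show "\<Delta>\<^sub>0 (a * b) = \<Delta>\<^sub>0 a * \<Delta>\<^sub>0 b" for a b
      using hom(2)[of a b] unfolding \<Delta>' emb_mult[symmetric] emb_inject[OF u2] .
    show "clinear \<Delta>\<^sub>0"
    proof (rule clinearI; rule emb_inject[OF u2, THEN iffD1])
      show "emb (\<Delta>\<^sub>0 (a + b)) = emb (\<Delta>\<^sub>0 a + \<Delta>\<^sub>0 b)" for a b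
        by (simp add: clinear_add[OF clinear_emb[OF clinear_intros(1)]] \<Delta>'[symmetric] clinear_add[OF hom(1)])
      show "emb (\<Delta>\<^sub>0 (c *\<^sub>C a)) = emb (c *\<^sub>C \<Delta>\<^sub>0 a)" for c a
        by (simp add: clinear_scale[OF clinear_emb[OF clinear_intros(1)]] \<Delta>'[symmetric] clinear_scale[OF hom(1)])
    qed
  qed
  have "\<Delta>' = (\<lambda>a. emb (\<Delta>\<^sub>0 a))"
    using \<Delta>' by blast
  then show "\<exists>\<Delta>\<^sub>0. (\<forall>a. \<Delta>' a = emb (\<Delta>\<^sub>0 a)) \<and> weak_Hopf_algebra \<Delta>\<^sub>0"
    using wmha_imp_weak_Hopf w \<Delta>' by blast
qed

end
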